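(* Let $R_5:=\frac{5\sqrt5-11}{8}$. For every dissection $D$ of the unit square into five nondegenerate triangles (T-junctions allowed), one has $$R(D)\ge R_5 .$$ Equality is attainable, i.e. there exists a dissection $D$ of the unit square into five nondegenerate triangles with $R(D)=R_5$. Moreover, if $D$ is a dissection of the unit square into five nondegenerate triangles with $R(D)=R_5$, then the multiset of the areas of its five triangles is $$\{m,m,m,M,M\},\qquad m=\frac{3-\sqrt5}{4},\qquad M=\frac{3\sqrt5-5}{8}.$$
   Context: A dissection of the unit square $[0,1]^2$ into $n$ triangles is a collection of $n$ nondegenerate (positive-area) closed triangles with pairwise disjoint interiors whose union is the square. It need not be a simplicial triangulation: T-junctions are allowed, i.e. a vertex of one triangle may lie in the relative interior of a side of another triangle. If $D$ is a dissection whose triangles have areas $a_1,\dots,a_n$, its area range is $R(D)=\max_i a_i-\min_i a_i$. *)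

theory Defs
  imports "HOL-Analysis.Analysis" "HOL-Library.Multiset"
begin

definition unit_square :: "(real^2) set" where
  "unit_square = {x. \<forall>i. 0 \<le> x $ i \<and> x $ i \<le> 1}"

abbreviation area :: "(real^2) set \<Rightarrow> real" where
  "area \<equiv> measure lebesgue"

definition nondegenerate_triangle :: "(real^2) set \<Rightarrow> bool" where
  "nondegenerate_triangle T \<longleftrightarrow> (\<exists>a b c. T = convex hull {a, b, c}) \<and> area T > 0"

(* A set of triangles suffices: distinct members of an indexed family with disjoint interiors
   are different sets, as each has nonempty interior.  Nothing is required about how two
   triangles meet, so T-junctions are allowed. *)
definition triangle_dissection :: "nat \<Rightarrow> (real^2) set set \<Rightarrow> bool" where
  "triangle_dissection n D \<longleftrightarrow>
     finite D \<and> card D = n \<and>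
     (\<forall>T\<in>D. nondegenerate_triangle T) \<and>
     pairwise (\<lambda>S T. interior S \<inter> interior T = {}) D \<and>
     \<Union>D = unit_square"

definition areas :: "(real^2) set set \<Rightarrow> real multiset" where
  "areas D = image_mset area (mset_set D)"

definition area_range :: "(real^2) set set \<Rightarrow> real" where
  "area_range D = Max (area ` D) - Min (area ` D)"

definition R5 :: real where
  "R5 = (5 * sqrt 5 - 11) / 8"

end

theory Submission
  imports Defs
begin

text \<open>If the area range is at most \<open>R5\<close>, every doubled area lies within \<open>(4/5) * 2 * R5\<close> of
  \<open>2/5\<close>. A triangle with an edge on a side of the square has height at most 1, so that edge is longer
  than \<open>1/3\<close>: each side of the square is either an edge of one triangle or split between two.
  The bound rests on one inequality. If three of the triangles have doubled areas \<open>x, y, z\<close> with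
  \<open>z \<le> (1 - x) * (1 - y)\<close>, then the smallest of the three cannot exceed the root \<open>k\<close> of
  \<open>(1 - k)^2 = k\<close>, while the sum of all five areas forces it to be at least \<open>k\<close>; so all
  three equal \<open>k\<close>. Such a triple appears when two triangles cut the lengths \<open>x\<close> and \<open>y\<close> off two
  adjacent sides and a third one has the remainder of one side as base and the other remainder as a
  bound for its height. In every configuration without such a triple, only five triangles are available to
  lie along the far side of each interior edge, and this leads to a contradiction.\<close>

section \<open>Triangles and dissections\<close>

text \<open>The bound and the uniqueness are one statement, \<open>near_optimal\<close>: a range of
  at most \<open>R5\<close> already forces the extremal areas. Since these areas have range exactly
  \<open>R5\<close>, no smaller range occurs. The constant comes from
  \<open>k = (3 - sqrt 5) / 2\<close>: three triangles of doubled area \<open>k\<close> leave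
  \<open>2 - 3 * k\<close> for the other two, so \<open>1 - 3 * k / 2\<close> for each, and
  \<open>2 * R5\<close> is the gap \<open>1 - 5 * k / 2\<close>. The obstacle is that T-junctions
  leave no short list of combinatorial types to run through. Only local facts are used instead:
  distinct triangles are separated by a line, so triangles sharing a segment lie on opposite sides
  of it; and at each end of an edge inside the square some other triangle has an edge on the same
  line. A triangle has only three edges to offer, and triangles on the same side of a line cannot
  overlap along it. The area bounds decide which triangle can reach which edge.\<close>

definition pt :: "real \<Rightarrow> real \<Rightarrow> real^2" where
  "pt x y = vector [x, y]"

definition tri :: "real^2 \<Rightarrow> real^2 \<Rightarrow> real^2 \<Rightarrow> (real^2) set" where
  "tri a b c = convex hull {a, b, c}"

text \<open>Twice the signed area of the triangle. For two fixed distinct points it is an affine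
  function of the third that vanishes exactly on their line, so areas, incidences and sides of lines
  all become statements about the size or sign of \<open>cr\<close>.\<close>

definition cr :: "real^2 \<Rightarrow> real^2 \<Rightarrow> real^2 \<Rightarrow> real" where
  "cr a b c = (b$1 - a$1) * (c$2 - a$2) - (b$2 - a$2) * (c$1 - a$1)"

lemma pt_nth [simp]: "pt x y $ 1 = x" "pt x y $ 2 = y"
  by (simp_all add: pt_def)

lemma vec2_eq_iff: "p = q \<longleftrightarrow> p$1 = q$1 \<and> p$2 = q$2" for p q :: "real^2"
  by (simp add: vec_eq_iff forall_2)

abbreviation "SW \<equiv> pt 0 0"
abbreviation "SE \<equiv> pt 1 0"
abbreviation "NE \<equiv> pt 1 1"
abbreviation "NW \<equiv> pt 0 1"

text \<open>As with \<open>pt\<close> for the bottom, the first argument runs along the side and the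
  second is the depth into the square. \<open>left_side\<close> and \<open>top_side\<close> reverse
  orientation; \<open>right_side\<close> is a rotation.\<close>

abbreviation "left_side \<equiv> (\<lambda>x y. pt y x)"
abbreviation "top_side \<equiv> (\<lambda>x y. pt x (1 - y))"
abbreviation "right_side \<equiv> (\<lambda>x y. pt (1 - y) x)"

lemma pt_eq_iff [simp]: "pt x y = pt x' y' \<longleftrightarrow> x = x' \<and> y = y'"
  by (simp add: vec2_eq_iff)

lemma pt_collapse [simp]: "pt (p$1) (p$2) = p"
  by (simp add: vec2_eq_iff)

lemma tri_mem:
  "p \<in> tri a b c \<longleftrightarrow> (\<exists>\<alpha> \<beta> \<gamma>. 0 \<le> \<alpha> \<and> 0 \<le> \<beta> \<and> 0 \<le> \<gamma> \<and> \<alpha> + \<beta> + \<gamma> = 1 \<and>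
     p = \<alpha> *\<^sub>R a + \<beta> *\<^sub>R b + \<gamma> *\<^sub>R c)"
  by (auto simp: tri_def convex_hull_3)

lemma tri_vertices [simp]: "a \<in> tri a b c" "b \<in> tri a b c" "c \<in> tri a b c"
  by (auto simp: tri_def hull_inc)

lemma tri_perm: "tri a b c = tri b c a" "tri a b c = tri b a c"
  by (simp_all add: tri_def insert_commute)

lemma convex_tri: "convex (tri a b c)" by (simp add: tri_def)
lemma compact_tri: "compact (tri a b c)" by (simp add: tri_def compact_convex_hull)
lemma closed_tri: "closed (tri a b c)" by (simp add: compact_tri compact_imp_closed)

lemma tri_subset: "convex S \<Longrightarrow> a \<in> S \<Longrightarrow> b \<in> S \<Longrightarrow> c \<in> S \<Longrightarrow> tri a b c \<subseteq> S"
  unfolding tri_def by (intro hull_minimal) auto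

lemma cr_affine:
  assumes "\<alpha> + \<beta> + \<gamma> = 1"
  shows "cr u v (\<alpha> *\<^sub>R a + \<beta> *\<^sub>R b + \<gamma> *\<^sub>R c) = \<alpha> * cr u v a + \<beta> * cr u v b + \<gamma> * cr u v c"
  using assms unfolding cr_def vector_add_component vector_scaleR_component real_scaleR_def by algebra

lemma cr_line: "cr u v (p + t *\<^sub>R (q - p)) = (1 - t) * cr u v p + t * cr u v q"
  by (simp add: cr_def algebra_simps)

lemma cr_self [simp]: "cr u v u = 0" "cr u v v = 0" "cr u u p = 0"
  by (simp_all add: cr_def)

lemma cr_rot: "cr a b c = cr b c a" "cr a b c = - cr b a c"
  by (simp_all add: cr_def algebra_simps)

lemma area_tri: "area (tri a b c) = \<bar>cr a b c\<bar> / 2"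
proof -
  have "area (tri a b c) = measure lborel (convex hull {a, b, c})"
    unfolding tri_def by (simp add: measure_completion borel_compact compact_convex_hull)
  then show ?thesis
    by (simp add: content_triangle cr_def algebra_simps abs_minus_commute)
qed

lemma dissection_tri:
  assumes "triangle_dissection n D" "X \<in> D"
  obtains a b c where "X = tri a b c" "cr a b c \<noteq> 0"
proof -
  from assms have "nondegenerate_triangle X" by (auto simp: triangle_dissection_def)
  then obtain a b c where "X = tri a b c" "area X > 0"
    by (auto simp: nondegenerate_triangle_def tri_def)
  then show thesis using that by (auto simp: area_tri)
qed

lemma dissection_cr:
  assumes "triangle_dissection n D" "tri a b c \<in> D"
  shows "cr a b c \<noteq> 0"
proof -
  from assms have "area (tri a b c) > 0"
    by (auto simp: triangle_dissection_def nondegenerate_triangle_def)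
  then show ?thesis by (auto simp: area_tri)
qed

text \<open>Both coordinates of \<open>v - u\<close> annihilate \<open>cr a b c\<close>, and one of
  them is nonzero.\<close>

lemma cr_collinear:
  assumes "u \<noteq> v" "cr u v a = 0" "cr u v b = 0" "cr u v c = 0"
  shows "cr a b c = 0"
proof -
  have "(v$1 - u$1) * cr a b c = 0" "(v$2 - u$2) * cr a b c = 0"
    using assms(2-4) unfolding cr_def by algebra+
  then show ?thesis using assms(1) by (auto simp: vec2_eq_iff)
qed

lemma not_collinear_cr: assumes "cr a b c \<noteq> 0" shows "\<not> collinear {a, b, c}"
proof
  assume "collinear {a, b, c}"
  then obtain u where u: "\<forall>x\<in>{a, b, c}. \<forall>y\<in>{a, b, c}. \<exists>k. x - y = k *\<^sub>R u"
    unfolding collinear_def by blast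
  then obtain k l where "b - a = k *\<^sub>R u" "c - a = l *\<^sub>R u" by blast
  then have "b$1 - a$1 = k * u$1" "b$2 - a$2 = k * u$2" "c$1 - a$1 = l * u$1" "c$2 - a$2 = l * u$2"
    by (metis vector_minus_component vector_scaleR_component real_scaleR_def)+
  then have "cr a b c = 0" by (simp add: cr_def)
  with assms show False by simp
qed

lemma tri_interior:
  assumes "cr a b c \<noteq> 0" "0 < \<alpha>" "0 < \<beta>" "0 < \<gamma>" "\<alpha> + \<beta> + \<gamma> = 1"
  shows "\<alpha> *\<^sub>R a + \<beta> *\<^sub>R b + \<gamma> *\<^sub>R c \<in> interior (tri a b c)"
  unfolding tri_def
  by (subst interior_convex_hull_3_minimal) (use not_collinear_cr[OF assms(1)] assms in \<open>auto\<close>)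

lemma tri_interior_ne: "cr a b c \<noteq> 0 \<Longrightarrow> interior (tri a b c) \<noteq> {}"
  using tri_interior[of a b c "1/3" "1/3" "1/3"] by auto

lemma unit_square_iff: "p \<in> unit_square \<longleftrightarrow> 0 \<le> p$1 \<and> p$1 \<le> 1 \<and> 0 \<le> p$2 \<and> p$2 \<le> 1"
  by (auto simp: unit_square_def forall_2)

lemma dissection_subset: "triangle_dissection n D \<Longrightarrow> X \<in> D \<Longrightarrow> p \<in> X \<Longrightarrow> p \<in> unit_square"
  by (auto simp: triangle_dissection_def)

lemma dissection_cover: "triangle_dissection n D \<Longrightarrow> p \<in> unit_square \<Longrightarrow> \<exists>X\<in>D. p \<in> X"
  by (auto simp: triangle_dissection_def)

section \<open>Separating lines between triangles of a dissection\<close>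

lemma dissection_sep:
  assumes "triangle_dissection n D" "X \<in> D" "Y \<in> D" "X \<noteq> Y"
  obtains a1 a2 k :: real where "a1 \<noteq> 0 \<or> a2 \<noteq> 0"
    "\<And>p. p \<in> X \<Longrightarrow> a1 * p$1 + a2 * p$2 \<le> k" "\<And>p. p \<in> Y \<Longrightarrow> k \<le> a1 * p$1 + a2 * p$2"
proof -
  obtain a b c where X: "X = tri a b c" "cr a b c \<noteq> 0" using dissection_tri assms by metis
  obtain a' b' c' where Y: "Y = tri a' b' c'" "cr a' b' c' \<noteq> 0" using dissection_tri assms by metis
  have disj: "interior X \<inter> interior Y = {}"
    using assms by (auto simp: triangle_dissection_def pairwise_def)
  have "\<exists>a b. a \<noteq> 0 \<and> (\<forall>x\<in>interior X. a \<bullet> x \<le> b) \<and> (\<forall>x\<in>interior Y. b \<le> a \<bullet> x)"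
    using X Y disj by (intro separating_hyperplane_sets) (auto simp: tri_interior_ne convex_interior convex_tri)
  then obtain f k where f: "f \<noteq> 0" "interior X \<subseteq> {x. f \<bullet> x \<le> k}" "interior Y \<subseteq> {x. k \<le> f \<bullet> x}"
    by blast
  \<comment> \<open>A convex set with nonempty interior has the same closure as its interior, so the
    weak inequalities extend from the interiors to the closed triangles.\<close>
  have "closure (interior X) = closure X" "closure (interior Y) = closure Y"
    using X Y by (auto intro!: convex_closure_interior simp: tri_interior_ne convex_tri)
  then have cl: "closure (interior X) = X" "closure (interior Y) = Y"
    using X Y by (auto simp: closed_tri)
  have "closure (interior X) \<subseteq> {x. f \<bullet> x \<le> k}" "closure (interior Y) \<subseteq> {x. k \<le> f \<bullet> x}"
    using f by (auto intro!: closure_minimal closed_halfspace_le closed_halfspace_ge del: subsetI)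
  then have "\<And>p. p \<in> X \<Longrightarrow> f \<bullet> p \<le> k" "\<And>p. p \<in> Y \<Longrightarrow> k \<le> f \<bullet> p"
    using cl by auto
  then show thesis using that[of "f$1" "f$2" k] f(1)
    by (auto simp: inner_vec_def sum_2 vec2_eq_iff)
qed

lemma segment_mem:
  assumes "triangle_dissection n D" "X \<in> D" "p \<in> X" "q \<in> X" "0 \<le> t" "t \<le> 1" shows "p + t *\<^sub>R (q - p) \<in> X"
proof -
  have "convex X" using dissection_tri[OF assms(1,2)] convex_tri by metis
  then have "(1 - t) *\<^sub>R p + t *\<^sub>R q \<in> X" using assms by (simp add: convex_alt)
  moreover have "(1 - t) *\<^sub>R p + t *\<^sub>R q = p + t *\<^sub>R (q - p)" by (simp add: algebra_simps)
  ultimately show ?thesis by simp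
qed

text \<open>The separating functional is at most \<open>c\<close> at \<open>p\<close> and
  \<open>q\<close> but at least \<open>c\<close> at a point strictly between them, hence equal to
  \<open>c\<close> at both. The separating line is thus the line \<open>p q\<close>, and the
  functional is a multiple of \<open>cr p q\<close>.\<close>

lemma separating_cr:
  assumes D: "triangle_dissection n D" and X: "X \<in> D" "Y \<in> D" "X \<noteq> Y"
    and pq: "p \<in> X" "q \<in> X" "p \<noteq> q" and t: "0 < t" "t < 1" "p + t *\<^sub>R (q - p) \<in> Y"
  obtains \<kappa> where "\<kappa> \<noteq> 0" "\<And>z. z \<in> X \<Longrightarrow> \<kappa> * cr p q z \<le> 0" "\<And>z. z \<in> Y \<Longrightarrow> 0 \<le> \<kappa> * cr p q z"
proof -
  obtain a1 a2 c :: real where s: "a1 \<noteq> 0 \<or> a2 \<noteq> 0"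
    "\<And>p. p \<in> X \<Longrightarrow> a1 * p$1 + a2 * p$2 \<le> c" "\<And>p. p \<in> Y \<Longrightarrow> c \<le> a1 * p$1 + a2 * p$2"
    using dissection_sep[OF D X] by metis
  have "c \<le> (1 - t) * (a1 * p$1 + a2 * p$2) + t * (a1 * q$1 + a2 * q$2)"
    using s(3)[OF t(3)] by (simp add: algebra_simps)
  then have "(1 - t) * (c - (a1 * p$1 + a2 * p$2)) + t * (c - (a1 * q$1 + a2 * q$2)) \<le> 0"
    by (simp add: algebra_simps)
  moreover have "0 \<le> (1 - t) * (c - (a1 * p$1 + a2 * p$2))" "0 \<le> t * (c - (a1 * q$1 + a2 * q$2))"
    using s(2)[OF pq(1)] s(2)[OF pq(2)] t by simp_all
  ultimately have "(1 - t) * (c - (a1 * p$1 + a2 * p$2)) = 0" "t * (c - (a1 * q$1 + a2 * q$2)) = 0"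
    by linarith+
  then have pc: "a1 * p$1 + a2 * p$2 = c" and qc: "a1 * q$1 + a2 * q$2 = c" using t by simp_all
  have par: "a1 * (q$1 - p$1) + a2 * (q$2 - p$2) = 0" using pc qc by (simp add: algebra_simps)
  define L where "L = (q$1 - p$1)^2 + (q$2 - p$2)^2"
  have L: "L > 0" using \<open>p \<noteq> q\<close> unfolding L_def by (auto simp: sum_power2_gt_zero_iff vec2_eq_iff)
  define \<kappa> where "\<kappa> = a2 * (q$1 - p$1) - a1 * (q$2 - p$2)"
  \<comment> \<open>By \<open>par\<close> the normal \<open>(a1, a2)\<close> is orthogonal to
    \<open>q - p\<close>. Here \<open>L\<close> is the squared length of \<open>q - p\<close>, and
    \<kappa> is the inner product of the normal with \<open>q - p\<close> turned by a right
    angle.\<close>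
  have *: "L * (a1 * (z$1 - p$1) + a2 * (z$2 - p$2)) = \<kappa> * cr p q z" for z
    using par unfolding L_def \<kappa>_def cr_def by algebra
  have "L * (a1^2 + a2^2) = \<kappa>^2" using par unfolding L_def \<kappa>_def by algebra
  moreover have "a1^2 + a2^2 > 0" using s(1) by (simp add: sum_power2_gt_zero_iff)
  ultimately have \<kappa>: "\<kappa> \<noteq> 0" using L by (metis mult_pos_pos less_irrefl zero_power2)
  show thesis
  proof (rule that[OF \<kappa>])
    fix z assume "z \<in> X"
    then have "a1 * (z$1 - p$1) + a2 * (z$2 - p$2) \<le> 0" using s(2)[of z] pc by (simp add: algebra_simps)
    then show "\<kappa> * cr p q z \<le> 0" unfolding *[symmetric] using L by (simp add: mult_nonneg_nonpos)
  next
    fix z assume "z \<in> Y"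
    then have "0 \<le> a1 * (z$1 - p$1) + a2 * (z$2 - p$2)" using s(3)[of z] pc by (simp add: algebra_simps)
    then show "0 \<le> \<kappa> * cr p q z" unfolding *[symmetric] using L by simp
  qed
qed

lemma opposite_sides_mult:
  assumes "\<kappa> \<noteq> 0" "\<kappa> * a \<le> 0" "0 \<le> \<kappa> * b" shows "a * b \<le> (0::real)"
proof -
  have "\<kappa>^2 * (a * b) = (\<kappa> * a) * (\<kappa> * b)" by algebra
  also have "\<dots> \<le> 0" using assms(2,3) by (rule mult_nonpos_nonneg)
  finally show ?thesis using assms(1) by (simp add: mult_le_0_iff)
qed

lemma common_pair:
  assumes "triangle_dissection n D" "X \<in> D" "Y \<in> D" "X \<noteq> Y"
    "p \<in> X" "p \<in> Y" "q \<in> X" "q \<in> Y" "p \<noteq> q" "a \<in> X" "b \<in> Y"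
  shows "cr p q a * cr p q b \<le> 0"
proof -
  have "p + (1/2) *\<^sub>R (q - p) \<in> Y" using segment_mem[OF assms(1,3,6,8), of "1/2"] by simp
  then obtain \<kappa> where "\<kappa> \<noteq> 0" "\<And>z. z \<in> X \<Longrightarrow> \<kappa> * cr p q z \<le> 0" "\<And>z. z \<in> Y \<Longrightarrow> 0 \<le> \<kappa> * cr p q z"
    using separating_cr[OF assms(1-5,7,9), of "1/2"] by auto
  then show ?thesis using opposite_sides_mult assms(10,11) by blast
qed

text \<open>Excludes a ray of \<open>X\<close> from the common point \<open>V\<close> that runs
  strictly inside the angle \<open>B V C\<close> of \<open>Y\<close>. The separating functional,
  taken relative to \<open>V\<close>, is nonpositive at \<open>A\<close> and nonnegative at
  \<open>B\<close> and \<open>C\<close>, although \<open>A - V\<close> is a positive combination of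
  \<open>B - V\<close> and \<open>C - V\<close>. The factor \<open>k\<close> only accounts for
  orientation.\<close>

lemma cone_disjoint:
  assumes "triangle_dissection n D" "X \<in> D" "Y \<in> D" "X \<noteq> Y"
    "V \<in> X" "A \<in> X" "V \<in> Y" "B \<in> Y" "C \<in> Y"
    "0 < k * cr V B A" "0 < k * cr V A C" "0 < k * cr V B C"
  shows False
proof -
  obtain a1 a2 c :: real where s: "a1 \<noteq> 0 \<or> a2 \<noteq> 0"
    "\<And>p. p \<in> X \<Longrightarrow> a1 * p$1 + a2 * p$2 \<le> c" "\<And>p. p \<in> Y \<Longrightarrow> c \<le> a1 * p$1 + a2 * p$2"
    using dissection_sep assms by metis
  have Vk: "a1 * V$1 + a2 * V$2 = c" using s assms by (auto intro!: antisym)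
  define f where "f p = a1 * (p$1 - V$1) + a2 * (p$2 - V$2)" for p :: "real^2"
  have fA: "f A \<le> 0" and fB: "0 \<le> f B" and fC: "0 \<le> f C"
    using s(2)[of A] s(3)[of B] s(3)[of C] assms Vk by (auto simp: algebra_simps f_def)
  have "(k * cr V A C) * f B + (k * cr V B A) * f C = (k * cr V B C) * f A"
    unfolding f_def cr_def by algebra
  moreover have "0 \<le> (k * cr V A C) * f B" "0 \<le> (k * cr V B A) * f C" "(k * cr V B C) * f A \<le> 0"
    using assms fA fB fC by (auto intro: mult_nonneg_nonneg mult_nonneg_nonpos)
  ultimately have "(k * cr V A C) * f B = 0" "(k * cr V B A) * f C = 0" by linarith+
  then have "f B = 0" "f C = 0" using assms by auto
  then have "a1 * cr V B C = 0" "a2 * cr V B C = 0" unfolding f_def cr_def by algebra+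
  then show False using s(1) assms by auto
qed

text \<open>The triangle lies on one side of the line, so any of its points on the line has weight
  only on vertices on the line. Two distinct such points need two such vertices; nondegeneracy keeps
  the third vertex off the line.\<close>

lemma edge_extract:
  assumes "cr a b c \<noteq> 0" "u \<noteq> v" "p \<in> tri a b c" "q \<in> tri a b c" "p \<noteq> q"
    "k * cr u v a \<le> 0" "k * cr u v b \<le> 0" "k * cr u v c \<le> 0" "k \<noteq> 0"
    "cr u v p = 0" "cr u v q = 0"
  shows "(cr u v a = 0 \<and> cr u v b = 0 \<and> k * cr u v c < 0) \<or>
         (cr u v b = 0 \<and> cr u v c = 0 \<and> k * cr u v a < 0) \<or>
         (cr u v c = 0 \<and> cr u v a = 0 \<and> k * cr u v b < 0)"
proof -
  have coef: "\<alpha> * (k * cr u v a) = 0 \<and> \<beta> * (k * cr u v b) = 0 \<and> \<gamma> * (k * cr u v c) = 0"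
    if "0 \<le> \<alpha>" "0 \<le> \<beta>" "0 \<le> \<gamma>" "\<alpha> + \<beta> + \<gamma> = 1" "cr u v (\<alpha> *\<^sub>R a + \<beta> *\<^sub>R b + \<gamma> *\<^sub>R c) = 0" for \<alpha> \<beta> \<gamma>
  proof -
    have "\<alpha> * cr u v a + \<beta> * cr u v b + \<gamma> * cr u v c = 0" using that cr_affine by metis
    then have "\<alpha> * (k * cr u v a) + \<beta> * (k * cr u v b) + \<gamma> * (k * cr u v c) = 0" by algebra
    moreover have "\<alpha> * (k * cr u v a) \<le> 0" "\<beta> * (k * cr u v b) \<le> 0" "\<gamma> * (k * cr u v c) \<le> 0"
      using that assms by (auto intro: mult_nonneg_nonpos)
    ultimately show ?thesis by linarith
  qed
  obtain \<alpha> \<beta> \<gamma> where p: "0 \<le> \<alpha>" "0 \<le> \<beta>" "0 \<le> \<gamma>" "\<alpha> + \<beta> + \<gamma> = 1" "p = \<alpha> *\<^sub>R a + \<beta> *\<^sub>R b + \<gamma> *\<^sub>R c"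
    using assms tri_mem by metis
  obtain \<alpha>' \<beta>' \<gamma>' where q: "0 \<le> \<alpha>'" "0 \<le> \<beta>'" "0 \<le> \<gamma>'" "\<alpha>' + \<beta>' + \<gamma>' = 1" "q = \<alpha>' *\<^sub>R a + \<beta>' *\<^sub>R b + \<gamma>' *\<^sub>R c"
    using assms tri_mem by metis
  have cp: "\<alpha> * (k * cr u v a) = 0 \<and> \<beta> * (k * cr u v b) = 0 \<and> \<gamma> * (k * cr u v c) = 0"
    using coef[OF p(1-4)] assms p(5) by auto
  have cq: "\<alpha>' * (k * cr u v a) = 0 \<and> \<beta>' * (k * cr u v b) = 0 \<and> \<gamma>' * (k * cr u v c) = 0"
    using coef[OF q(1-4)] assms q(5) by auto
  have "\<not> (cr u v a = 0 \<and> cr u v b = 0 \<and> cr u v c = 0)"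
    using cr_collinear assms by blast
  moreover have "\<not> (cr u v a \<noteq> 0 \<and> cr u v b \<noteq> 0)"
    using cp cq p q \<open>k \<noteq> 0\<close> \<open>p \<noteq> q\<close> by auto
  moreover have "\<not> (cr u v b \<noteq> 0 \<and> cr u v c \<noteq> 0)"
    using cp cq p q \<open>k \<noteq> 0\<close> \<open>p \<noteq> q\<close> by auto
  moreover have "\<not> (cr u v a \<noteq> 0 \<and> cr u v c \<noteq> 0)"
    using cp cq p q \<open>k \<noteq> 0\<close> \<open>p \<noteq> q\<close> by auto
  ultimately show ?thesis using assms(6-9) by (smt (verit) mult_eq_0_iff)
qed

section \<open>Neighbours across an edge\<close>

lemma infinite_closed_limit:
  fixes x :: "nat \<Rightarrow> 'a::topological_space"
  assumes "closed S" "x \<longlonglongrightarrow> l" "infinite {n. x n \<in> S}" shows "l \<in> S"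
proof (rule ccontr)
  assume "l \<notin> S"
  then have "\<forall>\<^sub>F n in sequentially. x n \<in> - S"
    using assms by (intro topological_tendstoD[of x l]) auto
  then obtain N where "\<And>n. n \<ge> N \<Longrightarrow> x n \<notin> S" by (auto simp: eventually_sequentially)
  then have "{n. x n \<in> S} \<subseteq> {..<N}" by (auto simp: not_le[symmetric])
  then show False using assms(3) finite_subset by blast
qed

text \<open>Points tending to \<open>x\<close> from the side opposite to \<open>w\<close> are
  outside \<open>tri u v w\<close> and eventually inside the square, so the other triangles cover
  them; the finite union of those triangles is closed.\<close>

lemma edge_covered:
  assumes D: "triangle_dissection n D" and T: "tri u v w \<in> D"
    and x: "cr u v x = 0" "0 < x$1" "x$1 < 1" "0 < x$2" "x$2 < 1"
  shows "\<exists>X\<in>D - {tri u v w}. x \<in> X"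
proof -
  define y where "y k = x - (1 / real (Suc k)) *\<^sub>R (w - x)" for k
  have nz: "cr u v w \<noteq> 0" using dissection_cr[OF D T] .
  have "closed (\<Union>(D - {tri u v w}))"
  proof (rule closed_Union)
    show "finite (D - {tri u v w})" using D by (auto simp: triangle_dissection_def)
    show "\<forall>X\<in>D - {tri u v w}. closed X"
      using dissection_tri[OF D] closed_tri by (metis DiffD1)
  qed
  moreover have lim: "y \<longlonglongrightarrow> x"
  proof -
    have "y \<longlonglongrightarrow> x - 0 *\<^sub>R (w - x)"
      unfolding y_def by (intro tendsto_intros LIMSEQ_Suc lim_const_over_n)
    then show ?thesis by simp
  qed
  moreover have "\<forall>\<^sub>F k in sequentially. y k \<in> \<Union>(D - {tri u v w})"
  proof -
    have l: "(\<lambda>k. y k $ i) \<longlonglongrightarrow> x $ i" for i using lim by (rule tendsto_vec_nth)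
    have "\<forall>\<^sub>F k in sequentially. 0 < y k $ 1 \<and> y k $ 1 < 1 \<and> 0 < y k $ 2 \<and> y k $ 2 < 1"
      using order_tendstoD[OF l[of 1]] order_tendstoD[OF l[of 2]] x by (intro eventually_conj) auto
    then show ?thesis
    proof eventually_elim
      case (elim k)
      then have "y k \<in> unit_square" by (simp add: unit_square_iff)
      then obtain X where X: "X \<in> D" "y k \<in> X" using dissection_cover[OF D] by blast
      have "y k = x + (- (1 / real (Suc k))) *\<^sub>R (w - x)" by (simp add: y_def)
      then have c: "cr u v (y k) = - (1 / real (Suc k)) * cr u v w"
        using x(1) by (simp only: cr_line)
      have "y k \<notin> tri u v w"
      proof
        assume "y k \<in> tri u v w"
        then obtain \<alpha> \<beta> \<gamma> where "0 \<le> \<gamma>" "\<alpha> + \<beta> + \<gamma> = 1" "y k = \<alpha> *\<^sub>R u + \<beta> *\<^sub>R v + \<gamma> *\<^sub>R w"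
          using tri_mem by metis
        then have "cr u v (y k) = \<gamma> * cr u v w" using cr_affine by simp
        with c have "(\<gamma> + 1 / real (Suc k)) * cr u v w = 0" by (simp add: algebra_simps)
        with nz have "\<gamma> + 1 / real (Suc k) = 0" by simp
        moreover have "1 / real (Suc k) > 0" by simp
        ultimately show False using \<open>0 \<le> \<gamma>\<close> by linarith
      qed
      with X show ?case by blast
    qed
  qed
  ultimately have "x \<in> \<Union>(D - {tri u v w})"
    using Lim_in_closed_set[OF _ _ trivial_limit_sequentially] by blast
  then show ?thesis by blast
qed

definition on2 where
  "on2 u v a b c \<longleftrightarrow> (cr u v a = 0 \<and> cr u v b = 0) \<or> (cr u v b = 0 \<and> cr u v c = 0) \<or> (cr u v c = 0 \<and> cr u v a = 0)"

text \<open>\<open>nb u v w X\<close> encodes that \<open>X\<close> borders the edge \<open>u v\<close> of the triangle \<open>u v w\<close> from outside, along a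
  segment ending at \<open>v\<close>. By T-junctions the neighbours at \<open>u\<close> and at \<open>v\<close> may differ, hence the
  asymmetry.\<close>

definition nb where
  "nb u v w X \<longleftrightarrow> v \<in> X \<and> (\<exists>t. 0 < t \<and> t < 1 \<and> v + t *\<^sub>R (u - v) \<in> X) \<and>
    (\<forall>p\<in>X. cr u v w * cr u v p \<le> 0) \<and> (\<exists>p\<in>X. cr u v w * cr u v p < 0) \<and>
    (\<forall>a b c. X = tri a b c \<longrightarrow> on2 u v a b c)"

text \<open>The conditions \<open>m\<close> put the midpoint of the edge into the open square, so
  the edge is not on the boundary. Points of the edge tending to \<open>v\<close> are covered by
  other triangles; one of these, \<open>X\<close>, contains infinitely many of them and, being
  closed, also \<open>v\<close>. Two of the points are common to \<open>X\<close> and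
  \<open>tri u v w\<close>, which puts \<open>X\<close> on the far side, and
  \<open>edge_extract\<close> gives it an edge on the line.\<close>

lemma nb_ex:
  assumes D: "triangle_dissection n D" and T: "tri u v w \<in> D"
    and m: "0 < u$1 + v$1" "u$1 + v$1 < 2" "0 < u$2 + v$2" "u$2 + v$2 < 2"
  shows "\<exists>X\<in>D. X \<noteq> tri u v w \<and> nb u v w X"
proof -
  have nz: "cr u v w \<noteq> 0" using dissection_cr[OF D T] .
  then have uv: "u \<noteq> v" by auto
  have us: "u \<in> unit_square" "v \<in> unit_square" using D T dissection_subset tri_vertices by metis+
  define t where "t n = 1 / real (Suc (Suc n))" for n
  have t: "0 < t n" "t n < 1" for n by (auto simp: t_def)
  have tinj: "t n \<noteq> t k" if "n \<noteq> k" for n k using that by (auto simp: t_def)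
  define x where "x n = v + t n *\<^sub>R (u - v)" for n
  have in01: "0 < v$i + t n * (u$i - v$i) \<and> v$i + t n * (u$i - v$i) < 1"
    if "0 \<le> u$i" "u$i \<le> 1" "0 \<le> v$i" "v$i \<le> 1" "0 < u$i + v$i" "u$i + v$i < 2" for n i
  proof -
    have e: "v$i + t n * (u$i - v$i) = (1 - t n) * v$i + t n * u$i" by algebra
    have e': "1 - (v$i + t n * (u$i - v$i)) = (1 - t n) * (1 - v$i) + t n * (1 - u$i)" by algebra
    have "0 < (1 - t n) * v$i + t n * u$i"
    proof (cases "v$i = 0")
      case True then show ?thesis using that t[of n] by simp
    next
      case False then show ?thesis using that t[of n] by (intro add_pos_nonneg mult_pos_pos mult_nonneg_nonneg) auto
    qed
    moreover have "0 < (1 - t n) * (1 - v$i) + t n * (1 - u$i)"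
    proof (cases "v$i = 1")
      case True then show ?thesis using that t[of n] by simp
    next
      case False then show ?thesis using that t[of n] by (intro add_pos_nonneg mult_pos_pos mult_nonneg_nonneg) auto
    qed
    ultimately show ?thesis using e e' by (metis diff_gt_0_iff_gt)
  qed
  have xs: "0 < x n $ 1" "x n $ 1 < 1" "0 < x n $ 2" "x n $ 2 < 1" for n
    using in01[of 1 n] in01[of 2 n] us m by (auto simp: x_def unit_square_iff)
  have c0: "cr u v (x n) = 0" for n unfolding x_def cr_line by simp
  have "\<exists>X\<in>D - {tri u v w}. \<not> finite {n \<in> UNIV. x n \<in> X}"
  proof (rule pigeonhole_infinite_rel)
    show "finite (D - {tri u v w})" using D by (auto simp: triangle_dissection_def)
    show "\<forall>n\<in>UNIV. \<exists>X\<in>D - {tri u v w}. x n \<in> X" using edge_covered[OF D T c0 xs] by auto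
  qed auto
  then obtain X where X: "X \<in> D" "X \<noteq> tri u v w" "infinite {n. x n \<in> X}" by auto
  have "v \<in> X"
  proof (rule infinite_closed_limit[OF _ _ X(3)])
    show "closed X" using dissection_tri[OF D X(1)] closed_tri by metis
    have "t \<longlonglongrightarrow> 0" unfolding t_def by (intro LIMSEQ_Suc lim_const_over_n)
    then have "x \<longlonglongrightarrow> v + 0 *\<^sub>R (u - v)" unfolding x_def by (intro tendsto_intros)
    then show "x \<longlonglongrightarrow> v" by simp
  qed
  obtain i where i: "x i \<in> X" using X(3) by (metis (mono_tags) empty_Collect_eq finite.emptyI)
  have "infinite ({n. x n \<in> X} - {i})" using X(3) by simp
  then obtain j where j: "x j \<in> X" "j \<noteq> i" using finite.emptyI by (metis (mono_tags, lifting) Diff_iff all_not_in_conv mem_Collect_eq singletonI)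
  have xij: "x i \<noteq> x j" using tinj[OF j(2)] uv by (auto simp: x_def)
  have xT: "x n \<in> tri u v w" for n
    unfolding tri_mem x_def using t[of n]
    by (intro exI[of _ "t n"] exI[of _ "1 - t n"] exI[of _ 0]) (auto simp: algebra_simps)
  have side: "cr u v w * cr u v p \<le> 0" if "p \<in> X" for p
  proof -
    have "cr (x i) (x j) p * cr (x i) (x j) w \<le> 0"
      using common_pair[OF D X(1) T X(2) i xT j(1) xT xij that] by simp
    moreover have "cr (x i) (x j) z = (t i - t j) * cr u v z" for z
      unfolding x_def cr_def by (simp add: algebra_simps)
    ultimately have "(t i - t j)^2 * (cr u v w * cr u v p) \<le> 0" by (simp add: power2_eq_square algebra_simps)
    moreover have "(t i - t j)^2 > 0" using tinj[OF j(2)] by simp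
    ultimately show ?thesis by (simp add: mult_le_0_iff)
  qed
  have ed: "(cr u v a = 0 \<and> cr u v b = 0 \<and> cr u v w * cr u v c < 0) \<or>
      (cr u v b = 0 \<and> cr u v c = 0 \<and> cr u v w * cr u v a < 0) \<or>
      (cr u v c = 0 \<and> cr u v a = 0 \<and> cr u v w * cr u v b < 0)" if X': "X = tri a b c" for a b c
  proof (rule edge_extract[where p = "x i" and q = "x j"])
    show "cr a b c \<noteq> 0" using dissection_cr[OF D] X(1) unfolding X' .
    show "x i \<in> tri a b c" "x j \<in> tri a b c" using i j(1) unfolding X' .
  qed (use side X' in \<open>auto simp: uv xij nz c0\<close>)
  obtain a b c where abc: "X = tri a b c" using dissection_tri[OF D X(1)] by metis
  have "a \<in> X" "b \<in> X" "c \<in> X" unfolding abc by simp_all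
  then have "\<exists>p\<in>X. cr u v w * cr u v p < 0" using ed[OF abc] by blast
  moreover have "\<forall>a b c. X = tri a b c \<longrightarrow> on2 u v a b c" using ed unfolding on2_def by blast
  moreover have "\<exists>t. 0 < t \<and> t < 1 \<and> v + t *\<^sub>R (u - v) \<in> X" using i t[of i] unfolding x_def by blast
  ultimately have "nb u v w X" unfolding nb_def using \<open>v \<in> X\<close> side by blast
  then show ?thesis using X(1,2) by blast
qed

section \<open>Dissections with small area range\<close>

text \<open>With the factor 2 the area is base times height, so a triangle standing on a whole side
  of the square has its height as area.\<close>

definition area2 :: "(real^2) set \<Rightarrow> real" where
  "area2 X = 2 * area X"

lemma area2_tri: "area2 (tri a b c) = \<bar>cr a b c\<bar>"
  by (simp add: area2_def area_tri)

lemma unit_square_cbox: "unit_square = cbox 0 1"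
  by (auto simp: unit_square_def mem_box_cart)

lemma dissection_area_sum:
  assumes "triangle_dissection n D" shows "(\<Sum>X\<in>D. area X) = 1"
proof -
  have "measure lebesgue (\<Union>D) = (\<Sum>X\<in>D. area X)"
  proof (rule measure_negligible_finite_Union)
    show "finite D" using assms by (auto simp: triangle_dissection_def)
    fix X assume "X \<in> D"
    then show "X \<in> lmeasurable" using dissection_tri[OF assms] compact_tri lmeasurable_compact by metis
  next
    show "pairwise (\<lambda>S T. negligible (S \<inter> T)) D"
    proof (rule pairwiseI)
      fix X Y assume XY: "X \<in> D" "Y \<in> D" "X \<noteq> Y"
      have "convex X" "convex Y" using dissection_tri[OF assms] convex_tri XY by metis+
      moreover have "interior (X \<inter> Y) = {}"
        using XY assms by (auto simp: triangle_dissection_def pairwise_def)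
      ultimately show "negligible (X \<inter> Y)" by (simp add: negligible_convex_interior convex_Int)
    qed
  qed
  moreover have "measure lebesgue unit_square = 1"
    unfolding unit_square_cbox by (simp add: measure_completion content_cbox_cart cbox_interval[symmetric] interval_eq_empty_cart)
  ultimately show ?thesis using assms by (simp add: triangle_dissection_def)
qed

definition near :: "(real^2) set set \<Rightarrow> bool" where
  "near D \<longleftrightarrow> triangle_dissection 5 D \<and> area_range D \<le> R5"

definition optimal :: "(real^2) set set \<Rightarrow> bool" where
  "optimal D \<longleftrightarrow> areas D = {# (3 - sqrt 5) / 4, (3 - sqrt 5) / 4, (3 - sqrt 5) / 4,
     (3 * sqrt 5 - 5) / 8, (3 * sqrt 5 - 5) / 8 #}"

lemma near_dissection: "near D \<Longrightarrow> triangle_dissection 5 D" by (simp add: near_def)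

lemma near_finite: "near D \<Longrightarrow> finite D" "near D \<Longrightarrow> card D = 5"
  by (auto simp: near_def triangle_dissection_def)

lemma near_diff: assumes "near D" "X \<in> D" "Y \<in> D" shows "area2 X - area2 Y \<le> 2 * R5"
proof -
  have "area X \<le> Max (area ` D)" "Min (area ` D) \<le> area Y"
    using near_finite[OF assms(1)] assms by auto
  then show ?thesis using assms(1) by (auto simp: near_def area_range_def area2_def)
qed

lemma near_sum: assumes "near D" shows "(\<Sum>X\<in>D. area2 X) = 2"
  using dissection_area_sum[OF near_dissection[OF assms]] by (simp add: area2_def sum_distrib_left[symmetric])

lemma sqrt5_bounds: "2236/1000 < sqrt (5::real)" "sqrt (5::real) < 22361/10000"
  by (rule real_less_rsqrt, simp add: power2_eq_square) (rule real_less_lsqrt, simp_all add: power2_eq_square)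

text \<open>Comparing \<open>X\<close> with the four others, whose doubled areas complete its own to
  2, shows that \<open>5 * area2 X\<close> differs from 2 by at most \<open>8 * R5\<close>. The
  decimals are rounded outward; they and their complements 0.6361 and 0.5639 recur in all later
  estimates.\<close>

lemma near_bounds: assumes "near D" "X \<in> D" shows "3639/10000 \<le> area2 X" "area2 X \<le> 4361/10000"
proof -
  have fin: "finite D" "card (D - {X}) = 4" using near_finite[OF assms(1)] assms by auto
  have "sum area2 (D - {X}) \<le> (\<Sum>Y\<in>D - {X}. area2 X + 2 * R5)"
    using near_diff[OF assms(1) _ assms(2)] by (intro sum_mono) (auto simp: algebra_simps)
  moreover have "(\<Sum>Y\<in>D - {X}. area2 X - 2 * R5) \<le> sum area2 (D - {X})"
    using near_diff[OF assms(1,2)] by (intro sum_mono) (auto simp: algebra_simps)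
  moreover have "area2 X + sum area2 (D - {X}) = 2"
    using near_sum[OF assms(1)] sum.remove[OF fin(1) assms(2), of area2] by simp
  ultimately have "2 \<le> 5 * area2 X + 8 * R5" "5 * area2 X - 8 * R5 \<le> 2" using fin(2) by auto
  then show "3639/10000 \<le> area2 X" "area2 X \<le> 4361/10000" using sqrt5_bounds unfolding R5_def by (auto simp: field_simps)
qed

text \<open>The first premise on \<open>k\<close> is \<open>(1 - k)^2 = k\<close>, and the last premise is the total area 2 with the two
  other triangles at most \<open>\<mu> + 2 * R5 = \<mu> + 1 - 5 * k / 2\<close>. If \<open>\<mu> < k\<close>, then with \<open>w = sqrt \<mu>\<close> AM-GM
  gives \<open>x * y \<le> (1 - w)^2\<close>, hence \<open>x + y + z + 2 * \<mu> \<le> 2 - 2 * w + 3 * w^2\<close>; the right-hand side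
  increases in \<open>w\<close> and equals \<open>5 * k\<close> at \<open>w = 1 - k\<close>.\<close>

lemma key_arith:
  fixes x y z \<mu> k :: real
  assumes k: "k^2 = 3 * k - 1" "38/100 < k" "k < 382/1000"
    and z: "z \<le> (1 - x) * (1 - y)" and \<mu>: "36/100 \<le> \<mu>" "\<mu> \<le> x" "\<mu> \<le> y" "\<mu> \<le> z"
    and lt: "x < 1" "y < 1" and s: "5 * k \<le> x + y + z + 2 * \<mu>"
  shows "x = k \<and> y = k \<and> z = k"
proof (cases "k \<le> \<mu>")
  \<comment> \<open>Here \<open>z <= (1 - x) * (1 - y) <= (1 - k)^2 = k <= z\<close>, so equality
    holds throughout, and a strict \<open>x > k\<close> or \<open>y > k\<close> would destroy
    it.\<close>
  case True
  have kk: "(1 - k) * (1 - k) = k" using k by algebra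
  have "(1 - x) * (1 - y) \<le> (1 - k) * (1 - k)" using True \<mu> lt by (intro mult_mono) auto
  then have zk: "z = k" "(1 - x) * (1 - y) = k" using z \<mu> True kk by linarith+
  have "\<not> x > k"
  proof
    assume "x > k"
    then have "(1 - x) * (1 - y) < (1 - k) * (1 - y)" using lt by simp
    also have "\<dots> \<le> (1 - k) * (1 - k)" using True \<mu> k by (intro mult_left_mono) auto
    finally show False using zk kk by simp
  qed
  moreover have "\<not> y > k"
  proof
    assume "y > k"
    then have "(1 - x) * (1 - y) < (1 - x) * (1 - k)" using lt by simp
    also have "\<dots> \<le> (1 - k) * (1 - k)" using True \<mu> k by (intro mult_right_mono) auto
    finally show False using zk kk by simp
  qed
  ultimately show ?thesis using zk True \<mu> by auto
next
  case False
  define w where "w = sqrt \<mu>"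
  define g where "g = sqrt (x * y)"
  have w: "w^2 = \<mu>" "0 \<le> w" "6/10 \<le> w" using \<mu> unfolding w_def
    using real_le_rsqrt[of "6/10" \<mu>] by (auto simp: power2_eq_square)
  have g: "g^2 = x * y" "0 \<le> g" using \<mu> unfolding g_def by auto
  have "g < 1" using mult_strict_mono[OF lt] \<mu> lt unfolding g_def by (auto intro!: real_less_lsqrt)
  have "2 * g \<le> x + y" using arith_geo_mean_sqrt[of x y] \<mu> unfolding g_def by simp
  then have "\<mu> \<le> (1 - g)^2" using z \<mu> g(1) by (simp add: power2_eq_square algebra_simps)
  then have "w^2 \<le> (1 - g)^2" using w by simp
  then have "g \<le> 1 - w" using \<open>g < 1\<close> w by (metis diff_ge_0_iff_ge less_eq_real_def power2_le_imp_le le_diff_eq add.commute)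
  then have "g^2 \<le> (1 - w)^2" using g by (intro power_mono) auto
  then have *: "5 * k \<le> 2 - 2 * w + 3 * w^2"
    using s z g(1) w(1) by (simp add: power2_eq_square algebra_simps)
  have e: "5 * k = 2 - 2 * (1 - k) + 3 * (1 - k)^2" using k by algebra
  have "w^2 < (1 - k)^2" using False w k by (simp add: power2_eq_square algebra_simps)
  then have "w < 1 - k" using k power2_less_imp_less[of w "1 - k"] by simp
  \<comment> \<open>The product is \<open>f (1 - k) - f w\<close> for
    \<open>f w = 2 - 2 * w + 3 * w^2\<close>; its second factor is positive because \<open>w\<close>
    and \<open>1 - k\<close> are both at least 6/10.\<close>
  then have "0 < (1 - k - w) * (3 * (1 - k + w) - 2)" using w k by (intro mult_pos_pos) auto
  then show ?thesis using * e by (simp add: power2_eq_square algebra_simps)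
qed

lemma near_key:
  assumes D: "near D" and XYZ: "X \<in> D" "Y \<in> D" "Z \<in> D" "X \<noteq> Y" "Y \<noteq> Z" "X \<noteq> Z"
    and z: "area2 Z \<le> (1 - area2 X) * (1 - area2 Y)"
  shows "optimal D"
proof -
  have "card {X, Y, Z} = 3" using XYZ by simp
  moreover have sub: "{X, Y, Z} \<subseteq> D" using XYZ by simp
  ultimately have "card (D - {X, Y, Z}) = 2"
    using near_finite[OF D] by (simp add: card_Diff_subset)
  then have "\<exists>U V. D - {X, Y, Z} = {U, V} \<and> U \<noteq> V" unfolding card_2_iff .
  then obtain U V where UV: "D - {X, Y, Z} = {U, V}" "U \<noteq> V" by (elim exE conjE)
  have "D = {X, Y, Z} \<union> (D - {X, Y, Z})" using Diff_partition[OF sub] by (rule sym)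
  then have De: "D = {U, V, X, Y, Z}" unfolding UV(1) by simp
  have "U \<in> D - {X, Y, Z}" "V \<in> D - {X, Y, Z}" unfolding UV(1) by simp_all
  then have UVn: "U \<notin> {X, Y, Z}" "V \<notin> {X, Y, Z}" by simp_all
  have "area2 U + (area2 V + (area2 X + (area2 Y + area2 Z))) = 2"
    using near_sum[OF D] UV(2) UVn XYZ(4-6) unfolding De by simp
  then have sum: "area2 X + area2 Y + area2 Z + area2 U + area2 V = 2" by linarith
  define k where "k = (3 - sqrt 5) / 2"
  have s5: "(sqrt 5)^2 = (5::real)" by simp
  have k: "k^2 = 3 * k - 1" using s5 unfolding k_def by (simp add: power2_eq_square field_simps)
  have kb: "38/100 < k" "k < 382/1000" unfolding k_def using sqrt5_bounds by auto
  have R: "2 * R5 = 1 - 5 * k / 2" unfolding k_def R5_def by (simp add: field_simps)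
  define \<mu> where "\<mu> = min (area2 X) (min (area2 Y) (area2 Z))"
  have \<mu>: "\<mu> \<le> area2 X" "\<mu> \<le> area2 Y" "\<mu> \<le> area2 Z" unfolding \<mu>_def by linarith+
  have \<mu>c: "\<mu> = area2 X \<or> \<mu> = area2 Y \<or> \<mu> = area2 Z" unfolding \<mu>_def by linarith
  have UVin: "U \<in> D" "V \<in> D" unfolding De by simp_all
  have U: "area2 U \<le> \<mu> + 2 * R5" "area2 V \<le> \<mu> + 2 * R5"
    using \<mu>c near_diff[OF D UVin(1) XYZ(1)] near_diff[OF D UVin(1) XYZ(2)] near_diff[OF D UVin(1) XYZ(3)]
     near_diff[OF D UVin(2) XYZ(1)] near_diff[OF D UVin(2) XYZ(2)] near_diff[OF D UVin(2) XYZ(3)] by linarith+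
  have "5 * k \<le> area2 X + area2 Y + area2 Z + 2 * \<mu>" using sum R U by linarith
  moreover have "36/100 \<le> \<mu>"
    using near_bounds(1)[OF D XYZ(1)] near_bounds(1)[OF D XYZ(2)] near_bounds(1)[OF D XYZ(3)] \<mu>c by linarith
  moreover have "area2 X < 1" "area2 Y < 1"
    using near_bounds(2)[OF D XYZ(1)] near_bounds(2)[OF D XYZ(2)] by linarith+
  ultimately have eq: "area2 X = k" "area2 Y = k" "area2 Z = k"
    using key_arith[OF k kb z _ \<mu>] by auto
  have "\<mu> = k" using \<mu>c eq by linarith
  \<comment> \<open>Each of the two is at most \<open>1 - 3 * k / 2\<close>, and together they
    amount to \<open>2 - 3 * k\<close>, so both attain the bound.\<close>
  then have "area2 U = 1 - 3 * k / 2" "area2 V = 1 - 3 * k / 2" using sum U eq R by linarith+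
  then have ar: "area X = (3 - sqrt 5) / 4" "area Y = (3 - sqrt 5) / 4" "area Z = (3 - sqrt 5) / 4"
    "area U = (3 * sqrt 5 - 5) / 8" "area V = (3 * sqrt 5 - 5) / 8"
    using eq unfolding area2_def k_def by (simp_all add: field_simps)
  have De': "areas D = {#area U, area V, area X, area Y, area Z#}"
    using UV(2) UVn XYZ(4-6) unfolding areas_def De by simp
  show ?thesis unfolding optimal_def De' ar by (simp add: add_mset_commute)
qed

section \<open>Symmetries of the square\<close>

definition swap_xy :: "real^2 \<Rightarrow> real^2" where "swap_xy p = pt (p$2) (p$1)"
definition flip_x :: "real^2 \<Rightarrow> real^2" where "flip_x p = pt (1 - p$1) (p$2)"

lemma swap_xy_pt [simp]: "swap_xy (pt x y) = pt y x" by (simp add: swap_xy_def)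
lemma flip_x_pt [simp]: "flip_x (pt x y) = pt (1 - x) y" by (simp add: flip_x_def)

text \<open>Being an involution, \<open>f\<close> is its own inverse, which keeps membership in
  images simple. The reflections \<open>swap_xy\<close> and \<open>flip_x\<close> generate all
  symmetries of the square; the remaining ones are reached by iterating \<open>img\<close>.\<close>

definition square_sym :: "(real^2 \<Rightarrow> real^2) \<Rightarrow> bool" where
  "square_sym f \<longleftrightarrow> (\<forall>p. f (f p) = p) \<and> continuous_on UNIV f \<and>
    (\<forall>\<alpha> \<beta> \<gamma> a b c. \<alpha> + \<beta> + \<gamma> = 1 \<longrightarrow> f (\<alpha> *\<^sub>R a + \<beta> *\<^sub>R b + \<gamma> *\<^sub>R c) = \<alpha> *\<^sub>R f a + \<beta> *\<^sub>R f b + \<gamma> *\<^sub>R f c) \<and>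
    (\<forall>a b c. \<bar>cr (f a) (f b) (f c)\<bar> = \<bar>cr a b c\<bar>) \<and> f ` unit_square = unit_square"

lemma continuous_on_pt:
  assumes "continuous_on S g" "continuous_on S h" shows "continuous_on S (\<lambda>p. pt (g p) (h p))"
proof -
  have "pt x y = (\<chi> i. if i = 1 then x else y)" for x y by (simp add: vec2_eq_iff)
  moreover have c: "continuous_on S (\<lambda>p. if i = 1 then g p else h p)" for i :: 2
    using assms by (cases "i = 1") auto
  ultimately show ?thesis using continuous_on_vec_lambda[OF c] by simp
qed

lemma square_sym_swap: "square_sym swap_xy"
proof -
  have "continuous_on UNIV swap_xy" unfolding swap_xy_def by (intro continuous_on_pt continuous_intros)
  moreover have "swap_xy ` unit_square = unit_square"
  proof -
    have "p \<in> swap_xy ` unit_square" if "p \<in> unit_square" for p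
      using that by (intro image_eqI[of _ _ "swap_xy p"]) (auto simp: swap_xy_def unit_square_iff vec2_eq_iff)
    then show ?thesis by (auto simp: swap_xy_def unit_square_iff)
  qed
  moreover have "cr (swap_xy a) (swap_xy b) (swap_xy c) = - cr a b c" for a b c by (simp add: swap_xy_def cr_def algebra_simps)
  moreover have "swap_xy (\<alpha> *\<^sub>R a + \<beta> *\<^sub>R b + \<gamma> *\<^sub>R c) = \<alpha> *\<^sub>R swap_xy a + \<beta> *\<^sub>R swap_xy b + \<gamma> *\<^sub>R swap_xy c"
    if "\<alpha> + \<beta> + \<gamma> = 1" for \<alpha> \<beta> \<gamma> a b c
    using that by (simp add: swap_xy_def vec2_eq_iff algebra_simps flip: distrib_right)
  ultimately show ?thesis by (simp add: square_sym_def swap_xy_def)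
qed

lemma square_sym_flip: "square_sym flip_x"
proof -
  have "continuous_on UNIV flip_x" unfolding flip_x_def by (intro continuous_on_pt continuous_intros)
  moreover have "flip_x ` unit_square = unit_square"
  proof -
    have "p \<in> flip_x ` unit_square" if "p \<in> unit_square" for p
      using that by (intro image_eqI[of _ _ "flip_x p"]) (auto simp: flip_x_def unit_square_iff vec2_eq_iff)
    then show ?thesis by (auto simp: flip_x_def unit_square_iff)
  qed
  moreover have "cr (flip_x a) (flip_x b) (flip_x c) = - cr a b c" for a b c by (simp add: flip_x_def cr_def algebra_simps)
  moreover have "flip_x (\<alpha> *\<^sub>R a + \<beta> *\<^sub>R b + \<gamma> *\<^sub>R c) = \<alpha> *\<^sub>R flip_x a + \<beta> *\<^sub>R flip_x b + \<gamma> *\<^sub>R flip_x c"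
    if "\<alpha> + \<beta> + \<gamma> = 1" for \<alpha> \<beta> \<gamma> a b c
    using that by (simp add: flip_x_def vec2_eq_iff algebra_simps flip: distrib_right)
  ultimately show ?thesis by (simp add: square_sym_def flip_x_def)
qed

lemma sym_tri: assumes "square_sym f" shows "f ` tri a b c = tri (f a) (f b) (f c)"
proof -
  have f: "f (\<alpha> *\<^sub>R a + \<beta> *\<^sub>R b + \<gamma> *\<^sub>R c) = \<alpha> *\<^sub>R f a + \<beta> *\<^sub>R f b + \<gamma> *\<^sub>R f c" if "\<alpha> + \<beta> + \<gamma> = 1" for \<alpha> \<beta> \<gamma>
    using assms that by (simp add: square_sym_def)
  show ?thesis
  proof (intro equalityI subsetI)
    fix p assume "p \<in> f ` tri a b c"
    then obtain q where "q \<in> tri a b c" "p = f q" by blast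
    then show "p \<in> tri (f a) (f b) (f c)" unfolding tri_mem using f by metis
  next
    fix p assume "p \<in> tri (f a) (f b) (f c)"
    then obtain \<alpha> \<beta> \<gamma> where c: "0 \<le> \<alpha>" "0 \<le> \<beta>" "0 \<le> \<gamma>" "\<alpha> + \<beta> + \<gamma> = 1"
      "p = \<alpha> *\<^sub>R f a + \<beta> *\<^sub>R f b + \<gamma> *\<^sub>R f c" unfolding tri_mem by blast
    then have "p = f (\<alpha> *\<^sub>R a + \<beta> *\<^sub>R b + \<gamma> *\<^sub>R c)" using f by simp
    moreover have "\<alpha> *\<^sub>R a + \<beta> *\<^sub>R b + \<gamma> *\<^sub>R c \<in> tri a b c" unfolding tri_mem using c by blast
    ultimately show "p \<in> f ` tri a b c" by blast
  qed
qed

lemma sym_involution: "square_sym f \<Longrightarrow> f ` f ` X = X"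
  by (simp add: square_sym_def image_image)

lemma sym_area: assumes "square_sym f" "triangle_dissection n D" "X \<in> D" shows "area (f ` X) = area X"
proof -
  obtain a b c where "X = tri a b c" using dissection_tri assms by metis
  then show ?thesis using assms sym_tri by (simp add: area_tri square_sym_def)
qed

definition img :: "(real^2 \<Rightarrow> real^2) \<Rightarrow> (real^2) set set \<Rightarrow> (real^2) set set" where
  "img f D = (\<lambda>X. f ` X) ` D"

lemma img_mem: assumes "square_sym f" shows "X \<in> img f D \<longleftrightarrow> f ` X \<in> D"
proof
  assume "X \<in> img f D"
  then show "f ` X \<in> D" using sym_involution[OF assms] by (auto simp: img_def)
next
  assume "f ` X \<in> D"
  then show "X \<in> img f D" unfolding img_def using sym_involution[OF assms, of X] by (metis imageI)
qed

lemma sym_areas: assumes "square_sym f" "triangle_dissection n D" shows "areas (img f D) = areas D"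
proof -
  have inj: "inj_on ((`) f) D" using sym_involution[OF assms(1)] by (metis inj_onI)
  have "areas (img f D) = image_mset (\<lambda>X. area (f ` X)) (mset_set D)"
    unfolding areas_def img_def using inj by (simp add: image_mset_mset_set[symmetric] multiset.map_comp comp_def)
  also have "\<dots> = areas D" unfolding areas_def
    using assms sym_area by (intro image_mset_cong) (auto simp: triangle_dissection_def)
  finally show ?thesis .
qed

lemma sym_dissection: assumes f: "square_sym f" and D: "triangle_dissection n D"
  shows "triangle_dissection n (img f D)"
proof -
  have inj: "inj_on ((`) f) D" using sym_involution[OF f] by (metis inj_onI)
  have "nondegenerate_triangle X" if Xi: "X \<in> img f D" for X
  proof -
    obtain Y where Y: "Y \<in> D" "X = f ` Y" using Xi unfolding img_def by blast
    obtain a b c where "Y = tri a b c" using dissection_tri D Y by metis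
    then have "X = tri (f a) (f b) (f c)" using Y sym_tri[OF f] by simp
    moreover have "area X > 0" using sym_area[OF f D Y(1)] Y D
      by (auto simp: triangle_dissection_def nondegenerate_triangle_def)
    ultimately show ?thesis by (auto simp: nondegenerate_triangle_def tri_def)
  qed
  moreover have "pairwise (\<lambda>S T. interior S \<inter> interior T = {}) (img f D)"
  proof (rule pairwiseI)
    fix X Y assume XY: "X \<in> img f D" "Y \<in> img f D" "X \<noteq> Y"
    obtain X' Y' where X': "X' \<in> D" "X = f ` X'" "Y' \<in> D" "Y = f ` Y'" using XY unfolding img_def by blast
    have sub: "f ` interior (f ` Z) \<subseteq> interior Z" for Z
    proof (rule interior_maximal)
      have ff: "f (f p) = p" for p using f by (simp add: square_sym_def)
      \<comment> \<open>As \<open>f\<close> is its own inverse, the image is a preimage, and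
        continuity makes it open.\<close>
      have "f ` interior (f ` Z) = f -` interior (f ` Z)" using ff by (auto simp: image_iff) (metis ff)
      then show "open (f ` interior (f ` Z))"
        using f open_vimage[of "interior (f ` Z)" f] by (simp add: square_sym_def)
      have "f ` interior (f ` Z) \<subseteq> f ` f ` Z" using interior_subset by (intro image_mono)
      then show "f ` interior (f ` Z) \<subseteq> Z" using sym_involution[OF f] by simp
    qed
    have "X' \<noteq> Y'" using X' XY by blast
    then have "interior X' \<inter> interior Y' = {}"
      using X'(1,3) D by (auto simp: triangle_dissection_def pairwise_def)
    then show "interior X \<inter> interior Y = {}" using sub[of X'] sub[of Y'] X' by blast
  qed
  moreover have "\<Union>(img f D) = unit_square"
    using f D by (simp add: img_def triangle_dissection_def square_sym_def image_Union[symmetric])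
  ultimately show ?thesis
    using D card_image[OF inj] by (auto simp: triangle_dissection_def img_def)
qed

lemma range_areas: "triangle_dissection n D \<Longrightarrow> area_range D = Max (set_mset (areas D)) - Min (set_mset (areas D))"
  by (auto simp: area_range_def areas_def triangle_dissection_def)

lemma sym_near: "square_sym f \<Longrightarrow> near D \<Longrightarrow> near (img f D)"
  using sym_dissection sym_areas range_areas unfolding near_def by metis

lemma sym_optimal: "square_sym f \<Longrightarrow> near D \<Longrightarrow> optimal (img f D) \<Longrightarrow> optimal D"
  using sym_areas near_dissection unfolding optimal_def by metis

section \<open>The sides of the square\<close>

lemma tri_edge_mem:
  assumes "p \<in> tri u v w" "cr u v w \<noteq> 0" "cr u v p = 0"
  obtains t where "0 \<le> t" "t \<le> 1" "p = u + t *\<^sub>R (v - u)"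
proof -
  obtain \<alpha> \<beta> \<gamma> where c: "0 \<le> \<alpha>" "0 \<le> \<beta>" "0 \<le> \<gamma>" "\<alpha> + \<beta> + \<gamma> = 1"
    "p = \<alpha> *\<^sub>R u + \<beta> *\<^sub>R v + \<gamma> *\<^sub>R w" using assms(1) unfolding tri_mem by blast
  have "cr u v p = \<gamma> * cr u v w" unfolding c(5) cr_affine[OF c(4)] by simp
  then have "\<gamma> = 0" using assms by simp
  moreover from this have "\<alpha> + \<beta> = 1" using c(4) by simp
  then have "\<alpha> * x + \<beta> * y = x + \<beta> * (y - x)" for x y by algebra
  ultimately have "p = u + \<beta> *\<^sub>R (v - u)" unfolding c(5) by (simp add: vec2_eq_iff)
  then show thesis using that[of \<beta>] c by simp
qed

lemma tri_segment:
  assumes "0 \<le> t" "t \<le> 1" shows "u + t *\<^sub>R (v - u) \<in> tri u v w"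
  unfolding tri_mem using assms
  by (intro exI[of _ "1 - t"] exI[of _ t] exI[of _ 0]) (auto simp: algebra_simps)

text \<open>If \<open>X\<close> and \<open>Y\<close> differed, \<open>separating_cr\<close> would
  make \<open>p q\<close> their separating line. But the whole square lies on one side of that line,
  and each of the two triangles has a vertex strictly off it.\<close>

lemma boundary_unique:
  assumes D: "triangle_dissection n D" and X: "X \<in> D" "Y \<in> D"
    and pq: "p \<in> X" "q \<in> X" "p \<noteq> q" and t: "0 < t" "t < 1" "p + t *\<^sub>R (q - p) \<in> Y"
    and side: "\<And>z. z \<in> unit_square \<Longrightarrow> 0 \<le> k * cr p q z" and k: "k \<noteq> 0"
  shows "X = Y"
proof (rule ccontr)
  assume ne: "X \<noteq> Y"
  obtain \<kappa> where \<kappa>: "\<kappa> \<noteq> 0" "\<And>z. z \<in> X \<Longrightarrow> \<kappa> * cr p q z \<le> 0" "\<And>z. z \<in> Y \<Longrightarrow> 0 \<le> \<kappa> * cr p q z"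
    by (rule separating_cr[OF D X ne pq t]) (rule that; assumption)
  have off: "\<exists>z\<in>Z. 0 < k * cr p q z" if Z: "Z \<in> D" for Z
  proof -
    obtain a b d where abd: "Z = tri a b d" "cr a b d \<noteq> 0" using dissection_tri[OF D Z] by metis
    then have "cr p q a \<noteq> 0 \<or> cr p q b \<noteq> 0 \<or> cr p q d \<noteq> 0"
      using cr_collinear[OF \<open>p \<noteq> q\<close>] by blast
    then obtain z where "z \<in> Z" "cr p q z \<noteq> 0" using abd(1) tri_vertices by metis
    moreover have "0 \<le> k * cr p q z" using side[OF dissection_subset[OF D Z \<open>z \<in> Z\<close>]] .
    ultimately have "0 < k * cr p q z" using k by (simp add: less_le)
    then show ?thesis using \<open>z \<in> Z\<close> by blast
  qed
  obtain x where x: "x \<in> X" "0 < k * cr p q x" using off[OF X(1)] by blast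
  obtain y where y: "y \<in> Y" "0 < k * cr p q y" using off[OF X(2)] by blast
  have "0 < (k * cr p q x) * (k * cr p q y)" using x y by simp
  also have "\<dots> = k^2 * (cr p q x * cr p q y)" by algebra
  also have "\<dots> \<le> 0" using opposite_sides_mult[OF \<kappa>(1) \<kappa>(2)[OF x(1)] \<kappa>(3)[OF y(1)]] by (simp add: mult_nonneg_nonpos)
  finally show False by simp
qed

text \<open>Two points on a supporting line of the square force an edge on it, and any two edges of
  a triangle share a vertex. For adjacent sides of the square this vertex is the corner; for
  opposite sides it cannot exist.\<close>

lemma two_lines:
  assumes D: "triangle_dissection n D" and X: "X \<in> D"
    and pq: "p \<in> X" "q \<in> X" "p \<noteq> q" and pq': "p' \<in> X" "q' \<in> X" "p' \<noteq> q'"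
    and side: "\<And>z. z \<in> unit_square \<Longrightarrow> 0 \<le> k * cr p q z" "k \<noteq> 0"
    and side': "\<And>z. z \<in> unit_square \<Longrightarrow> 0 \<le> k' * cr p' q' z" "k' \<noteq> 0"
  shows "\<exists>z\<in>X. cr p q z = 0 \<and> cr p' q' z = 0"
proof -
  obtain a b c where abc: "X = tri a b c" "cr a b c \<noteq> 0" using dissection_tri[OF D X] by metis
  have sq: "a \<in> unit_square" "b \<in> unit_square" "c \<in> unit_square"
    using dissection_subset[OF D X] abc by auto
  have "(cr p q a = 0 \<and> cr p q b = 0) \<or> (cr p q b = 0 \<and> cr p q c = 0) \<or> (cr p q c = 0 \<and> cr p q a = 0)"
    using edge_extract[of a b c p q p q "- k"] abc pq side sq by auto
  moreover have "(cr p' q' a = 0 \<and> cr p' q' b = 0) \<or> (cr p' q' b = 0 \<and> cr p' q' c = 0) \<or> (cr p' q' c = 0 \<and> cr p' q' a = 0)"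
    using edge_extract[of a b c p' q' p' q' "- k'"] abc pq' side' sq by auto
  ultimately show ?thesis using abc(1) tri_vertices by metis
qed

lemma cr_sides:
  "cr (pt a 0) (pt b 0) z = (b - a) * z$2"
  "cr (pt a 1) (pt b 1) z = (b - a) * (z$2 - 1)"
  "cr (pt 0 a) (pt 0 b) z = (a - b) * z$1"
  "cr (pt 1 a) (pt 1 b) z = (a - b) * (z$1 - 1)"
  by (simp_all add: cr_def algebra_simps)

lemma cr_sides_nonneg:
  assumes "z \<in> unit_square"
  shows "0 \<le> (b - a) * cr (pt a 0) (pt b 0) z" "0 \<le> (a - b) * cr (pt a 1) (pt b 1) z"
    "0 \<le> (a - b) * cr (pt 0 a) (pt 0 b) z" "0 \<le> (b - a) * cr (pt 1 a) (pt 1 b) z"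
proof -
  have e: "(b - a) * ((b - a) * u) = (b - a)^2 * u" "(a - b) * ((b - a) * (u - 1)) = (b - a)^2 * (1 - u)"
    "(a - b) * ((a - b) * u) = (b - a)^2 * u" "(b - a) * ((a - b) * (u - 1)) = (b - a)^2 * (1 - u)" for u
    by algebra+
  show "0 \<le> (b - a) * cr (pt a 0) (pt b 0) z" "0 \<le> (a - b) * cr (pt a 1) (pt b 1) z"
    "0 \<le> (a - b) * cr (pt 0 a) (pt 0 b) z" "0 \<le> (b - a) * cr (pt 1 a) (pt 1 b) z"
    using assms unfolding cr_sides e by (simp_all add: unit_square_iff)
qed

lemma bottom_left:
  assumes D: "triangle_dissection n D" "X \<in> D"
    and X: "pt a 0 \<in> X" "pt b 0 \<in> X" "a \<noteq> b" "pt 0 c \<in> X" "pt 0 d \<in> X" "c \<noteq> d"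
  shows "SW \<in> X"
proof -
  have ne: "b - a \<noteq> 0" "a - b \<noteq> 0" "d - c \<noteq> 0" "c - d \<noteq> 0" using X(3,6) by simp_all
  have p: "pt a 0 \<noteq> pt b 0" "pt 0 c \<noteq> pt 0 d" using X(3,6) by simp_all
  obtain z where z: "z \<in> X" "cr (pt a 0) (pt b 0) z = 0" "cr (pt 0 c) (pt 0 d) z = 0"
    using two_lines[OF D X(1,2) p(1) X(4,5) p(2) cr_sides_nonneg(1) ne(1) cr_sides_nonneg(3) ne(4)] by blast
  have "z$2 = 0" "z$1 = 0" using z(2,3) ne unfolding cr_sides by simp_all
  then have "z = SW" by (simp add: vec2_eq_iff)
  with z show ?thesis by simp
qed

lemma bottom_right:
  assumes D: "triangle_dissection n D" "X \<in> D"
    and X: "pt a 0 \<in> X" "pt b 0 \<in> X" "a \<noteq> b" "pt 1 c \<in> X" "pt 1 d \<in> X" "c \<noteq> d"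
  shows "SE \<in> X"
proof -
  have ne: "b - a \<noteq> 0" "a - b \<noteq> 0" "d - c \<noteq> 0" "c - d \<noteq> 0" using X(3,6) by simp_all
  have p: "pt a 0 \<noteq> pt b 0" "pt 1 c \<noteq> pt 1 d" using X(3,6) by simp_all
  obtain z where z: "z \<in> X" "cr (pt a 0) (pt b 0) z = 0" "cr (pt 1 c) (pt 1 d) z = 0"
    using two_lines[OF D X(1,2) p(1) X(4,5) p(2) cr_sides_nonneg(1) ne(1) cr_sides_nonneg(4) ne(3)] by blast
  have "z$2 = 0" "z$1 = 1" using z(2,3) ne unfolding cr_sides by simp_all
  then have "z = SE" by (simp add: vec2_eq_iff)
  with z show ?thesis by simp
qed

lemma top_left:
  assumes D: "triangle_dissection n D" "X \<in> D"
    and X: "pt a 1 \<in> X" "pt b 1 \<in> X" "a \<noteq> b" "pt 0 c \<in> X" "pt 0 d \<in> X" "c \<noteq> d"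
  shows "NW \<in> X"
proof -
  have ne: "b - a \<noteq> 0" "a - b \<noteq> 0" "d - c \<noteq> 0" "c - d \<noteq> 0" using X(3,6) by simp_all
  have p: "pt a 1 \<noteq> pt b 1" "pt 0 c \<noteq> pt 0 d" using X(3,6) by simp_all
  obtain z where z: "z \<in> X" "cr (pt a 1) (pt b 1) z = 0" "cr (pt 0 c) (pt 0 d) z = 0"
    using two_lines[OF D X(1,2) p(1) X(4,5) p(2) cr_sides_nonneg(2) ne(2) cr_sides_nonneg(3) ne(4)] by blast
  have "z$2 = 1" "z$1 = 0" using z(2,3) ne unfolding cr_sides by simp_all
  then have "z = NW" by (simp add: vec2_eq_iff)
  with z show ?thesis by simp
qed

lemma top_right:
  assumes D: "triangle_dissection n D" "X \<in> D"
    and X: "pt a 1 \<in> X" "pt b 1 \<in> X" "a \<noteq> b" "pt 1 c \<in> X" "pt 1 d \<in> X" "c \<noteq> d"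
  shows "NE \<in> X"
proof -
  have ne: "b - a \<noteq> 0" "a - b \<noteq> 0" "d - c \<noteq> 0" "c - d \<noteq> 0" using X(3,6) by simp_all
  have p: "pt a 1 \<noteq> pt b 1" "pt 1 c \<noteq> pt 1 d" using X(3,6) by simp_all
  obtain z where z: "z \<in> X" "cr (pt a 1) (pt b 1) z = 0" "cr (pt 1 c) (pt 1 d) z = 0"
    using two_lines[OF D X(1,2) p(1) X(4,5) p(2) cr_sides_nonneg(2) ne(2) cr_sides_nonneg(4) ne(3)] by blast
  have "z$2 = 1" "z$1 = 1" using z(2,3) ne unfolding cr_sides by simp_all
  then have "z = NE" by (simp add: vec2_eq_iff)
  with z show ?thesis by simp
qed

lemma bottom_top:
  assumes D: "triangle_dissection n D" "X \<in> D"
    and X: "pt a 0 \<in> X" "pt b 0 \<in> X" "a \<noteq> b" "pt c 1 \<in> X" "pt d 1 \<in> X" "c \<noteq> d"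
  shows False
proof -
  have ne: "b - a \<noteq> 0" "a - b \<noteq> 0" "d - c \<noteq> 0" "c - d \<noteq> 0" using X(3,6) by simp_all
  have p: "pt a 0 \<noteq> pt b 0" "pt c 1 \<noteq> pt d 1" using X(3,6) by simp_all
  obtain z where z: "z \<in> X" "cr (pt a 0) (pt b 0) z = 0" "cr (pt c 1) (pt d 1) z = 0"
    using two_lines[OF D X(1,2) p(1) X(4,5) p(2) cr_sides_nonneg(1) ne(1) cr_sides_nonneg(2) ne(4)] by blast
  have "z$2 = 0" "z$2 = 1" using z(2,3) ne unfolding cr_sides by simp_all
  then show False by simp
qed

lemma left_right:
  assumes D: "triangle_dissection n D" "X \<in> D"
    and X: "pt 0 a \<in> X" "pt 0 b \<in> X" "a \<noteq> b" "pt 1 c \<in> X" "pt 1 d \<in> X" "c \<noteq> d"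
  shows False
proof -
  have ne: "b - a \<noteq> 0" "a - b \<noteq> 0" "d - c \<noteq> 0" "c - d \<noteq> 0" using X(3,6) by simp_all
  have p: "pt 0 a \<noteq> pt 0 b" "pt 1 c \<noteq> pt 1 d" using X(3,6) by simp_all
  obtain z where z: "z \<in> X" "cr (pt 0 a) (pt 0 b) z = 0" "cr (pt 1 c) (pt 1 d) z = 0"
    using two_lines[OF D X(1,2) p(1) X(4,5) p(2) cr_sides_nonneg(3) ne(2) cr_sides_nonneg(4) ne(3)] by blast
  have "z$1 = 0" "z$1 = 1" using z(2,3) ne unfolding cr_sides by simp_all
  then show False by simp
qed

lemma pt_between: "pt a c + t *\<^sub>R (pt b d - pt a c) = pt (a + t * (b - a)) (c + t * (d - c))"
  by (simp add: vec2_eq_iff)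

lemma side_unique:
  assumes D: "triangle_dissection n D" and X: "X \<in> D" "Y \<in> D" and t: "a < t" "t < b"
  shows "pt a 0 \<in> X \<Longrightarrow> pt b 0 \<in> X \<Longrightarrow> pt t 0 \<in> Y \<Longrightarrow> X = Y"
    "pt a 1 \<in> X \<Longrightarrow> pt b 1 \<in> X \<Longrightarrow> pt t 1 \<in> Y \<Longrightarrow> X = Y"
    "pt 0 a \<in> X \<Longrightarrow> pt 0 b \<in> X \<Longrightarrow> pt 0 t \<in> Y \<Longrightarrow> X = Y"
    "pt 1 a \<in> X \<Longrightarrow> pt 1 b \<in> X \<Longrightarrow> pt 1 t \<in> Y \<Longrightarrow> X = Y"
proof -
  define s where "s = (t - a) / (b - a)"
  have s: "0 < s" "s < 1" "a + s * (b - a) = t" using t by (auto simp: s_def field_simps)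
  show "pt a 0 \<in> X \<Longrightarrow> pt b 0 \<in> X \<Longrightarrow> pt t 0 \<in> Y \<Longrightarrow> X = Y"
    using boundary_unique[OF D X _ _ _ s(1,2) _ cr_sides_nonneg(1)] t s by (auto simp: pt_between)
  show "pt a 1 \<in> X \<Longrightarrow> pt b 1 \<in> X \<Longrightarrow> pt t 1 \<in> Y \<Longrightarrow> X = Y"
    using boundary_unique[OF D X _ _ _ s(1,2) _ cr_sides_nonneg(2)] t s by (auto simp: pt_between)
  show "pt 0 a \<in> X \<Longrightarrow> pt 0 b \<in> X \<Longrightarrow> pt 0 t \<in> Y \<Longrightarrow> X = Y"
    using boundary_unique[OF D X _ _ _ s(1,2) _ cr_sides_nonneg(3)] t s by (auto simp: pt_between)
  show "pt 1 a \<in> X \<Longrightarrow> pt 1 b \<in> X \<Longrightarrow> pt 1 t \<in> Y \<Longrightarrow> X = Y"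
    using boundary_unique[OF D X _ _ _ s(1,2) _ cr_sides_nonneg(4)] t s by (auto simp: pt_between)
qed

lemma side_mem:
  assumes "a < b" "y > 0"
  shows "pt t 0 \<in> tri (pt a 0) (pt b 0) (pt x y) \<Longrightarrow> a \<le> t \<and> t \<le> b"
proof -
  assume "pt t 0 \<in> tri (pt a 0) (pt b 0) (pt x y)"
  then obtain s where "0 \<le> s" "s \<le> 1" "pt t 0 = pt a 0 + s *\<^sub>R (pt b 0 - pt a 0)"
    by (rule tri_edge_mem) (use assms in \<open>auto simp: cr_sides\<close>)
  moreover from this have "t = a + s * (b - a)" by (simp add: pt_between)
  moreover have "s * (b - a) \<le> 1 * (b - a)" "0 \<le> s * (b - a)"
    using calculation assms by (intro mult_right_mono, auto)
  ultimately show ?thesis by simp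
qed

text \<open>Points of the bottom side tending to \<open>a\<close> from the right lie infinitely
  often in one triangle, which then contains \<open>pt a 0\<close> too, and
  \<open>edge_extract\<close> yields a bottom edge reaching beyond \<open>a\<close>. The two inner
  claims only list the vertices with this edge first and from left to right.\<close>

lemma bottom_start:
  assumes D: "triangle_dissection n D" and a: "0 \<le> a" "a < 1"
  obtains X a' b x y where "X \<in> D" "X = tri (pt a' 0) (pt b 0) (pt x y)" "0 \<le> a'" "a' \<le> a" "a < b" "b \<le> 1"
    "0 \<le> x" "x \<le> 1" "0 < y" "y \<le> 1"
proof -
  note main = that
  define t where "t n = a + (1 - a) * (1 / real (Suc (Suc n)))" for n
  have t: "a < t n" "t n < 1" for n
  proof -
    have "(1 - a) * (1 / real (Suc (Suc n))) < (1 - a) * 1" using a by (intro mult_strict_left_mono) auto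
    then show "a < t n" "t n < 1" using a by (auto simp: t_def)
  qed
  have tinj: "t n \<noteq> t k" if "n \<noteq> k" for n k using that a by (auto simp: t_def)
  define z where "z n = pt (t n) 0" for n
  have "\<exists>X\<in>D. \<not> finite {n \<in> UNIV. z n \<in> X}"
  proof (rule pigeonhole_infinite_rel)
    show "finite D" using D by (auto simp: triangle_dissection_def)
    have "z n \<in> unit_square" for n using t[of n] a by (auto simp: z_def unit_square_iff)
    then show "\<forall>n\<in>UNIV. \<exists>X\<in>D. z n \<in> X" using dissection_cover[OF D] by blast
  qed auto
  then obtain X where X: "X \<in> D" "infinite {n. z n \<in> X}" by auto
  have aX: "pt a 0 \<in> X"
  proof (rule infinite_closed_limit[OF _ _ X(2)])
    show "closed X" using dissection_tri[OF D X(1)] closed_tri by metis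
    have "(\<lambda>n. 1 / real (Suc (Suc n))) \<longlonglongrightarrow> 0" by (intro LIMSEQ_Suc lim_const_over_n)
    then have "(\<lambda>n. pt a 0 + (1 / real (Suc (Suc n))) *\<^sub>R (SE - pt a 0)) \<longlonglongrightarrow> pt a 0 + 0 *\<^sub>R (SE - pt a 0)"
      by (intro tendsto_intros)
    then show "z \<longlonglongrightarrow> pt a 0" unfolding z_def t_def pt_between by (simp add: mult.commute)
  qed
  have "{n. z n \<in> X} \<noteq> {}" using X(2) by (metis finite.emptyI)
  then obtain i where i: "z i \<in> X" by blast
  obtain p q r where pqr: "X = tri p q r" "cr p q r \<noteq> 0" using dissection_tri[OF D X(1)] by metis
  have sq: "p \<in> unit_square" "q \<in> unit_square" "r \<in> unit_square" using dissection_subset[OF D X(1)] pqr by auto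
  have *: thesis if "X = tri p q r" "p \<in> unit_square" "q \<in> unit_square" "r \<in> unit_square"
    "p$2 = 0" "q$2 = 0" "0 < r$2" "cr p q r \<noteq> 0" "p$1 < q$1" for p q r
  proof -
    have X': "X = tri (pt (p$1) 0) (pt (q$1) 0) (pt (r$1) (r$2))" using that by (metis pt_collapse)
    have "p$1 \<le> a" using side_mem[OF that(9,7)] aX X' by blast
    moreover have "t i \<le> q$1" using side_mem[OF that(9,7)] i X' unfolding z_def by blast
    ultimately show thesis using main[OF X(1) X'] that t[of i] by (auto simp: unit_square_iff)
  qed
  have **: thesis if "X = tri p q r" "p \<in> unit_square" "q \<in> unit_square" "r \<in> unit_square"
    "p$2 = 0" "q$2 = 0" "0 < r$2" "cr p q r \<noteq> 0" for p q r
  proof -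
    have "p$1 \<noteq> q$1" using that(5,6,8) by (auto simp: cr_def)
    then consider "p$1 < q$1" | "q$1 < p$1" by linarith
    then show thesis
    proof cases
      case 1 then show thesis using *[of p q r] that by blast
    next
      case 2 then show thesis using *[of q p r] that tri_perm(2)[of p q r] cr_rot(2)[of p q r] by simp
    qed
  qed
  have "cr SW SE u = u$2" for u by (simp add: cr_sides)
  then have "(p$2 = 0 \<and> q$2 = 0 \<and> 0 < r$2) \<or> (q$2 = 0 \<and> r$2 = 0 \<and> 0 < p$2) \<or> (r$2 = 0 \<and> p$2 = 0 \<and> 0 < q$2)"
    using edge_extract[of p q r "SW" "SE" "pt a 0" "z i" "-1"] pqr aX i t[of i] sq
    by (auto simp: z_def unit_square_iff)
  moreover have "X = tri q r p" "X = tri r p q" "cr q r p \<noteq> 0" "cr r p q \<noteq> 0"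
    using pqr tri_perm(1)[of p q r] tri_perm(1)[of q r p] cr_rot(1)[of p q r] cr_rot(1)[of q r p] by simp_all
  ultimately show thesis
    using **[OF pqr(1) sq _ _ _ pqr(2)] **[of q r p] **[of r p q] sq by metis
qed

lemma area2_bottom: "a \<le> b \<Longrightarrow> 0 \<le> y \<Longrightarrow> area2 (tri (pt a 0) (pt b 0) (pt x y)) = (b - a) * y"
  by (simp add: area2_tri cr_sides)

text \<open>The base has length 1, so the depth \<open>y\<close> of the apex and the doubled area
  are the same number.\<close>

definition full_side where
  "full_side c D X x y \<longleftrightarrow> X \<in> D \<and> X = tri (c 0 0) (c 1 0) (c x y) \<and> 0 \<le> x \<and> x \<le> 1 \<and> y = area2 X"

definition split_side where
  "split_side c D s X x y X' x' y' \<longleftrightarrow> X \<in> D \<and> X' \<in> D \<and> X \<noteq> X' \<and>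
     X = tri (c 0 0) (c s 0) (c x y) \<and> X' = tri (c s 0) (c 1 0) (c x' y') \<and>
     3639/10000 \<le> s \<and> s \<le> 6361/10000 \<and> 0 \<le> x \<and> x \<le> 1 \<and> 0 < y \<and> y \<le> 1 \<and>
     0 \<le> x' \<and> x' \<le> 1 \<and> 0 < y' \<and> y' \<le> 1 \<and> s * y = area2 X \<and> (1 - s) * y' = area2 X'"

definition side_ok where
  "side_ok c \<longleftrightarrow> (\<forall>D. near D \<longrightarrow> (\<exists>X x y. full_side c D X x y) \<or> (\<exists>s X x y X' x' y'. split_side c D s X x y X' x' y'))"

text \<open>Bases are collected from left to right: one starting at 0 and, if it ends before 1,
  another starting exactly where it ends, since \<open>side_unique\<close> forbids overlapping
  bases. Heights are at most 1, so every base is at least 0.3639 long and a third one does not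
  fit.\<close>

lemma side_ok_bottom: "side_ok pt"
  unfolding side_ok_def
proof (intro allI impI)
  fix D assume nD: "near D"
  note D = near_dissection[OF nD]
  have len: "3639/10000 \<le> b - a"
    if "X \<in> D" "X = tri (pt a 0) (pt b 0) (pt x y)" "a < b" "0 < y" "y \<le> 1" for X a b x y
  proof -
    have "area2 X = (b - a) * y" using that by (simp add: area2_bottom)
    also have "\<dots> \<le> (b - a) * 1" using that by (intro mult_left_mono) auto
    finally show ?thesis using near_bounds(1)[OF nD that(1)] by simp
  qed
  have disj: "b \<le> a'"
    if X: "X \<in> D" "X = tri (pt a 0) (pt b 0) (pt x y)" "a < b"
      and Y: "Y \<in> D" "Y = tri (pt a' 0) (pt b' 0) (pt x' y')" "a' \<le> b" "b < b'" and "0 < y"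
    for X Y a b x y a' b' x' y'
  proof (rule ccontr)
    assume "\<not> b \<le> a'"
    then have m: "max a a' < b" using X by simp
    have "X = Y"
    proof (rule side_unique(1)[OF D Y(1) X(1), symmetric])
      show "a' < (max a a' + b) / 2" "(max a a' + b) / 2 < b'" using m Y(4) by auto
      show "pt a' 0 \<in> Y" "pt b' 0 \<in> Y" using Y by auto
      define r where "r = ((max a a' + b) / 2 - a) / (b - a)"
      have r: "0 \<le> r" "r \<le> 1" "a + r * (b - a) = (max a a' + b) / 2"
        using X(3) m by (auto simp: r_def field_simps)
      show "pt ((max a a' + b) / 2) 0 \<in> X"
        using tri_segment[OF r(1,2), of "pt a 0" "pt b 0" "pt x y"] by (simp only: X(2) pt_between r(3)) simp
    qed
    then have "pt b' 0 \<in> X" using Y by auto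
    then show False using side_mem[OF X(3) \<open>0 < y\<close>] X(2) Y(4) by fastforce
  qed
  obtain X a b x y where X: "X \<in> D" "X = tri (pt a 0) (pt b 0) (pt x y)" "0 \<le> a" "a \<le> 0" "0 < b" "b \<le> 1"
    "0 \<le> x" "x \<le> 1" "0 < y" "y \<le> 1" by (rule bottom_start[OF D order_refl zero_less_one])
  have a: "a = 0" using X by simp
  show "(\<exists>X x y. full_side pt D X x y) \<or> (\<exists>s X x y X' x' y'. split_side pt D s X x y X' x' y')"
  proof (cases "b = 1")
    case True
    then have "full_side pt D X x y" using X a by (simp add: full_side_def area2_bottom)
    then show ?thesis by blast
  next
    case False
    then have b: "0 \<le> b" "b < 1" using X(5,6) by linarith+
    obtain Y a' b' x' y' where Y: "Y \<in> D" "Y = tri (pt a' 0) (pt b' 0) (pt x' y')" "0 \<le> a'" "a' \<le> b" "b < b'" "b' \<le> 1"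
      "0 \<le> x'" "x' \<le> 1" "0 < y'" "y' \<le> 1" by (rule bottom_start[OF D b])
    have a': "a' = b" using disj[OF X(1,2) _ Y(1,2,4,5) X(9)] X(5) a Y(4) by simp
    have lX: "3639/10000 \<le> b" using len[OF X(1,2) _ X(9,10)] X(5) a by simp
    have lY: "3639/10000 \<le> b' - b" using len[OF Y(1,2) _ Y(9,10)] Y(5) a' by simp
    have b': "b' = 1"
    proof (rule ccontr)
      assume "b' \<noteq> 1"
      then have b1: "0 \<le> b'" "b' < 1" using X(5) Y(5,6) by linarith+
      obtain Z c d u v where Z: "Z \<in> D" "Z = tri (pt c 0) (pt d 0) (pt u v)" "0 \<le> c" "c \<le> b'" "b' < d" "d \<le> 1"
        "0 \<le> u" "u \<le> 1" "0 < v" "v \<le> 1" by (rule bottom_start[OF D b1])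
      have "b' \<le> c" using disj[OF Y(1,2) _ Z(1,2,4,5) Y(9)] Y(5) a' by simp
      then have "3639/10000 \<le> d - b'" using len[OF Z(1,2) _ Z(9,10)] Z(4,5) by simp
      then show False using lX lY Z(6) by simp
    qed
    have "X \<noteq> Y"
    proof
      assume "X = Y"
      then have "SE \<in> X" using Y(2) tri_vertices(2)[of "SE"] unfolding b' by simp
      then show False using side_mem[OF _ X(9), of a b 1 x] X(5) unfolding X(2) a using b by simp
    qed
    have Xe: "X = tri SW (pt b 0) (pt x y)" using X(2) unfolding a .
    have Ye: "Y = tri (pt b 0) SE (pt x' y')" using Y(2) unfolding a' b' .
    have "b * y = area2 X" unfolding Xe using X(5,9) by (simp add: area2_bottom)
    moreover have "(1 - b) * y' = area2 Y" unfolding Ye using b Y(9) by (simp add: area2_bottom)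
    moreover have "b \<le> 6361/10000" using lY unfolding b' by simp
    ultimately have "split_side pt D b X x y Y x' y'"
      unfolding split_side_def using X(1,7-10) Y(1,7-10) Xe Ye lX \<open>X \<noteq> Y\<close> by (intro conjI)
    then show ?thesis by (intro disjI2 exI)
  qed
qed

lemma area2_sym: "square_sym f \<Longrightarrow> area2 (f ` tri a b c) = area2 (tri a b c)"
  by (simp add: sym_tri area2_tri square_sym_def)

lemma side_ok_sym:
  assumes f: "square_sym f" and c: "\<And>x y. f (c x y) = c' x y" and ok: "side_ok c"
  shows "side_ok c'"
  unfolding side_ok_def
proof (intro allI impI)
  fix D assume nD: "near D"
  note mem = img_mem[OF f]
  have full: "full_side c' D (f ` X) x y" if "full_side c (img f D) X x y" for X x y
  proof -
    have X: "X \<in> img f D" "X = tri (c 0 0) (c 1 0) (c x y)" "0 \<le> x" "x \<le> 1" "y = area2 X"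
      using that unfolding full_side_def by blast+
    have "f ` X = tri (c' 0 0) (c' 1 0) (c' x y)" unfolding X(2) sym_tri[OF f] c ..
    moreover have "area2 (f ` X) = area2 X" unfolding X(2) by (rule area2_sym[OF f])
    ultimately show ?thesis using X(1,3,4,5) mem[of X] unfolding full_side_def by metis
  qed
  have split: "split_side c' D s (f ` X) x y (f ` X') x' y'" if "split_side c (img f D) s X x y X' x' y'" for s X x y X' x' y'
  proof -
    have X: "X \<in> img f D" "X = tri (c 0 0) (c s 0) (c x y)" "X' \<in> img f D" "X' = tri (c s 0) (c 1 0) (c x' y')" "X \<noteq> X'"
      using that unfolding split_side_def by blast+
    have "f ` X = tri (c' 0 0) (c' s 0) (c' x y)" unfolding X(2) sym_tri[OF f] c ..
    moreover have "f ` X' = tri (c' s 0) (c' 1 0) (c' x' y')" unfolding X(4) sym_tri[OF f] c ..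
    moreover have "area2 (f ` X) = area2 X" unfolding X(2) by (rule area2_sym[OF f])
    moreover have "area2 (f ` X') = area2 X'" unfolding X(4) by (rule area2_sym[OF f])
    moreover have "f ` X \<noteq> f ` X'" using X(5) sym_involution[OF f] by metis
    ultimately show ?thesis using that mem[of X] mem[of X'] unfolding split_side_def by metis
  qed
  show "(\<exists>X x y. full_side c' D X x y) \<or> (\<exists>s X x y X' x' y'. split_side c' D s X x y X' x' y')"
    using ok[unfolded side_ok_def, rule_format, OF sym_near[OF f nD]] full split by metis
qed

lemma side_ok_left: "side_ok left_side"
  by (rule side_ok_sym[OF square_sym_swap _ side_ok_bottom]) simp

lemma side_ok_right: "side_ok right_side"
  by (rule side_ok_sym[OF square_sym_flip _ side_ok_left]) simp

lemma side_ok_top: "side_ok top_side"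
  by (rule side_ok_sym[OF square_sym_swap _ side_ok_right]) simp

section \<open>Lines carrying edges\<close>

lemma cr_pt [simp]: "cr (pt a b) (pt c d) (pt e f) = (c - a) * (f - b) - (d - b) * (e - a)"
  by (simp add: cr_def)

lemma tri_cr_le:
  assumes "p \<in> tri a b c" "cr u v a \<le> k" "cr u v b \<le> k" "cr u v c \<le> k" shows "cr u v p \<le> k"
proof -
  obtain \<alpha> \<beta> \<gamma> where c: "0 \<le> \<alpha>" "0 \<le> \<beta>" "0 \<le> \<gamma>" "\<alpha> + \<beta> + \<gamma> = 1"
    "p = \<alpha> *\<^sub>R a + \<beta> *\<^sub>R b + \<gamma> *\<^sub>R c" using assms(1) unfolding tri_mem by blast
  have "cr u v p = \<alpha> * cr u v a + \<beta> * cr u v b + \<gamma> * cr u v c" unfolding c(5) by (rule cr_affine[OF c(4)])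
  also have "\<dots> \<le> \<alpha> * k + \<beta> * k + \<gamma> * k" using c assms by (intro add_mono mult_left_mono)
  also have "\<dots> = k" using c(4) by algebra
  finally show ?thesis .
qed

lemma nb_mem: "nb u v w X \<Longrightarrow> v \<in> X" by (simp add: nb_def)
lemma nb_side: "nb u v w X \<Longrightarrow> p \<in> X \<Longrightarrow> cr u v w * cr u v p \<le> 0" by (simp add: nb_def)
lemma nb_strict: "nb u v w X \<Longrightarrow> \<exists>p\<in>X. cr u v w * cr u v p < 0" by (simp add: nb_def)
lemma nb_on2: "nb u v w (tri a b c) \<Longrightarrow> on2 u v a b c" by (simp add: nb_def)
lemma nb_along: "nb u v w X \<Longrightarrow> \<exists>t. 0 < t \<and> t < 1 \<and> v + t *\<^sub>R (u - v) \<in> X" by (simp add: nb_def)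
lemma nb_self: "nb u v w X \<Longrightarrow> w \<in> X \<Longrightarrow> False"
  using nb_side[of u v w X w] nb_strict[of u v w X] by (auto simp: mult_le_0_iff)

definition sameline where "sameline u v u' v' \<longleftrightarrow> cr u v u' = 0 \<and> cr u v v' = 0"

lemma on_two_lines:
  assumes "a \<noteq> b" "cr u v a = 0" "cr u v b = 0" "cr u' v' a = 0" "cr u' v' b = 0" "u \<noteq> v" "u' \<noteq> v'"
  shows "sameline u v u' v'"
proof -
  have "cr a b u = 0" "cr a b v = 0"
    using cr_collinear[OF \<open>u \<noteq> v\<close>, of a b] assms by auto
  moreover have "cr a b u' = 0" "cr a b v' = 0"
    using cr_collinear[OF \<open>u' \<noteq> v'\<close>, of a b] assms by auto
  ultimately show ?thesis unfolding sameline_def using cr_collinear[OF \<open>a \<noteq> b\<close>] by metis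
qed

lemma sameline_sym: "u \<noteq> v \<Longrightarrow> sameline u v u' v' \<Longrightarrow> sameline u' v' u v"
  unfolding sameline_def using cr_collinear[of u v u' v'] cr_self cr_rot by metis

text \<open>Pigeonhole: each of the four lines carries one of only three edges, and lines carrying
  the same edge coincide.\<close>

lemma four_lines:
  assumes "cr a b c \<noteq> 0" "on2 u1 v1 a b c" "on2 u2 v2 a b c" "on2 u3 v3 a b c" "on2 u4 v4 a b c"
    "u1 \<noteq> v1" "u2 \<noteq> v2" "u3 \<noteq> v3" "u4 \<noteq> v4"
  shows "sameline u1 v1 u2 v2 \<or> sameline u1 v1 u3 v3 \<or> sameline u1 v1 u4 v4 \<or>
    sameline u2 v2 u3 v3 \<or> sameline u2 v2 u4 v4 \<or> sameline u3 v3 u4 v4"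
proof -
  have ne: "a \<noteq> b" "b \<noteq> c" "c \<noteq> a" using assms(1) by (auto simp: cr_def)
  define P where "P p q u v \<longleftrightarrow> cr u v p = 0 \<and> cr u v q = 0" for p q u v
  have P: "sameline u v u' v'" if "P a b u v \<and> P a b u' v' \<or> P b c u v \<and> P b c u' v' \<or> P c a u v \<and> P c a u' v'"
    "u \<noteq> v" "u' \<noteq> v'" for u v u' v'
    using that on_two_lines ne unfolding P_def by metis
  have "P a b u1 v1 \<or> P b c u1 v1 \<or> P c a u1 v1" "P a b u2 v2 \<or> P b c u2 v2 \<or> P c a u2 v2"
    "P a b u3 v3 \<or> P b c u3 v3 \<or> P c a u3 v3" "P a b u4 v4 \<or> P b c u4 v4 \<or> P c a u4 v4"
    using assms(2-5) unfolding P_def on2_def by blast+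
  then show ?thesis
    using P[of u1 v1 u2 v2] P[of u1 v1 u3 v3] P[of u1 v1 u4 v4] P[of u2 v2 u3 v3] P[of u2 v2 u4 v4] P[of u3 v3 u4 v4] assms(6-9)
    by blast
qed

text \<open>Different lines carry different edges, and any two edges of a triangle contain all three
  vertices.\<close>

lemma two_lines_cover:
  assumes "cr a b c \<noteq> 0" "on2 u v a b c" "on2 u' v' a b c" "u \<noteq> v" "u' \<noteq> v'" "\<not> sameline u v u' v'" "z \<in> {a, b, c}"
  shows "cr u v z = 0 \<or> cr u' v' z = 0"
proof -
  have ne: "a \<noteq> b" "b \<noteq> c" "c \<noteq> a" using assms(1) by (auto simp: cr_def)
  show ?thesis using assms ne on_two_lines[of a b u v u' v'] on_two_lines[of b c u v u' v'] on_two_lines[of c a u v u' v']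
    unfolding on2_def by blast
qed

lemma slanted_mem:
  assumes "triangle_dissection n D" "X \<in> D" "pt (\<alpha> + \<beta> * a) a \<in> X" "pt (\<alpha> + \<beta> * b) b \<in> X" "a \<le> t" "t \<le> b" "a < b"
  shows "pt (\<alpha> + \<beta> * t) t \<in> X"
proof -
  define s where "s = (t - a) / (b - a)"
  have s: "0 \<le> s" "s \<le> 1" "a + s * (b - a) = t" using assms by (auto simp: s_def field_simps)
  have "\<alpha> + \<beta> * a + s * (\<alpha> + \<beta> * b - (\<alpha> + \<beta> * a)) = \<alpha> + \<beta> * (a + s * (b - a))" by algebra
  then show ?thesis using segment_mem[OF assms(1-4) s(1,2)] by (simp only: pt_between s(3))
qed

text \<open>Each triangle contains a segment of the line with first coordinate \<alpha> + \<beta>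
  times the second, parametrised by the second coordinate; \<open>ov\<close> makes the parameter
  intervals overlap. By \<open>common_pair\<close> the triangles lie on opposite sides of this line,
  against the points \<open>x\<close> and \<open>y\<close> strictly on the same side.\<close>

lemma overlap:
  assumes D: "triangle_dissection n D" and X: "X \<in> D" "Y \<in> D" "X \<noteq> Y"
    and a: "pt (\<alpha> + \<beta> * a) a \<in> X" "pt (\<alpha> + \<beta> * a') a' \<in> X" "a < a'"
    and b: "pt (\<alpha> + \<beta> * b) b \<in> Y" "pt (\<alpha> + \<beta> * b') b' \<in> Y" "b < b'"
    and ov: "a < b'" "b < a'"
    and side: "x \<in> X" "y \<in> Y" "0 < (x$1 - \<alpha> - \<beta> * x$2) * (y$1 - \<alpha> - \<beta> * y$2)"
  shows False
proof -
  define m where "m = max a b"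
  define M where "M = min a' b'"
  have m: "m < M" "a \<le> m" "b \<le> m" "M \<le> a'" "M \<le> b'" using a b ov by (auto simp: m_def M_def)
  have "pt (\<alpha> + \<beta> * m) m \<in> X" "pt (\<alpha> + \<beta> * m) m \<in> Y" "pt (\<alpha> + \<beta> * M) M \<in> X" "pt (\<alpha> + \<beta> * M) M \<in> Y"
    using slanted_mem[OF D X(1) a(1,2)] slanted_mem[OF D X(2) b(1,2)] m a b by auto
  then have le: "cr (pt (\<alpha> + \<beta> * m) m) (pt (\<alpha> + \<beta> * M) M) x * cr (pt (\<alpha> + \<beta> * m) m) (pt (\<alpha> + \<beta> * M) M) y \<le> 0"
    using common_pair[OF D X] m(1) side by auto
  have c: "cr (pt (\<alpha> + \<beta> * m) m) (pt (\<alpha> + \<beta> * M) M) z = (m - M) * (z$1 - \<alpha> - \<beta> * z$2)" for z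
    unfolding cr_def pt_nth by algebra
  have "(m - M)^2 * ((x$1 - \<alpha> - \<beta> * x$2) * (y$1 - \<alpha> - \<beta> * y$2)) =
    ((m - M) * (x$1 - \<alpha> - \<beta> * x$2)) * ((m - M) * (y$1 - \<alpha> - \<beta> * y$2))" by algebra
  also have "\<dots> \<le> 0" using le unfolding c .
  finally have "(m - M)^2 * ((x$1 - \<alpha> - \<beta> * x$2) * (y$1 - \<alpha> - \<beta> * y$2)) \<le> 0" .
  moreover have "(m - M)^2 > 0" using m by simp
  ultimately show False using mult_pos_pos[OF _ side(3)] by (metis not_less)
qed

lemma five_eq:
  assumes D: "near D" and "A \<in> D" "B \<in> D" "C \<in> D" "E \<in> D" "F \<in> D" "distinct [A, B, C, E, F]"
  shows "D = {A, B, C, E, F}"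
proof -
  have "card {A, B, C, E, F} = 5" using assms(7) by simp
  moreover have "{A, B, C, E, F} \<subseteq> D" using assms by simp
  ultimately show ?thesis using near_finite[OF D] card_subset_eq by metis
qed

lemma fifth_ex:
  assumes D: "near D" and "A \<in> D" "B \<in> D" "C \<in> D" "E \<in> D" "distinct [A, B, C, E]"
  obtains F where "F \<in> D" "distinct [A, B, C, E, F]" "D = {A, B, C, E, F}"
proof -
  have "card {A, B, C, E} = 4" using assms(6) by simp
  then have "D \<noteq> {A, B, C, E}" using near_finite[OF D] by auto
  then obtain F where "F \<in> D" "F \<notin> {A, B, C, E}" using assms by blast
  then have F: "F \<in> D" "distinct [A, B, C, E, F]" using assms(6) by auto
  then show thesis using that five_eq[OF D assms(2-5)] by blast
qed

lemma six_False:
  assumes D: "near D" and "A \<in> D" "B \<in> D" "C \<in> D" "E \<in> D" "F \<in> D" "G \<in> D" "distinct [A, B, C, E, F, G]"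
  shows False
proof -
  have "D = {A, B, C, E, F}" using five_eq[OF assms(1-6)] assms(8) by simp
  then have "G \<in> {A, B, C, E, F}" using assms(7) by simp
  then show False using assms(8) by (elim insertE) auto
qed

section \<open>All sides undivided\<close>

text \<open>Coordinates after each of the four rotations of the square; these preserve orientation, so \<open>cr\<close> has the
  same formula in all of them.\<close>

definition frame where
  "frame c \<longleftrightarrow> c = pt \<or> c = right_side \<or> c = (\<lambda>x y. pt (1 - x) (1 - y)) \<or> c = (\<lambda>x y. pt y (1 - x))"

lemma frame_cr: "frame c \<Longrightarrow> cr (c a b) (c a' b') (c a'' b'') = (a' - a) * (b'' - b) - (b' - b) * (a'' - a)"
  by (auto simp: frame_def algebra_simps)

lemma frame_line: "frame c \<Longrightarrow> c a b + t *\<^sub>R (c a' b' - c a b) = c (a + t * (a' - a)) (b + t * (b' - b))"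
  by (auto simp: frame_def vec2_eq_iff algebra_simps)

lemma frame_surj: assumes "frame c" obtains x y where "p = c x y"
proof -
  have "p = pt (p$1) (p$2)" "p = right_side (p$2) (1 - p$1)"
    "p = (\<lambda>x y. pt (1 - x) (1 - y)) (1 - p$1) (1 - p$2)" "p = (\<lambda>x y. pt y (1 - x)) (1 - p$2) (p$1)"
    by (simp_all add: vec2_eq_iff)
  then show thesis using assms that unfolding frame_def by metis
qed

lemma frame_mem:
  assumes "frame c" "c x y \<in> tri (c a b) (c a' b') (c a'' b'')"
  shows "a \<le> k \<Longrightarrow> a' \<le> k \<Longrightarrow> a'' \<le> k \<Longrightarrow> x \<le> k"
    "k \<le> a \<Longrightarrow> k \<le> a' \<Longrightarrow> k \<le> a'' \<Longrightarrow> k \<le> x"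
    "b \<le> k \<Longrightarrow> b' \<le> k \<Longrightarrow> b'' \<le> k \<Longrightarrow> y \<le> k"
    "k \<le> b \<Longrightarrow> k \<le> b' \<Longrightarrow> k \<le> b'' \<Longrightarrow> k \<le> y"
  using tri_cr_le[OF assms(2), of "c 0 1" "c 0 0" k] tri_cr_le[OF assms(2), of "c 0 0" "c 0 1" "- k"]
    tri_cr_le[OF assms(2), of "c 0 0" "c 1 0" k] tri_cr_le[OF assms(2), of "c 1 0" "c 0 0" "- k"]
  by (simp_all add: frame_cr[OF assms(1)])

lemma tri_perm3: "tri a b c = tri a c b" by (simp add: tri_def insert_commute)

lemma frame_mid:
  assumes "frame c" "0 < x + x'" "x + x' < 2" "0 < y + y'" "y + y' < 2"
  shows "0 < c x y $ 1 + c x' y' $ 1" "c x y $ 1 + c x' y' $ 1 < 2" "0 < c x y $ 2 + c x' y' $ 2" "c x y $ 2 + c x' y' $ 2 < 2"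
  using assms by (auto simp: frame_def)

text \<open>At the apex of \<open>B\<close>, the neighbours of its two slanted edges are sought. As
  all depths are below 1/2, \<open>T\<close> cannot reach the apex, \<open>L\<close> reaches it only
  if \<open>u1 <= d4\<close> and \<open>R\<close> only if \<open>1 - d2 <= u1\<close>. These
  conditions exclude each other, so \<open>F\<close> borders at least one of the two edges
  there.\<close>

lemma apex_edges:
  assumes D: "triangle_dissection n D" and c: "frame c" and DD: "D = {B, R, T, L, F}"
    and B: "B = tri (c 0 0) (c 1 0) (c u1 d1)" and R: "R = tri (c 1 0) (c 1 1) (c (1 - d2) u2)"
    and T: "T = tri (c 1 1) (c 0 1) (c (1 - u3) (1 - d3))" and L: "L = tri (c 0 1) (c 0 0) (c d4 (1 - u4))"
    and u: "0 < u1" "u1 < 1" "0 < d1" "d1 < 1/2" "0 < d2" "d2 < 1/2" "0 < d3" "d3 < 1/2" "0 < d4" "d4 < 1/2"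
  shows "u1 \<le> d4 \<or> nb (c 0 0) (c u1 d1) (c 1 0) F" "1 - d2 \<le> u1 \<or> nb (c 1 0) (c u1 d1) (c 0 0) F"
proof -
  note crs = frame_cr[OF c]
  have inR: "c u1 d1 \<in> R \<Longrightarrow> 1 - d2 \<le> u1" unfolding R using frame_mem(2)[OF c, of _ _ 1 0 1 1 "1 - d2" u2 "1 - d2"] u by simp
  have inT: "c u1 d1 \<in> T \<Longrightarrow> 1 - d3 \<le> d1" unfolding T using frame_mem(4)[OF c, of _ _ 1 1 0 1 "1 - u3" "1 - d3" "1 - d3"] u by simp
  have inL: "c u1 d1 \<in> L \<Longrightarrow> u1 \<le> d4" unfolding L using frame_mem(1)[OF c, of _ _ 0 1 0 0 d4 "1 - u4" d4] u by simp
  have B1: "B = tri (c 0 0) (c u1 d1) (c 1 0)" unfolding B by (rule tri_perm3)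
  have B2: "B = tri (c 1 0) (c u1 d1) (c 0 0)" unfolding B1 tri_def by (simp add: insert_commute)
  have BD: "tri (c 0 0) (c u1 d1) (c 1 0) \<in> D" "tri (c 1 0) (c u1 d1) (c 0 0) \<in> D"
    using DD B1 B2 by blast+
  obtain X where X: "X \<in> D" "X \<noteq> B" "nb (c 0 0) (c u1 d1) (c 1 0) X"
    using nb_ex[OF D BD(1)] frame_mid[OF c, of 0 u1 0 d1] u unfolding B1 by auto
  have "\<not> nb (c 0 0) (c u1 d1) (c 1 0) R"
  proof
    assume a: "nb (c 0 0) (c u1 d1) (c 1 0) R"
    then have "u1 = d1" using nb_on2[of "c 0 0" "c u1 d1" "c 1 0" "c 1 0" "c 1 1" "c (1 - d2) u2"] u
      unfolding R on2_def crs by auto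
    then show False using inR[OF nb_mem[OF a]] u by simp
  qed
  moreover have "\<not> nb (c 0 0) (c u1 d1) (c 1 0) T" using inT[OF nb_mem] u by fastforce
  moreover have "nb (c 0 0) (c u1 d1) (c 1 0) L \<Longrightarrow> u1 \<le> d4" using inL[OF nb_mem] .
  ultimately show "u1 \<le> d4 \<or> nb (c 0 0) (c u1 d1) (c 1 0) F" using X unfolding DD by blast
  obtain Y where Y: "Y \<in> D" "Y \<noteq> B" "nb (c 1 0) (c u1 d1) (c 0 0) Y"
    using nb_ex[OF D BD(2)] frame_mid[OF c, of 1 u1 0 d1] u unfolding B2 by auto
  have "\<not> nb (c 1 0) (c u1 d1) (c 0 0) L"
  proof
    assume a: "nb (c 1 0) (c u1 d1) (c 0 0) L"
    then have "u1 = 1 - d1" using nb_on2[of "c 1 0" "c u1 d1" "c 0 0" "c 0 1" "c 0 0" "c d4 (1 - u4)"] u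
      unfolding L on2_def crs by auto
    then show False using inL[OF nb_mem[OF a]] u by simp
  qed
  moreover have "\<not> nb (c 1 0) (c u1 d1) (c 0 0) T" using inT[OF nb_mem] u by fastforce
  moreover have "nb (c 1 0) (c u1 d1) (c 0 0) R \<Longrightarrow> 1 - d2 \<le> u1" using inR[OF nb_mem] .
  ultimately show "1 - d2 \<le> u1 \<or> nb (c 1 0) (c u1 d1) (c 0 0) F" using Y unfolding DD by blast
qed

lemma nonneg_of_neg_mult: "0 < d \<Longrightarrow> - d * e \<le> 0 \<Longrightarrow> 0 \<le> (e::real)"
  by (simp add: zero_le_mult_iff)

text \<open>A single edge of \<open>F\<close> cannot serve slanted edges from two adjacent sides.
  The lines could coincide only through the common corner (\<open>GG\<close>) or along a diagonal
  (\<open>ON\<close>); in the other two cases the common line would contain a side, on which no apex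
  lies.\<close>

lemma adjacent_apexes:
  assumes c: "frame c"
    and l1: "a1 = c 0 0 \<and> w1 = c 1 0 \<or> a1 = c 1 0 \<and> w1 = c 0 0" "nb a1 (c u1 d1) w1 F"
    and l2: "a2 = c 1 0 \<and> w2 = c 1 1 \<or> a2 = c 1 1 \<and> w2 = c 1 0" "nb a2 (c (1 - d2) u2) w2 F"
    and same: "sameline a1 (c u1 d1) a2 (c (1 - d2) u2)"
    and e: "1 - d2 \<le> u1 \<or> nb (c 1 0) (c u1 d1) (c 0 0) F"
    and u: "0 < u1" "u1 < 1" "0 < d1" "d1 < 1/2" "0 < u2" "0 < d2" "d2 < 1/2"
  shows False
proof -
  note crs = frame_cr[OF c]
  consider (GG) "a1 = c 1 0" "w1 = c 0 0" "a2 = c 1 0" "w2 = c 1 1" | (ON) "a1 = c 0 0" "w1 = c 1 0" "a2 = c 1 1" "w2 = c 1 0"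
    | (OG) "a1 = c 0 0" "a2 = c 1 0" | (GN) "a1 = c 1 0" "a2 = c 1 1" using l1(1) l2(1) by blast
  then show False
  proof cases
    case GG
    \<comment> \<open>The corners \<open>w1\<close> and \<open>w2\<close> lie on opposite sides of
      the common line, so \<open>F\<close>, lying beyond it as seen from either, would have to be on
      both sides.\<close>
    have eq: "(1 - u1) * u2 = d1 * d2" using same unfolding GG sameline_def crs by (simp add: algebra_simps)
    obtain p where p: "p \<in> F" "cr (c 1 0) (c u1 d1) (c 0 0) * cr (c 1 0) (c u1 d1) p < 0"
      using nb_strict[OF l1(2)] unfolding GG by blast
    obtain x y where xy: "p = c x y" using frame_surj[OF c] .
    have "d1 * ((u1 - 1) * y - d1 * (x - 1)) < 0" using p(2) unfolding xy crs by (simp add: algebra_simps)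
    then have "(u1 - 1) * y - d1 * (x - 1) < 0" using u(3) by (metis mult_less_0_iff less_asym)
    then have 1: "d1 * (1 - x) < (1 - u1) * y" by (simp add: algebra_simps)
    have "- d2 * (- d2 * y - u2 * (x - 1)) \<le> 0" using nb_side[OF l2(2) p(1)] unfolding GG xy crs by (simp add: algebra_simps)
    then have 2: "d2 * y \<le> u2 * (1 - x)" using nonneg_of_neg_mult[OF u(6)] by (fastforce simp: algebra_simps)
    have "u2 * (d1 * (1 - x)) < u2 * ((1 - u1) * y)" using 1 u by (intro mult_strict_left_mono) auto
    moreover have "d1 * (d2 * y) \<le> d1 * (u2 * (1 - x))" using 2 u by (intro mult_left_mono) auto
    moreover have "u2 * ((1 - u1) * y) = d1 * (d2 * y)" using eq by algebra
    moreover have "u2 * (d1 * (1 - x)) = d1 * (u2 * (1 - x))" by algebra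
    ultimately show False by linarith
  next
    case ON
    \<comment> \<open>The common line is the diagonal, so \<open>u1 = d1 < 1/2\<close> and by
      \<open>e\<close> the triangle \<open>F\<close> also borders the other slanted edge. That edge
      runs from the diagonal to \<open>c 1 0\<close>, on the side which \<open>F\<close> must
      avoid.\<close>
    have eq: "u1 = d1" using same unfolding ON sameline_def crs by simp
    then have "nb (c 1 0) (c u1 d1) (c 0 0) F" using e u by simp
    then obtain t where t: "0 < t" "c u1 d1 + t *\<^sub>R (c 1 0 - c u1 d1) \<in> F" using nb_along by blast
    have "cr (c 0 0) (c u1 d1) (c 1 0) * cr (c 0 0) (c u1 d1) (c u1 d1 + t *\<^sub>R (c 1 0 - c u1 d1)) \<le> 0"
      using nb_side[OF l1(2) t(2)] unfolding ON .
    then have "(- d1) * (- (d1 * t)) \<le> 0" unfolding frame_line[OF c] crs eq by (simp add: algebra_simps)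
    moreover have "0 < d1 * (d1 * t)" using t u by simp
    ultimately show False by simp
  next
    case OG then show False using same u unfolding sameline_def by (simp add: crs)
  next
    case GN then show False using same u unfolding sameline_def by (simp add: crs)
  qed
qed

text \<open>A common line would be a diagonal with \<open>w1\<close> and \<open>w3\<close> on
  opposite sides of it, and \<open>F\<close> cannot lie beyond it as seen from both. The remaining
  combinations of corners would put the apexes on a side of the square.\<close>

lemma opposite_apexes:
  assumes c: "frame c"
    and l1: "a1 = c 0 0 \<and> w1 = c 1 0 \<or> a1 = c 1 0 \<and> w1 = c 0 0" "nb a1 (c u1 d1) w1 F"
    and l3: "a3 = c 1 1 \<and> w3 = c 0 1 \<or> a3 = c 0 1 \<and> w3 = c 1 1" "nb a3 (c (1 - u3) (1 - d3)) w3 F"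
    and same: "sameline a1 (c u1 d1) a3 (c (1 - u3) (1 - d3))"
    and u: "0 < u1" "u1 < 1" "0 < d1" "d1 < 1/2" "0 < d3" "d3 < 1/2"
  shows False
proof -
  note crs = frame_cr[OF c]
  consider (ON) "a1 = c 0 0" "w1 = c 1 0" "a3 = c 1 1" "w3 = c 0 1" | (GK) "a1 = c 1 0" "w1 = c 0 0" "a3 = c 0 1" "w3 = c 1 1"
    | (OK) "a1 = c 0 0" "a3 = c 0 1" | (GN) "a1 = c 1 0" "a3 = c 1 1" using l1(1) l3(1) by blast
  then show False
  proof cases
    case ON
    have eq: "u1 = d1" using same unfolding ON sameline_def crs by simp
    have eq3: "u3 = d3" using same u unfolding ON sameline_def crs eq by (simp flip: right_diff_distrib)
    obtain p where p: "p \<in> F" "cr a1 (c u1 d1) w1 * cr a1 (c u1 d1) p < 0" using nb_strict[OF l1(2)] by blast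
    obtain x y where xy: "p = c x y" using frame_surj[OF c] .
    have "(- d1) * (d1 * (y - x)) < 0" using p(2) unfolding ON xy crs eq by (simp add: algebra_simps)
    then have "x < y" using u by (simp add: mult_less_0_iff zero_less_mult_iff)
    have "(- d3) * (d3 * (x - y)) \<le> 0" using nb_side[OF l3(2) p(1)] unfolding ON xy crs eq3 by (simp add: algebra_simps)
    then have "y \<le> x" using u by (simp add: mult_le_0_iff zero_le_mult_iff)
    then show False using \<open>x < y\<close> by simp
  next
    case GK
    have eq: "u1 = 1 - d1" using same unfolding GK sameline_def crs by simp
    have "d1 * (u3 - (1 - d3)) = 0" using same unfolding GK sameline_def crs eq by (simp add: algebra_simps)
    then have eq3: "u3 = 1 - d3" using u by simp
    obtain p where p: "p \<in> F" "cr a1 (c u1 d1) w1 * cr a1 (c u1 d1) p < 0" using nb_strict[OF l1(2)] by blast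
    obtain x y where xy: "p = c x y" using frame_surj[OF c] .
    have "d1 * (d1 * (1 - x - y)) < 0" using p(2) unfolding GK xy crs eq by (simp add: algebra_simps)
    then have "1 < x + y" using u by (simp add: mult_less_0_iff)
    have "d3 * (d3 * (x + y - 1)) \<le> 0" using nb_side[OF l3(2) p(1)] unfolding GK xy crs eq3 by (simp add: algebra_simps)
    then have "x + y \<le> 1" using u by (simp add: mult_le_0_iff)
    then show False using \<open>1 < x + y\<close> by simp
  next
    case OK then show False using same u unfolding sameline_def by (simp add: crs)
  next
    case GN then show False using same u unfolding sameline_def by (simp add: crs)
  qed
qed

lemma pt_tri_mem:
  assumes "pt x y \<in> tri (pt a b) (pt a' b') (pt a'' b'')"
  shows "a \<le> k \<Longrightarrow> a' \<le> k \<Longrightarrow> a'' \<le> k \<Longrightarrow> x \<le> k"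
    "k \<le> a \<Longrightarrow> k \<le> a' \<Longrightarrow> k \<le> a'' \<Longrightarrow> k \<le> x"
    "b \<le> k \<Longrightarrow> b' \<le> k \<Longrightarrow> b'' \<le> k \<Longrightarrow> y \<le> k"
    "k \<le> b \<Longrightarrow> k \<le> b' \<Longrightarrow> k \<le> b'' \<Longrightarrow> k \<le> y"
  using frame_mem[of pt, OF _ assms] by (simp_all add: frame_def)

lemma full_sideD:
  assumes "full_side c D X x y" "near D"
  shows "X \<in> D" "X = tri (c 0 0) (c 1 0) (c x y)" "0 \<le> x" "x \<le> 1" "y = area2 X" "3639/10000 \<le> y" "y \<le> 4361/10000"
proof -
  show "X \<in> D" "X = tri (c 0 0) (c 1 0) (c x y)" "0 \<le> x" "x \<le> 1" and y: "y = area2 X"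
    using assms(1) unfolding full_side_def by blast+
  show "3639/10000 \<le> y" "y \<le> 4361/10000" unfolding y using near_bounds[OF assms(2) \<open>X \<in> D\<close>] .
qed

text \<open>By \<open>apex_edges\<close> the fifth triangle \<open>F\<close> borders a slanted edge
  at each of the four apexes. Having only three edges, it would use one line for two of them;
  \<open>adjacent_apexes\<close> and \<open>opposite_apexes\<close> exclude all six pairs.\<close>

lemma all_sides_full:
  assumes nD: "near D" and b: "full_side pt D B u1 d1" and r: "full_side right_side D R u2 d2"
    and t: "full_side top_side D T x3 d3" and l: "full_side left_side D L y4 d4"
  shows False
proof -
  note D = near_dissection[OF nD]
  \<comment> \<open>The frames run counterclockwise round the square, whereas
    \<open>top_side\<close> runs rightwards and \<open>left_side\<close> upwards; hence the
    complements.\<close>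
  define u3 u4 where "u3 = 1 - x3" and "u4 = 1 - y4"
  note B = full_sideD[OF b nD] and R = full_sideD[OF r nD] and T = full_sideD[OF t nD] and L = full_sideD[OF l nD]
  have Be: "B = tri SW SE (pt u1 d1)" and Re: "R = tri SE NE (pt (1 - d2) u2)"
    using B(2) R(2) by simp_all
  have Te: "T = tri NE NW (pt (1 - u3) (1 - d3))"
    using T(2) tri_perm(2)[of "NW"] by (simp add: u3_def)
  have Le: "L = tri NW SW (pt d4 (1 - u4))"
    using L(2) tri_perm(2)[of "SW"] by (simp add: u4_def)
  note d = B(6,7) R(6,7) T(6,7) L(6,7)
  have u0: "0 \<le> u1" "u1 \<le> 1" "0 \<le> u2" "u2 \<le> 1" "0 \<le> u3" "u3 \<le> 1" "0 \<le> u4" "u4 \<le> 1"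
    using B(3,4) R(3,4) T(3,4) L(3,4) by (simp_all add: u3_def u4_def)
  have inB: "y \<le> d1" if "pt x y \<in> B" for x y using pt_tri_mem(3)[of x y, OF that[unfolded Be], of d1] d by simp
  have inR: "1 - d2 \<le> x" if "pt x y \<in> R" for x y using pt_tri_mem(2)[of x y, OF that[unfolded Re], of "1 - d2"] d by simp
  have inT: "1 - d3 \<le> y" if "pt x y \<in> T" for x y using pt_tri_mem(4)[of x y, OF that[unfolded Te], of "1 - d3"] d by simp
  have inL: "x \<le> d4" if "pt x y \<in> L" for x y using pt_tri_mem(1)[of x y, OF that[unfolded Le], of d4] d by simp
  have V: "SW \<in> B" "SE \<in> B" "SE \<in> R" "NE \<in> R" "NE \<in> T" "NW \<in> T" "NW \<in> L" "SW \<in> L"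
    unfolding Be Re Te Le by simp_all
  have P: "pt u1 d1 \<in> B" "pt (1 - d2) u2 \<in> R" "pt (1 - u3) (1 - d3) \<in> T" "pt d4 (1 - u4) \<in> L"
    unfolding Be Re Te Le by simp_all
  have ne: "B \<noteq> R" "B \<noteq> T" "B \<noteq> L" "R \<noteq> T" "R \<noteq> L" "T \<noteq> L"
    using V inB[of 1 1] inB[of 0 1] inR[of 0 1] inL[of 1 0] inL[of 1 1] d by auto
  obtain F where F: "F \<in> D" "distinct [B, R, T, L, F]" "D = {B, R, T, L, F}"
    using fifth_ex[OF nD B(1) R(1) T(1) L(1)] ne by auto
  have u: "0 < u1" "u1 < 1" "0 < u2" "u2 < 1" "0 < u3" "u3 < 1" "0 < u4" "u4 < 1"
  proof -
    have "u1 \<noteq> 0" using side_unique(3)[OF D L(1) B(1), of 0 d1 1] V P d ne by auto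
    moreover have "u1 \<noteq> 1" using side_unique(4)[OF D R(1) B(1), of 0 d1 1] V P d ne by auto
    moreover have "u2 \<noteq> 0" using side_unique(1)[OF D B(1) R(1), of 0 "1 - d2" 1] V P d ne by auto
    moreover have "u2 \<noteq> 1" using side_unique(2)[OF D T(1) R(1), of 0 "1 - d2" 1] V P d ne by auto
    moreover have "u3 \<noteq> 0" using side_unique(4)[OF D R(1) T(1), of 0 "1 - d3" 1] V P d ne by auto
    moreover have "u3 \<noteq> 1" using side_unique(3)[OF D L(1) T(1), of 0 "1 - d3" 1] V P d ne by auto
    moreover have "u4 \<noteq> 0" using side_unique(2)[OF D T(1) L(1), of 0 d4 1] V P d ne by auto
    moreover have "u4 \<noteq> 1" using side_unique(1)[OF D B(1) L(1), of 0 d4 1] V P d ne by auto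
    ultimately show "0 < u1" "u1 < 1" "0 < u2" "u2 < 1" "0 < u3" "u3 < 1" "0 < u4" "u4 < 1" using u0 by linarith+
  qed
  have d': "0 < d1" "d1 < 1/2" "0 < d2" "d2 < 1/2" "0 < d3" "d3 < 1/2" "0 < d4" "d4 < 1/2" using d by linarith+
  have fr: "frame pt" "frame right_side" "frame (\<lambda>x y. pt (1 - x) (1 - y))" "frame (\<lambda>x y. pt y (1 - x))"
    by (simp_all add: frame_def)
  have D': "D = {R, T, L, B, F}" "D = {T, L, B, R, F}" "D = {L, B, R, T, F}" using F(3) by (simp_all add: insert_commute)
  note e1 = apex_edges[OF D fr(1) F(3) Be Re Te Le u(1,2) d']
  have e2: "u2 \<le> d1 \<or> nb SE (pt (1 - d2) u2) NE F" "1 - d3 \<le> u2 \<or> nb NE (pt (1 - d2) u2) SE F"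
    using apex_edges[of 5 D "right_side" R T L B F u2 d2 d3 u3 u4 d4 d1 u1, OF D fr(2) D'(1)] Be Re Te Le u d' by simp_all
  have e3: "u3 \<le> d2 \<or> nb NE (pt (1 - u3) (1 - d3)) NW F" "1 - d4 \<le> u3 \<or> nb NW (pt (1 - u3) (1 - d3)) NE F"
    using apex_edges[of 5 D "(\<lambda>x y. pt (1 - x) (1 - y))" T L B R F u3 d3 d4 u4 u1 d1 d2 u2, OF D fr(3) D'(2)] Be Re Te Le u d' by simp_all
  have e4: "u4 \<le> d3 \<or> nb NW (pt d4 (1 - u4)) SW F" "1 - d1 \<le> u4 \<or> nb SW (pt d4 (1 - u4)) NW F"
    using apex_edges[of 5 D "(\<lambda>x y. pt y (1 - x))" L B R T F u4 d4 d1 u1 u2 d2 d3 u3, OF D fr(4) D'(3)] Be Re Te Le u d' by simp_all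
  obtain a1 w1 where l1: "a1 = SW \<and> w1 = SE \<or> a1 = SE \<and> w1 = SW" "nb a1 (pt u1 d1) w1 F"
    using e1 d' by fastforce
  obtain a2 w2 where l2: "a2 = SE \<and> w2 = NE \<or> a2 = NE \<and> w2 = SE" "nb a2 (pt (1 - d2) u2) w2 F"
    using e2 d' by fastforce
  obtain a3 w3 where l3: "a3 = NE \<and> w3 = NW \<or> a3 = NW \<and> w3 = NE" "nb a3 (pt (1 - u3) (1 - d3)) w3 F"
    using e3 d' by fastforce
  obtain a4 w4 where l4: "a4 = NW \<and> w4 = SW \<or> a4 = SW \<and> w4 = NW" "nb a4 (pt d4 (1 - u4)) w4 F"
    using e4 d' by fastforce
  have av: "a1 \<noteq> pt u1 d1" "a2 \<noteq> pt (1 - d2) u2" "a3 \<noteq> pt (1 - u3) (1 - d3)" "a4 \<noteq> pt d4 (1 - u4)"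
    using l1(1) l2(1) l3(1) l4(1) u d' by auto
  obtain f g h where fgh: "F = tri f g h" "cr f g h \<noteq> 0" using dissection_tri[OF D F(1)] by metis
  have "\<not> sameline a1 (pt u1 d1) a2 (pt (1 - d2) u2)"
    using adjacent_apexes[OF fr(1) l1 l2 _ e1(2)] u d' by auto
  moreover have "\<not> sameline a2 (pt (1 - d2) u2) a3 (pt (1 - u3) (1 - d3))"
    using adjacent_apexes[of "right_side" a2 w2 u2 d2 F a3 w3 d3 u3, OF fr(2)] l2 l3 e2(2) u d' by auto
  moreover have "\<not> sameline a3 (pt (1 - u3) (1 - d3)) a4 (pt d4 (1 - u4))"
    using adjacent_apexes[of "(\<lambda>x y. pt (1 - x) (1 - y))" a3 w3 u3 d3 F a4 w4 d4 u4, OF fr(3)] l3 l4 e3(2) u d' by auto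
  moreover have "\<not> sameline a4 (pt d4 (1 - u4)) a1 (pt u1 d1)"
    using adjacent_apexes[of "(\<lambda>x y. pt y (1 - x))" a4 w4 u4 d4 F a1 w1 d1 u1, OF fr(4)] l4 l1 e4(2) u d' by auto
  moreover have "\<not> sameline a1 (pt u1 d1) a3 (pt (1 - u3) (1 - d3))"
    using opposite_apexes[OF fr(1) l1 l3] u d' by auto
  moreover have "\<not> sameline a2 (pt (1 - d2) u2) a4 (pt d4 (1 - u4))"
    using opposite_apexes[of "right_side" a2 w2 u2 d2 F a4 w4 u4 d4, OF fr(2)] l2 l4 u d' by auto
  ultimately show False
    using four_lines[OF fgh(2) nb_on2[OF l1(2)[unfolded fgh(1)]] nb_on2[OF l2(2)[unfolded fgh(1)]]
      nb_on2[OF l3(2)[unfolded fgh(1)]] nb_on2[OF l4(2)[unfolded fgh(1)]] av]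
      sameline_sym[OF av(1), of a4 "pt d4 (1 - u4)"] by blast
qed

section \<open>One divided side\<close>

lemma split_sideD:
  assumes "split_side c D s X x y X' x' y'" "near D"
  shows "X \<in> D" "X' \<in> D" "X \<noteq> X'" "X = tri (c 0 0) (c s 0) (c x y)" "X' = tri (c s 0) (c 1 0) (c x' y')"
    "3639/10000 \<le> s" "s \<le> 6361/10000" "0 \<le> x" "x \<le> 1" "0 \<le> x'" "x' \<le> 1" "s * y = area2 X" "(1 - s) * y' = area2 X'"
    "572/1000 \<le> y" "y \<le> 1" "572/1000 \<le> y'" "y' \<le> 1"
proof -
  \<comment> \<open>The value 572/1000 is rounded down from 0.3639 / 0.6361, the least area over the
    longest possible base.\<close>
  have low: "572/1000 \<le> v" if "3639/10000 \<le> u * v" "u \<le> 6361/10000" "0 < u" "0 < v" for u v :: real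
  proof (rule ccontr)
    assume "\<not> 572/1000 \<le> v"
    then have "u * v \<le> 6361/10000 * (572/1000)" using that by (intro mult_mono) auto
    then show False using that by simp
  qed
  show X: "X \<in> D" "X' \<in> D" "X \<noteq> X'" "X = tri (c 0 0) (c s 0) (c x y)" "X' = tri (c s 0) (c 1 0) (c x' y')"
    "3639/10000 \<le> s" "s \<le> 6361/10000" "0 \<le> x" "x \<le> 1" "0 \<le> x'" "x' \<le> 1" and e: "s * y = area2 X" "(1 - s) * y' = area2 X'"
    and y1: "y \<le> 1" "y' \<le> 1"
    using assms(1) unfolding split_side_def by blast+
  have y0: "0 < y" "0 < y'" using assms(1) unfolding split_side_def by blast+
  show "572/1000 \<le> y" by (rule low[of s]) (use near_bounds(1)[OF assms(2) X(1)] e X(6,7) y0 in linarith)+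
  show "572/1000 \<le> y'" by (rule low[of "1 - s"]) (use near_bounds(1)[OF assms(2) X(2)] e X(6,7) y0 in linarith)+
qed

lemma side_notin:
  assumes "triangle_dissection n D" "X \<in> D" "Y \<in> D" "X \<noteq> Y" "a < t" "t < b"
  shows "pt a 0 \<in> X \<Longrightarrow> pt b 0 \<in> X \<Longrightarrow> pt t 0 \<notin> Y"
    "pt a 1 \<in> X \<Longrightarrow> pt b 1 \<in> X \<Longrightarrow> pt t 1 \<notin> Y"
    "pt 0 a \<in> X \<Longrightarrow> pt 0 b \<in> X \<Longrightarrow> pt 0 t \<notin> Y"
    "pt 1 a \<in> X \<Longrightarrow> pt 1 b \<in> X \<Longrightarrow> pt 1 t \<notin> Y"
  using side_unique[OF assms(1-3,5,6)] assms(4) by blast+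

text \<open>The value 774/1000 is rounded up from 0.4361 / 0.5639: the largest area over the
  remainder of a side from which at most 0.4361 has been cut off.\<close>

lemma height_bound: "5639/10000 \<le> a \<Longrightarrow> 0 \<le> y \<Longrightarrow> a * y \<le> 4361/10000 \<Longrightarrow> y < (774/1000::real)"
  using mult_mono[of "5639/10000" a "774/1000" y] by fastforce

text \<open>The five triangles all stand on sides, and the neighbour at the apex of \<open>T\<close>
  of its left slanted edge is one of them. Both alternatives of the conclusion put the apex into the
  left half.\<close>

lemma top_apex_left:
  assumes D: "triangle_dissection 5 D" and DD: "D = {B1, B2, R, T, L}"
    and B1: "B1 = tri SW (pt s 0) (pt x1 y1)" and B2: "B2 = tri (pt s 0) SE (pt x2 y2)"
    and R: "R = tri SE NE (pt (1 - r) yR)" and T: "T = tri NW NE (pt xT (1 - q))"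
    and L: "L = tri SW NW (pt l yL)" and ne: "L \<noteq> B1" "L \<noteq> T"
    and b: "3639/10000 \<le> s" "s \<le> 6361/10000" "3639/10000 \<le> l" "l < 1/2" "0 < q" "q < 1/2" "3639/10000 \<le> s * y1" "y1 \<le> 1" "0 < y1"
      "0 < xT" "xT < 1" "0 < yL" "yL < 1"
  shows "xT \<le> l \<or> xT = q"
proof -
  have TD: "tri NW (pt xT (1 - q)) NE \<in> D" using DD T tri_perm3 by blast
  have T': "T = tri NW (pt xT (1 - q)) NE" unfolding T by (rule tri_perm3)
  obtain X where X: "X \<in> D" "X \<noteq> T" "nb NW (pt xT (1 - q)) NE X"
    using nb_ex[OF D TD] b unfolding T' by auto
  have "xT \<le> l" if "nb NW (pt xT (1 - q)) NE L"
    using pt_tri_mem(1)[OF nb_mem[OF that[unfolded L]], of l] b by simp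
  moreover have "xT = q" if "nb NW (pt xT (1 - q)) NE R"
    using nb_on2[OF that[unfolded R]] b by (auto simp: on2_def)
  moreover have "xT = q" if nb: "nb NW (pt xT (1 - q)) NE B2"
  proof (rule ccontr)
    assume "xT \<noteq> q"
    then have "xT = q * s" using nb_on2[OF nb[unfolded B2]] b by (auto simp: on2_def)
    moreover have "q * (q - xT) \<le> 0" using nb_side[OF nb, of "SE"] unfolding B2 by simp
    then have "q \<le> xT" using b by (simp add: mult_le_0_iff)
    moreover have "q * s < q * 1" using b by (intro mult_strict_left_mono) auto
    ultimately show False by simp
  qed
  \<comment> \<open>The apexes of \<open>T\<close> and \<open>B1\<close> would both lie on the line
    through \<open>NW\<close> and \<open>pt s 0\<close>. The angle of \<open>T\<close> at
    \<open>NW\<close> and that of \<open>B1\<close> at \<open>SW\<close> then confine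
    \<open>L\<close> so much that \<open>l <= s - s * y1\<close>, which is at most 0.6361 -
    0.3639.\<close>
  moreover have False if nb: "nb NW (pt xT (1 - q)) NE B1"
  proof -
    have e: "xT = q * s" "q * x1 = xT * (1 - y1)"
      using nb_on2[OF nb[unfolded B1]] b by (auto simp: on2_def algebra_simps)
    then have x1: "x1 = s * (1 - y1)" using b by simp
    have LD: "L \<in> D" "T \<in> D" "B1 \<in> D" using DD by auto
    have "\<not> 0 < q * l - xT * (1 - yL)"
    proof
      assume "0 < q * l - xT * (1 - yL)"
      then show False
        using cone_disjoint[OF D LD(1,2) ne(2), of "NW" "pt l yL" "pt xT (1 - q)" "NE" 1] b
        unfolding L T by (simp add: algebra_simps)
    qed
    then have "q * l \<le> q * (s * (1 - yL))" unfolding e(1) by (simp add: algebra_simps)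
    then have 1: "l \<le> s * (1 - yL)" using b by simp
    have "\<not> 0 < l * y1 - yL * x1"
    proof
      assume "0 < l * y1 - yL * x1"
      then show False
        using cone_disjoint[OF D LD(1,3) ne(1), of "SW" "pt l yL" "pt s 0" "pt x1 y1" 1] b
        unfolding L B1 by simp
    qed
    then have 2: "l * y1 \<le> s * (1 - y1) * yL" unfolding x1 by (simp add: algebra_simps)
    have "l * (1 - y1) \<le> s * (1 - yL) * (1 - y1)" using 1 b by (intro mult_right_mono) auto
    then have "l \<le> s - s * y1" using 2 by (simp add: algebra_simps)
    then show False using b by linarith
  qed
  ultimately show ?thesis using X unfolding DD by blast
qed

text \<open>\<open>top_apex_left\<close> gives \<open>xT < 1/2\<close>; applied to the mirror image
  under \<open>flip_x\<close> it gives \<open>1 - xT < 1/2\<close>.\<close>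

lemma one_split_no_corner:
  assumes nD: "near D" and b: "split_side pt D s B1 x1 y1 B2 x2 y2" and r: "full_side right_side D R yR r"
    and t: "full_side top_side D T xT q" and l: "full_side left_side D L yL l"
    and ne: "L \<noteq> B1" "R \<noteq> B2"
  shows False
proof -
  note D = near_dissection[OF nD]
  note B = split_sideD[OF b nD] and R = full_sideD[OF r nD] and T = full_sideD[OF t nD] and L = full_sideD[OF l nD]
  have Be: "B1 = tri SW (pt s 0) (pt x1 y1)" "B2 = tri (pt s 0) SE (pt x2 y2)" using B(4,5) by simp_all
  have Re: "R = tri SE NE (pt (1 - r) yR)" using R(2) by simp
  have Te: "T = tri NW NE (pt xT (1 - q))" using T(2) by simp
  have Le: "L = tri SW NW (pt l yL)" using L(2) by simp
  note d = R(6,7) T(6,7) L(6,7)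
  have inR: "1 - r \<le> x" if "pt x y \<in> R" for x y using pt_tri_mem(2)[of x y, OF that[unfolded Re], of "1 - r"] d by simp
  have inT: "1 - q \<le> y" if "pt x y \<in> T" for x y using pt_tri_mem(4)[of x y, OF that[unfolded Te], of "1 - q"] d by simp
  have inL: "x \<le> l" if "pt x y \<in> L" for x y using pt_tri_mem(1)[of x y, OF that[unfolded Le], of l] d by simp
  have V: "SW \<in> B1" "SE \<in> B2" "SE \<in> R" "NE \<in> R" "NE \<in> T" "NW \<in> T" "NW \<in> L" "SW \<in> L"
    "pt s 0 \<in> B1" "pt s 0 \<in> B2" "pt (1 - r) yR \<in> R" "pt xT (1 - q) \<in> T" "pt l yL \<in> L"
    unfolding Be Re Te Le by simp_all
  have ni: "SW \<notin> R" "NW \<notin> R" "SW \<notin> T" "SE \<notin> T" "SE \<notin> L" "NE \<notin> L"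
    using inR[of 0 0] inR[of 0 1] inT[of 0 0] inT[of 1 0] inL[of 1 0] inL[of 1 1] d by auto
  have ne1: "B1 \<noteq> R" using V(1) ni(1) by blast
  have ne2: "B1 \<noteq> T" using V(1) ni(3) by blast
  have ne3: "B2 \<noteq> T" using V(2) ni(4) by blast
  have ne4: "B2 \<noteq> L" using V(2) ni(5) by blast
  have ne5: "T \<noteq> R" using V(6) ni(2) by blast
  have ne6: "R \<noteq> L" using V(3) ni(5) by blast
  have ne7: "T \<noteq> L" using V(5) ni(6) by blast
  have dist: "distinct [B1, B2, R, T, L]" using B(3) ne ne1 ne2 ne3 ne4 ne5 ne6 ne7 by simp
  have DD: "D = {B1, B2, R, T, L}" using five_eq[OF nD B(1,2) R(1) T(1) L(1) dist] .
  have "xT \<noteq> 0" using side_notin(3)[OF D L(1) T(1) ne7[symmetric] _ _ V(8,7), of "1 - q"] V(12) d by auto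
  moreover have "xT \<noteq> 1" using side_notin(4)[OF D R(1) T(1) ne5[symmetric] _ _ V(3,4), of "1 - q"] V(12) d by auto
  ultimately have xT: "0 < xT" "xT < 1" using T(3,4) by linarith+
  have "yL \<noteq> 0"
  proof
    assume "yL = 0"
    then have "pt (l/2) 0 \<in> L" using segment_mem[OF D L(1) V(8,13), of "1/2"] by (simp add: pt_between)
    then show False using side_notin(1)[OF D B(1) L(1) ne(1)[symmetric] _ _ V(1,9), of "l/2"] d B(6) by auto
  qed
  moreover have "yL \<noteq> 1" using side_notin(2)[OF D T(1) L(1) ne7 _ _ V(6,5), of l] V(13) d by auto
  ultimately have yL: "0 < yL" "yL < 1" using L(3,4) by linarith+
  have "yR \<noteq> 0"
  proof
    assume "yR = 0"
    then have "pt (1 - r/2) 0 \<in> R" using segment_mem[OF D R(1) V(3,11), of "1/2"] by (simp add: pt_between)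
    then show False using side_notin(1)[OF D B(2) R(1) ne(2)[symmetric] _ _ V(10,2), of "1 - r/2"] d B(7) by auto
  qed
  moreover have "yR \<noteq> 1" using side_notin(2)[OF D T(1) R(1) ne5 _ _ V(6,5), of "1 - r"] V(11) d by auto
  ultimately have yR: "0 < yR" "yR < 1" using R(3,4) by linarith+
  have h: "3639/10000 \<le> s * y1" "3639/10000 \<le> (1 - s) * y2" unfolding B(12,13) using near_bounds(1)[OF nD] B(1,2) by auto
  have "xT \<le> l \<or> xT = q"
    by (rule top_apex_left[OF D DD Be Re Te Le ne(1) ne7[symmetric]]) (use d xT yL h B(6,7,14,15) in \<open>auto\<close>)
  moreover have "1 - xT \<le> r \<or> 1 - xT = q"
  proof (rule top_apex_left[of "img flip_x D" "flip_x ` B2" "flip_x ` B1" "flip_x ` L" "flip_x ` T" "flip_x ` R" "1 - s" "1 - x2" y2 "1 - x1" y1 l yL "1 - xT" q r yR])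
    show "triangle_dissection 5 (img flip_x D)" by (rule sym_dissection[OF square_sym_flip D])
    show "img flip_x D = {flip_x ` B2, flip_x ` B1, flip_x ` L, flip_x ` T, flip_x ` R}" unfolding img_def DD by auto
    show "flip_x ` B2 = tri SW (pt (1 - s) 0) (pt (1 - x2) y2)" "flip_x ` B1 = tri (pt (1 - s) 0) SE (pt (1 - x1) y1)"
      "flip_x ` L = tri SE NE (pt (1 - l) yL)" "flip_x ` R = tri SW NW (pt r yR)"
      "flip_x ` T = tri NW NE (pt (1 - xT) (1 - q))"
      unfolding Be Re Te Le sym_tri[OF square_sym_flip] by (simp_all add: tri_perm(2))
    show "flip_x ` R \<noteq> flip_x ` B2" "flip_x ` R \<noteq> flip_x ` T" using ne(2) ne5 sym_involution[OF square_sym_flip] by metis+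
  qed (use d xT yR h B(6,7,16,17) in \<open>auto\<close>)
  ultimately show False using d by linarith
qed

text \<open>The bottom side is split and \<open>C\<close> occupies the whole left corner. The premise \<open>high\<close> excludes the case
  settled by the key inequality. The case distinction is on the neighbours of the slanted edge of \<open>C\<close>: \<open>T\<close>
  or \<open>F\<close> at \<open>NW\<close> (\<open>alpha\<close>, \<open>beta\<close>), and \<open>B\<close> or \<open>F\<close> at its foot (\<open>gamma\<close>, \<open>delta\<close>).\<close>

locale corner_split =
  fixes D :: "(real^2) set set" and C B R T F :: "(real^2) set" and s x2 y2 r yR xT q :: real
  assumes nD: "near D" and DD: "D = {C, B, R, T, F}" and dist: "distinct [C, B, R, T, F]"
    and Ce: "C = tri SW (pt s 0) NW" and Be: "B = tri (pt s 0) SE (pt x2 y2)"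
    and Re: "R = tri SE NE (pt (1 - r) yR)" and Te: "T = tri NW NE (pt xT (1 - q))"
    and C_area: "s = area2 C" and Ba: "(1 - s) * y2 = area2 B" and Ra: "r = area2 R" and Ta: "q = area2 T"
    and rng: "0 \<le> x2" "x2 \<le> 1" "0 < y2" "0 \<le> yR" "yR \<le> 1" "0 \<le> xT" "xT \<le> 1"
    and high: "1 - q < y2"
begin

lemma D: "triangle_dissection 5 D" by (rule near_dissection[OF nD])

lemma in_D: "C \<in> D" "B \<in> D" "R \<in> D" "T \<in> D" "F \<in> D" using DD by simp_all

lemma ne: "B \<noteq> C" "B \<noteq> R" "B \<noteq> T" "B \<noteq> F" "R \<noteq> C" "R \<noteq> T" "R \<noteq> F" "T \<noteq> C" "T \<noteq> F" "F \<noteq> C"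
  using dist by (simp_all, blast+)

lemma bounds: "3639/10000 \<le> s" "s \<le> 4361/10000" "3639/10000 \<le> r" "r \<le> 4361/10000" "3639/10000 \<le> q" "q \<le> 4361/10000"
    "3639/10000 \<le> (1 - s) * y2" "(1 - s) * y2 \<le> 4361/10000"
  unfolding Ba using near_bounds[OF nD] in_D unfolding C_area Ra Ta by blast+

lemma y2_less: "y2 < 774/1000" using height_bound[of "1 - s" y2] bounds rng by simp

lemma V: "SW \<in> C" "pt s 0 \<in> C" "NW \<in> C" "pt s 0 \<in> B" "SE \<in> B" "pt x2 y2 \<in> B"
    "SE \<in> R" "NE \<in> R" "pt (1 - r) yR \<in> R" "NW \<in> T" "NE \<in> T" "pt xT (1 - q) \<in> T"
  unfolding Ce Be Re Te by simp_all

lemma in_B: "pt x y \<in> B \<Longrightarrow> y \<le> y2" using pt_tri_mem(3)[of x y "s" 0 1 0 x2 y2 y2] rng unfolding Be by simp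
lemma in_R: "pt x y \<in> R \<Longrightarrow> 1 - r \<le> x" using pt_tri_mem(2)[of x y 1 0 1 1 "1 - r" yR "1 - r"] bounds unfolding Re by simp
lemma in_T: "pt x y \<in> T \<Longrightarrow> 1 - q \<le> y" using pt_tri_mem(4)[of x y 0 1 1 1 xT "1 - q" "1 - q"] bounds unfolding Te by simp
lemma in_C: "pt x y \<in> C \<Longrightarrow> x \<le> s" using pt_tri_mem(1)[of x y 0 0 s 0 0 1 s] bounds unfolding Ce by simp

lemma strict: "0 < x2" "x2 < 1" "0 < xT" "xT < 1" "0 < yR" "yR < 1"
proof -
  have "x2 \<noteq> 0" using side_notin(3)[OF D in_D(1,2) ne(1)[symmetric] _ _ V(1,3), of y2] V(6) y2_less rng by auto
  moreover have "x2 \<noteq> 1" using side_notin(4)[OF D in_D(3,2) ne(2)[symmetric] _ _ V(7,8), of y2] V(6) y2_less rng by auto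
  moreover have "xT \<noteq> 0" using side_notin(3)[OF D in_D(1,4) ne(8)[symmetric] _ _ V(1,3), of "1 - q"] V(12) bounds by auto
  moreover have "xT \<noteq> 1" using side_notin(4)[OF D in_D(3,4) ne(6) _ _ V(7,8), of "1 - q"] V(12) bounds by auto
  moreover have "yR \<noteq> 0" using side_notin(1)[OF D in_D(2,3) ne(2) _ _ V(4,5), of "1 - r"] V(9) bounds by auto
  moreover have "yR \<noteq> 1" using side_notin(2)[OF D in_D(4,3) ne(6)[symmetric] _ _ V(10,11), of "1 - r"] V(9) bounds by auto
  ultimately show "0 < x2" "x2 < 1" "0 < xT" "xT < 1" "0 < yR" "yR < 1" using rng by linarith+
qed

lemma neighbour:
  assumes "tri u v w \<in> D" "0 < u$1 + v$1" "u$1 + v$1 < 2" "0 < u$2 + v$2" "u$2 + v$2 < 2"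
  shows "nb u v w C \<or> nb u v w B \<or> nb u v w R \<or> nb u v w T \<or> nb u v w F"
  using nb_ex[OF D assms] unfolding DD by blast

lemma tri_forms:
  "tri (pt s 0) NW SW \<in> D" "tri NW (pt s 0) SW \<in> D"
  "tri NW (pt xT (1 - q)) NE \<in> D" "tri NE (pt xT (1 - q)) NW \<in> D"
  "tri (pt s 0) (pt x2 y2) SE \<in> D" "tri SE (pt x2 y2) (pt s 0) \<in> D"
  "tri SE (pt (1 - r) yR) NE \<in> D" "tri (pt (1 - r) yR) NE SE \<in> D"
  using in_D(1-4) unfolding Ce Be Re Te tri_def by (simp_all add: insert_commute)

text \<open>If \<open>T\<close> is the neighbour, one of its edges lies on the line of the slanted
  edge. That line passes through \<open>NW\<close> and misses \<open>NE\<close>, so it contains the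
  apex of \<open>T\<close>; this is the equation. The equation in \<open>gamma_or_delta\<close>
  arises likewise from \<open>B\<close>.\<close>

lemma alpha_or_beta: "xT = s * q \<or> nb (pt s 0) NW SW F"
proof -
  let ?nb = "nb (pt s 0) NW SW"
  have "\<not> ?nb C" using nb_self V(1) by blast
  moreover have "\<not> ?nb B" using in_B[OF nb_mem] y2_less by fastforce
  moreover have "\<not> ?nb R" using in_R[OF nb_mem] bounds by fastforce
  moreover have "xT = s * q" if "?nb T" using nb_on2[OF that[unfolded Te]] by (auto simp: on2_def algebra_simps)
  ultimately show ?thesis using neighbour[OF tri_forms(1)] bounds by auto
qed

lemma gamma_or_delta: "x2 = s * (1 - y2) \<or> nb NW (pt s 0) SW F"
proof -
  let ?nb = "nb NW (pt s 0) SW"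
  have "\<not> ?nb C" using nb_self V(1) by blast
  moreover have "\<not> ?nb T" using in_T[OF nb_mem] bounds by fastforce
  moreover have "\<not> ?nb R" using in_R[OF nb_mem] bounds by fastforce
  moreover have "x2 = s * (1 - y2)" if "?nb B" using nb_on2[OF that[unfolded Be]] bounds by (auto simp: on2_def algebra_simps)
  ultimately show ?thesis using neighbour[OF tri_forms(2)] bounds by auto
qed

text \<open>Otherwise \<open>T\<close> and \<open>F\<close> would both contain a stretch of the
  slanted line ending at \<open>NW\<close> while lying on the same side of it.
  \<open>delta_not_gamma\<close> repeats this at the foot with \<open>B\<close> and
  \<open>F\<close>.\<close>

lemma beta_not_alpha: assumes nb: "nb (pt s 0) NW SW F" shows "xT \<noteq> s * q"
proof
  assume a: "xT = s * q"
  obtain t where t: "0 < t" "t < 1" "NW + t *\<^sub>R (pt s 0 - NW) \<in> F" using nb_along[OF nb] by blast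
  obtain p where p: "p \<in> F" "cr (pt s 0) NW SW * cr (pt s 0) NW p < 0" using nb_strict[OF nb] by blast
  have "s * (s - p$1 - s * p$2) < 0" using p(2) by (simp add: cr_def algebra_simps)
  then have "s - p$1 - s * p$2 < 0" using bounds(1) by (simp add: mult_less_0_iff)
  then have pos: "0 < (NE $ 1 - s - (- s) * NE $ 2) * (p$1 - s - (- s) * p$2)" by simp
  show False
  proof (rule overlap[OF D in_D(4,5) ne(9) _ _ _ _ _ _ _ _ V(11) p(1) pos, of "1 - q" 1 "1 - t" 1])
    show "pt (s + - s * (1 - q)) (1 - q) \<in> T" using V(12) unfolding a by (simp add: algebra_simps)
    show "pt (s + - s * 1) 1 \<in> T" using V(10) by simp
    show "pt (s + - s * (1 - t)) (1 - t) \<in> F" using t(3) unfolding pt_between by (simp add: algebra_simps)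
    show "pt (s + - s * 1) 1 \<in> F" using nb_mem[OF nb] by simp
  qed (use t bounds in auto)
qed

lemma delta_not_gamma: assumes nb: "nb NW (pt s 0) SW F" shows "x2 \<noteq> s * (1 - y2)"
proof
  assume a: "x2 = s * (1 - y2)"
  obtain t where t: "0 < t" "t < 1" "pt s 0 + t *\<^sub>R (NW - pt s 0) \<in> F" using nb_along[OF nb] by blast
  obtain p where p: "p \<in> F" "cr NW (pt s 0) SW * cr NW (pt s 0) p < 0" using nb_strict[OF nb] by blast
  have "s * (s - p$1 - s * p$2) < 0" using p(2) by (simp add: cr_def algebra_simps)
  then have "s - p$1 - s * p$2 < 0" using bounds(1) by (simp add: mult_less_0_iff)
  then have pos: "0 < (SE $ 1 - s - (- s) * SE $ 2) * (p$1 - s - (- s) * p$2)" using bounds by simp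
  show False
  proof (rule overlap[OF D in_D(2,5) ne(4) _ _ _ _ _ _ _ _ V(5) p(1) pos, of 0 y2 0 t])
    show "pt (s + - s * y2) y2 \<in> B" using V(6) unfolding a by (simp add: algebra_simps)
    show "pt (s + - s * 0) 0 \<in> B" using V(4) by simp
    show "pt (s + - s * t) t \<in> F" using t(3) unfolding pt_between by (simp add: algebra_simps)
    show "pt (s + - s * 0) 0 \<in> F" using nb_mem[OF nb] by simp
  qed (use t rng in auto)
qed

lemma top_left_edge:
  assumes "xT \<noteq> s * q"
  shows "xT = q \<and> x2 = 1 - y2 \<or> nb NW (pt xT (1 - q)) NE F"
proof -
  let ?nb = "nb NW (pt xT (1 - q)) NE"
  have "\<not> ?nb T" using nb_self V(11) by blast
  moreover have "\<not> ?nb C"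
  proof
    assume "?nb C"
    from nb_on2[OF this[unfolded Ce]] show False using assms strict by (auto simp: on2_def algebra_simps)
  qed
  moreover have "xT = q \<and> x2 = 1 - y2" if "?nb B"
  proof -
    have "xT = q" "q * (y2 - 1 + x2) = 0" using nb_on2[OF that[unfolded Be]] assms by (auto simp: on2_def algebra_simps)
    then show ?thesis using bounds by simp
  qed
  moreover have "\<not> ?nb R"
  proof
    assume a: "?nb R"
    then have "xT = q" using nb_on2[OF a[unfolded Re]] bounds by (auto simp: on2_def)
    then show False using in_R[OF nb_mem[OF a]] bounds by simp
  qed
  ultimately show ?thesis using neighbour[OF tri_forms(3)] bounds strict by auto
qed

lemma top_right_edge:
  "1 - xT = q * (1 - s) \<and> 1 - x2 = (1 - s) * (1 - y2) \<or> 1 - r \<le> xT \<or> nb NE (pt xT (1 - q)) NW F"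
proof -
  let ?nb = "nb NE (pt xT (1 - q)) NW"
  have "\<not> ?nb T" using nb_self V(10) by blast
  moreover have "\<not> ?nb C" using nb_self V(3) by blast
  moreover have "1 - xT = q * (1 - s) \<and> 1 - x2 = (1 - s) * (1 - y2)" if "?nb B"
  proof -
    have e: "1 - xT = q * (1 - s)" "(1 - xT) * (1 - y2) = q * (1 - x2)"
      using nb_on2[OF that[unfolded Be]] strict by (auto simp: on2_def algebra_simps)
    then have "q * ((1 - s) * (1 - y2) - (1 - x2)) = 0" by algebra
    then show ?thesis using e bounds by simp
  qed
  moreover have "1 - r \<le> xT" if "?nb R" using in_R[OF nb_mem[OF that]] .
  ultimately show ?thesis using neighbour[OF tri_forms(4)] bounds strict by auto
qed

text \<open>\<open>Y\<close> contains a piece of the segment from \<open>NE\<close> to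
  \<open>pt s 0\<close>, and the apex of \<open>B\<close> is not to the left of it. Hence
  \<open>R\<close> is confined by this segment at \<open>NE\<close> and by \<open>B\<close> at
  \<open>SE\<close>. Combining the two conditions gives \<open>r <= (1 - s) - (1 - s) * y2\<close>,
  at most 0.6361 - 0.3639 and so too small.\<close>

lemma squeeze:
  assumes Y: "Y \<in> D" "Y \<noteq> R" "NE \<in> Y" "pt (1 - k * (1 - s)) (1 - k) \<in> Y" and k: "0 < k"
    and x2: "1 - x2 \<le> (1 - s) * (1 - y2)"
  shows False
proof -
  have "\<not> (1 - s) * (1 - yR) < r"
  proof
    assume "(1 - s) * (1 - yR) < r"
    then have "0 < k * (r - (1 - s) * (1 - yR))" using k by simp
    moreover have "0 < k * (1 - s)" using k bounds by simp
    ultimately show False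
      using cone_disjoint[OF D Y(1) in_D(3) Y(2) Y(3,4) V(8,7,9), of "-1"] bounds by (simp add: algebra_simps)
  qed
  then have 1: "r \<le> (1 - s) * (1 - yR)" by simp
  have "\<not> 0 < r * y2 - (1 - x2) * yR"
  proof
    assume "0 < r * y2 - (1 - x2) * yR"
    moreover have "0 < yR * (1 - s)" "0 < y2 * (1 - s)" using strict rng bounds by simp_all
    ultimately show False
      using cone_disjoint[OF D in_D(3,2) ne(2)[symmetric] V(7,9,5,6,4), of 1] by (simp add: algebra_simps)
  qed
  then have "r * y2 \<le> (1 - x2) * yR" by simp
  also have "\<dots> \<le> (1 - s) * (1 - y2) * yR" using x2 strict by (intro mult_right_mono) auto
  finally have 2: "r * y2 \<le> (1 - s) * (1 - y2) * yR" .
  have "r * (1 - y2) \<le> (1 - s) * (1 - yR) * (1 - y2)" using 1 y2_less by (intro mult_right_mono) auto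
  with 2 have "r \<le> (1 - s) - (1 - s) * y2" by (simp add: algebra_simps)
  then show False using bounds by linarith
qed

text \<open>On the slanted line \<open>T\<close> occupies the heights from \<open>1 - q\<close> up
  and \<open>B\<close> those up to \<open>y2\<close>; by \<open>high\<close> the two stretches
  overlap.\<close>

lemma alpha_gamma: assumes a: "xT = s * q" "x2 = s * (1 - y2)" shows False
proof (rule overlap[OF D in_D(4,2) ne(3)[symmetric] _ _ _ _ _ _ _ _ V(11,5), of s "-s" "1 - q" 1 0 y2])
  show "pt (s + - s * (1 - q)) (1 - q) \<in> T" using V(12) unfolding a by (simp add: algebra_simps)
  show "pt (s + - s * 1) 1 \<in> T" using V(10) by simp
  show "pt (s + - s * y2) y2 \<in> B" using V(6) unfolding a by (simp add: algebra_simps)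
  show "pt (s + - s * 0) 0 \<in> B" using V(4) by simp
qed (use rng bounds high in auto)

text \<open>\<open>F\<close> also borders the edge from \<open>SE\<close> to the apex of
  \<open>B\<close>, so its vertices lie on that line or on the slanted line of \<open>C\<close>, and
  \<open>F\<close> stays below the antidiagonal from \<open>NW\<close> to \<open>SE\<close>. It
  borders the left edge of \<open>T\<close> at its apex, whence \<open>xT <= q\<close>; for the
  right edge only \<open>R\<close> remains, whence \<open>1 - r <= xT\<close>.\<close>

lemma beta_gamma: assumes b: "nb (pt s 0) NW SW F" and g: "x2 = s * (1 - y2)" shows False
proof -
  let ?nb = "nb SE (pt x2 y2) (pt s 0)"
  have pos: "0 < (1 - s) * (1 - y2)" "0 < (1 - s) * y2" using bounds y2_less rng by simp_all
  have sum: "x2 + y2 - 1 = - ((1 - s) * (1 - y2))" unfolding g by algebra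
  have "\<not> ?nb B" using nb_self V(4) by blast
  moreover have "\<not> ?nb C" using nb_self V(2) by blast
  moreover have "\<not> ?nb R"
  proof
    assume "?nb R"
    from in_R[OF nb_mem[OF this]] have "1 - r \<le> s * (1 - y2)" unfolding g .
    also have "\<dots> \<le> s * 1" using bounds rng by (intro mult_left_mono) auto
    finally show False using bounds by simp
  qed
  moreover have "\<not> ?nb T"
  proof
    assume "?nb T"
    from nb_on2[OF this[unfolded Te]] have "x2 + y2 - 1 = 0" using strict by (auto simp: on2_def algebra_simps)
    then show False using sum pos by linarith
  qed
  ultimately have nbF: "?nb F" using neighbour[OF tri_forms(6)] strict y2_less rng by auto
  obtain f1 f2 f3 where f: "F = tri f1 f2 f3" "cr f1 f2 f3 \<noteq> 0" using dissection_tri[OF D in_D(5)] by metis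
  have nsl: "\<not> sameline (pt s 0) NW SE (pt x2 y2)" using bounds by (simp add: sameline_def)
  have vert: "cr NW SE z \<le> 0" if z: "z \<in> {f1, f2, f3}" for z
  proof -
    have zs: "0 \<le> z$2" "z$2 \<le> 1" using dissection_subset[OF D in_D(5), of z] z f(1) tri_vertices by (auto simp: unit_square_iff)
    have "cr (pt s 0) NW z = 0 \<or> cr SE (pt x2 y2) z = 0"
      using two_lines_cover[OF f(2) nb_on2[OF b[unfolded f(1)]] nb_on2[OF nbF[unfolded f(1)]] _ _ nsl z] strict by simp
    then show ?thesis
    proof
      assume "cr (pt s 0) NW z = 0"
      then have "z$1 + z$2 - 1 = - ((1 - s) * (1 - z$2))" by (simp add: cr_def algebra_simps)
      moreover have "0 \<le> (1 - s) * (1 - z$2)" using zs bounds by simp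
      ultimately show ?thesis by (simp add: cr_def)
    next
      assume "cr SE (pt x2 y2) z = 0"
      then have "y2 * (z$1 + z$2 - 1) = z$2 * (x2 + y2 - 1)" by (simp add: cr_def algebra_simps)
      also have "\<dots> \<le> 0" unfolding sum using zs pos by (simp add: mult_nonneg_nonpos)
      finally have "z$1 + z$2 - 1 \<le> 0" using rng by (simp add: mult_le_0_iff)
      then show ?thesis by (simp add: cr_def)
    qed
  qed
  have F_le: "cr NW SE p \<le> 0" if "p \<in> F" for p
    using tri_cr_le[OF that[unfolded f(1)] vert vert vert] by simp
  have "x2 \<noteq> 1 - y2" using sum pos by linarith
  then have "nb NW (pt xT (1 - q)) NE F"
    using top_left_edge[OF beta_not_alpha[OF b]] \<open>x2 \<noteq> 1 - y2\<close> by blast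
  from F_le[OF nb_mem[OF this]] have "xT \<le> q" by simp
  moreover have "1 - r \<le> xT"
  proof -
    have "\<not> nb NE (pt xT (1 - q)) NW F" using nb_self nb_mem[OF b] by blast
    moreover have "1 - x2 \<noteq> (1 - s) * (1 - y2)"
    proof
      assume "1 - x2 = (1 - s) * (1 - y2)"
      then have "y2 = 0" unfolding g by (simp add: algebra_simps)
      then show False using rng by simp
    qed
    ultimately show ?thesis using top_right_edge by blast
  qed
  ultimately show False using bounds by simp
qed

lemma bottom_left_edge:
  assumes "x2 \<noteq> s * (1 - y2)"
  shows "x2 - s = y2 * (1 - s) \<and> xT - s = (1 - s) * (1 - q) \<or> nb (pt s 0) (pt x2 y2) SE F"
proof -
  let ?nb = "nb (pt s 0) (pt x2 y2) SE"
  have "\<not> ?nb B" using nb_self V(5) by blast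
  moreover have "\<not> ?nb R" using nb_self V(7) by blast
  moreover have "\<not> ?nb C"
  proof
    assume "?nb C"
    from nb_on2[OF this[unfolded Ce]] show False using assms bounds rng by (auto simp: on2_def algebra_simps)
  qed
  moreover have "x2 - s = y2 * (1 - s) \<and> xT - s = (1 - s) * (1 - q)" if "?nb T"
  proof -
    have e: "x2 - s = y2 * (1 - s)" "(x2 - s) * (1 - q) = y2 * (xT - s)"
      using nb_on2[OF that[unfolded Te]] assms by (auto simp: on2_def algebra_simps)
    then have "y2 * ((1 - s) * (1 - q) - (xT - s)) = 0" by algebra
    then show ?thesis using e(1) rng by simp
  qed
  ultimately show ?thesis using neighbour[OF tri_forms(5)] strict y2_less rng bounds by auto
qed

text \<open>If \<open>T\<close> borders the left edge of \<open>B\<close>, \<open>squeeze\<close>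
  applies. Otherwise \<open>F\<close> does, and either \<open>xT = q\<close>, which fails
  numerically, or \<open>F\<close> also borders the left edge of \<open>T\<close>. Then
  \<open>F\<close> contains both apexes and must be beyond both left edges, which
  \<open>high\<close> makes incompatible.\<close>

lemma beta_delta:
  assumes b: "nb (pt s 0) NW SW F" and d: "nb NW (pt s 0) SW F" shows False
proof -
  note na = beta_not_alpha[OF b] and ng = delta_not_gamma[OF d]
  have KF: "NW \<in> F" using nb_mem[OF b] .
  from bottom_left_edge[OF ng] show False
  proof
    assume e: "x2 - s = y2 * (1 - s) \<and> xT - s = (1 - s) * (1 - q)"
    then have "xT = 1 - q * (1 - s)" by (simp add: algebra_simps)
    then have "pt (1 - q * (1 - s)) (1 - q) \<in> T" using V(12) by simp
    moreover have "1 - x2 = (1 - s) * (1 - y2)" using e by (simp add: algebra_simps)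
    ultimately show False using squeeze[OF in_D(4) ne(6)[symmetric] V(11), of q] bounds by simp
  next
    assume nbF: "nb (pt s 0) (pt x2 y2) SE F"
    have Fright: "0 \<le> (x2 - s) * p$2 - y2 * (p$1 - s)" if "p \<in> F" for p
    proof -
      have "- (y2 * (1 - s)) * ((x2 - s) * p$2 - y2 * (p$1 - s)) \<le> 0"
        using nb_side[OF nbF that] by (simp add: cr_def)
      then show ?thesis by (rule nonneg_of_neg_mult[rotated]) (use rng bounds in simp)
    qed
    have FEK: "0 \<le> p$1 - s * (1 - p$2)" if "p \<in> F" for p
    proof -
      have "- s * (p$1 - s * (1 - p$2)) \<le> 0" using nb_side[OF b that] by (simp add: cr_def algebra_simps)
      then show ?thesis by (rule nonneg_of_neg_mult[rotated]) (use bounds in simp)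
    qed
    have "\<not> nb NE (pt xT (1 - q)) NW F" using nb_self KF by blast
    then have rT: "1 - xT = q * (1 - s) \<or> 1 - r \<le> xT" using top_right_edge by blast
    from top_left_edge[OF na] show False
    proof
      assume "xT = q \<and> x2 = 1 - y2"
      then have "1 - q = q * (1 - s)" using rT bounds by auto
      then have "q * (2 - s) = 1" by (simp add: algebra_simps)
      moreover have "q * (2 - s) \<le> 4361/10000 * (16361/10000)" using bounds by (intro mult_mono) auto
      ultimately show False by simp
    next
      assume nbT: "nb NW (pt xT (1 - q)) NE F"
      have "- q * (xT * (1 - y2) - q * x2) \<le> 0" using nb_side[OF nbT nb_mem[OF nbF]] by (simp add: algebra_simps)
      then have "0 \<le> xT * (1 - y2) - q * x2" by (rule nonneg_of_neg_mult[rotated]) (use bounds in simp)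
      then have 1: "q * x2 - xT * (1 - y2) \<le> 0" by simp
      have 2: "0 \<le> y2 * s - (s - x2) * (1 - q) - y2 * xT" using Fright[OF nb_mem[OF nbT]] by (simp add: algebra_simps)
      have 3: "s * (1 - y2) < x2" using FEK[OF nb_mem[OF nbF]] ng by simp
      have 4: "s * q < xT" using FEK[OF nb_mem[OF nbT]] na by (simp add: algebra_simps)
      have "q * (s - x2) < q * (s * y2)" using 3 bounds by (intro mult_strict_left_mono) (auto simp: algebra_simps)
      moreover have "y2 * (s * q) < y2 * xT" using 4 rng by (intro mult_strict_left_mono) auto
      ultimately have "0 < y2 * xT - q * (s - x2)" by (simp add: algebra_simps)
      \<comment> \<open>The identity below combines the side conditions 1 and 2 with weights
        \<open>y2\<close> and \<open>- q\<close>, so its value is nonpositive. The left-hand side is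
        positive: its first factor because both apexes lie strictly to the right of the slanted
        line, its second by \<open>high\<close>.\<close>
      then have "0 < (y2 * xT - q * (s - x2)) * (y2 - 1 + q)" using high by simp
      moreover have "(y2 * xT - q * (s - x2)) * (y2 - 1 + q) =
        y2 * (q * x2 - xT * (1 - y2)) - q * (y2 * s - (s - x2) * (1 - q) - y2 * xT)" by algebra
      moreover have "y2 * (q * x2 - xT * (1 - y2)) \<le> 0" using 1 rng by (simp add: mult_nonneg_nonpos)
      moreover have "0 \<le> q * (y2 * s - (s - x2) * (1 - q) - y2 * xT)" using 2 bounds by simp
      ultimately show False by linarith
    qed
  qed
qed

lemma area_sum: "s + (1 - s) * y2 + r + q \<le> 16361/10000"
proof -
  have "area2 C + (area2 B + (area2 R + (area2 T + area2 F))) = 2"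
    using near_sum[OF nD] ne unfolding DD by (simp add: ne[symmetric])
  then show ?thesis using near_bounds(1)[OF nD in_D(5)] unfolding Ba unfolding C_area Ra Ta by linarith
qed

text \<open>\<open>F\<close> borders the right edge of \<open>T\<close> and the left edge of
  \<open>B\<close>. At \<open>NE\<close> the upper edge of \<open>R\<close> can then border only
  \<open>T\<close>, which puts the apex of \<open>R\<close> on the line of the right edge of
  \<open>T\<close> (\<open>PR\<close>). The lower edge of \<open>R\<close> cannot border
  \<open>F\<close>, which would need four edges, so it borders \<open>B\<close> and
  \<open>yR <= y2\<close>. The areas do not permit both.\<close>

lemma alpha_delta: assumes a: "xT = s * q" and d: "nb NW (pt s 0) SW F" shows False
proof -
  note ng = delta_not_gamma[OF d]
  have EF: "pt s 0 \<in> F" using nb_mem[OF d] .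
  have sq: "0 < s * q" "s * q < q" using bounds mult_strict_right_mono[of s 1 q] by auto
  have nbT: "nb NE (pt xT (1 - q)) NW F"
  proof -
    have "1 - xT \<noteq> q * (1 - s)" using bounds unfolding a by (simp add: algebra_simps)
    moreover have "\<not> 1 - r \<le> xT" using bounds sq unfolding a by linarith
    ultimately show ?thesis using top_right_edge by blast
  qed
  have nbB: "nb (pt s 0) (pt x2 y2) SE F"
  proof -
    have "xT - s \<noteq> (1 - s) * (1 - q)" using bounds unfolding a by (simp add: algebra_simps)
    then show ?thesis using bottom_left_edge[OF ng] by blast
  qed
  let ?nb = "nb (pt (1 - r) yR) NE SE"
  have "\<not> ?nb R" using nb_self V(7) by blast
  moreover have "\<not> ?nb C" using in_C[OF nb_mem] bounds by fastforce
  moreover have "\<not> ?nb B" using nb_self V(5) by blast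
  moreover have "\<not> ?nb F"
  proof
    assume "?nb F"
    then have N: "NE \<in> F" by (rule nb_mem)
    have "- (y2 * (1 - s)) * ((x2 - s) - y2 * (1 - s)) \<le> 0" using nb_side[OF nbB N] by simp
    then have "0 \<le> (x2 - s) - y2 * (1 - s)" by (rule nonneg_of_neg_mult[rotated]) (use rng bounds in simp)
    then have "1 - x2 \<le> (1 - s) * (1 - y2)" by (simp add: algebra_simps)
    then show False using squeeze[OF in_D(5) ne(7)[symmetric] N, of 1] EF by simp
  qed
  ultimately have "?nb T" using neighbour[OF tri_forms(8)] strict bounds by auto
  from nb_on2[OF this[unfolded Te]] have PR: "(1 - yR) * (1 - s * q) = r * q"
    using strict unfolding a by (auto simp: on2_def algebra_simps)
  let ?nb = "nb SE (pt (1 - r) yR) NE"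
  have "\<not> ?nb R" using nb_self V(8) by blast
  moreover have "\<not> ?nb T" using nb_self V(11) by blast
  moreover have "\<not> ?nb C"
  proof
    assume "?nb C"
    from nb_on2[OF this[unfolded Ce]] show False using strict bounds by (auto simp: on2_def)
  qed
  moreover have "\<not> ?nb F"
  proof
    assume nbR: "?nb F"
    obtain f1 f2 f3 where f: "F = tri f1 f2 f3" "cr f1 f2 f3 \<noteq> 0" using dissection_tri[OF D in_D(5)] by metis
    have "NW \<noteq> pt s 0" "NE \<noteq> pt xT (1 - q)" "pt s 0 \<noteq> pt x2 y2" "SE \<noteq> pt (1 - r) yR"
      using bounds rng strict by auto
    from four_lines[OF f(2) nb_on2[OF d[unfolded f(1)]] nb_on2[OF nbT[unfolded f(1)]] nb_on2[OF nbB[unfolded f(1)]]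
      nb_on2[OF nbR[unfolded f(1)]] this]
    show False using bounds rng strict ng unfolding sameline_def a by (auto simp: algebra_simps)
  qed
  ultimately have "?nb B" using neighbour[OF tri_forms(7)] strict bounds by auto
  from in_B[OF nb_mem[OF this]] have yy: "yR \<le> y2" .
  \<comment> \<open>The joint doubled area of \<open>C\<close> and \<open>B\<close>. With
    \<open>PR\<close> and \<open>yR <= y2\<close> it bounds \<open>(1 - e) * (1 - s * q)\<close> by
    \<open>(1 - s) * r * q\<close>, and \<open>4 * r * q <= (r + q)^2\<close> leaves an inequality
    in \<open>e\<close> alone.\<close>
  define e where "e = s + (1 - s) * y2"
  have e: "7278/10000 \<le> e" "e \<le> 8722/10000" "1 - e = (1 - s) * (1 - y2)" "r + q \<le> 16361/10000 - e"
    using bounds area_sum unfolding e_def by (linarith, linarith, algebra, linarith)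
  have sq': "s * q \<le> 1902/10000" using mult_mono[OF bounds(2) bounds(6)] bounds by simp
  have "(1 - e) * (8098/10000) \<le> (1 - e) * (1 - s * q)" using sq' e by (intro mult_left_mono) auto
  also have "\<dots> = (1 - s) * ((1 - y2) * (1 - s * q))" unfolding e(3) by algebra
  also have "\<dots> \<le> (1 - s) * ((1 - yR) * (1 - s * q))"
    using yy bounds sq' by (intro mult_left_mono mult_right_mono) auto
  also have "\<dots> = (1 - s) * (r * q)" unfolding PR ..
  also have "\<dots> \<le> 6361/10000 * (r * q)" using bounds by (intro mult_right_mono) auto
  finally have "4 * ((1 - e) * (8098/10000)) \<le> 6361/10000 * (4 * (r * q))" by linarith
  also have "\<dots> \<le> 6361/10000 * (16361/10000 - e)^2"
  proof -
    have "4 * (r * q) = (r + q)^2 - (r - q)^2" by algebra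
    also have "\<dots> \<le> (r + q)^2" by simp
    also have "\<dots> \<le> (16361/10000 - e)^2" using e bounds by (intro power_mono) auto
    finally show ?thesis by linarith
  qed
  finally have "4 * ((1 - e) * (8098/10000)) \<le> 6361/10000 * (16361/10000 - e)^2" .
  moreover have "6361/10000 * (16361/10000 - e)^2 \<le> 637/1000 * (2677/1000 - 3272/1000 * e + e * e)"
  proof -
    have le: "(16361/10000 - e)^2 \<le> 2677/1000 - 3272/1000 * e + e * e"
      using e(1) by (simp add: power2_eq_square algebra_simps)
    have "6361/10000 * (16361/10000 - e)^2 \<le> 6361/10000 * (2677/1000 - 3272/1000 * e + e * e)" using le by simp
    also have "\<dots> \<le> 637/1000 * (2677/1000 - 3272/1000 * e + e * e)"
      using order_trans[OF zero_le_power2 le] by (intro mult_right_mono) simp_all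
    finally show ?thesis .
  qed
  \<comment> \<open>On the interval known for \<open>e\<close> the square lies below its chord, so
    the remaining inequality becomes linear.\<close>
  moreover have "0 \<le> (e - 7278/10000) * (8722/10000 - e)" using e by simp
  then have "e * e \<le> 16/10 * e - 6347/10000" by (simp add: algebra_simps)
  ultimately show False using e(2) by (simp add: algebra_simps)
qed

lemma contradiction: False
  using alpha_or_beta gamma_or_delta alpha_gamma alpha_delta beta_gamma beta_delta by blast

end

text \<open>If \<open>y2 <= 1 - q\<close>, the triangles \<open>C\<close>, \<open>T\<close>,
  \<open>B\<close> form the triple for \<open>near_key\<close>: the base of \<open>B\<close> is
  \<open>1 - area2 C\<close>, and its height is at most \<open>1 - area2 T\<close>.\<close>

lemma one_split_left_corner:
  assumes nD: "near D" and DD: "D = {C, B, R, T, F}" and dist: "distinct [C, B, R, T, F]"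
    and Ce: "C = tri SW (pt s 0) NW" and Be: "B = tri (pt s 0) SE (pt x2 y2)"
    and Re: "R = tri SE NE (pt (1 - r) yR)" and Te: "T = tri NW NE (pt xT (1 - q))"
    and ar: "s = area2 C" "(1 - s) * y2 = area2 B" "r = area2 R" "q = area2 T"
    and rng: "0 \<le> x2" "x2 \<le> 1" "0 < y2" "0 \<le> yR" "yR \<le> 1" "0 \<le> xT" "xT \<le> 1"
  shows "optimal D"
proof (cases "1 - q < y2")
  case True
  have "corner_split D C B R T F s x2 y2 r yR xT q"
    by (rule corner_split.intro[OF nD DD dist Ce Be Re Te ar rng True])
  then show ?thesis using corner_split.contradiction by blast
next
  case False
  have X: "C \<in> D" "T \<in> D" "B \<in> D" using DD by simp_all
  have "(1 - area2 C) * y2 \<le> (1 - area2 C) * (1 - area2 T)"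
    using False near_bounds(2)[OF nD X(1)] unfolding ar by (intro mult_left_mono) auto
  then have "area2 B \<le> (1 - area2 C) * (1 - area2 T)" using ar(1,2) by simp
  moreover have "C \<noteq> T" "T \<noteq> B" "C \<noteq> B" using dist by auto
  ultimately show ?thesis using near_key[OF nD X] by blast
qed

section \<open>Two divided sides\<close>

lemma tri_apex:
  assumes "cr u v w \<noteq> 0" "p \<in> tri u v w" "k * cr u v w \<le> k * cr u v p" "0 < k * cr u v w"
  shows "p = w"
proof -
  obtain \<alpha> \<beta> \<gamma> where c: "0 \<le> \<alpha>" "0 \<le> \<beta>" "0 \<le> \<gamma>" "\<alpha> + \<beta> + \<gamma> = 1"
    "p = \<alpha> *\<^sub>R u + \<beta> *\<^sub>R v + \<gamma> *\<^sub>R w" using assms(2) unfolding tri_mem by blast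
  have "cr u v p = \<gamma> * cr u v w" unfolding c(5) cr_affine[OF c(4)] by simp
  then have "1 * (k * cr u v w) \<le> \<gamma> * (k * cr u v w)" using assms(3) by (simp add: algebra_simps)
  then have "1 \<le> \<gamma>" using assms(4) by (simp only: mult_le_cancel_right)
  then have "\<alpha> = 0" "\<beta> = 0" "\<gamma> = 1" using c by linarith+
  then show ?thesis unfolding c(5) by simp
qed

text \<open>\<open>C\<close> is a right triangle with the whole left side as a leg. The only
  remaining coincidence among the triangles on the sides is \<open>R = T2\<close>. The stretches of
  \<open>T1\<close> and \<open>B\<close> on the slanted line of \<open>C\<close> would overlap
  because both heights exceed 1/2.\<close>

lemma opposite_split_left_corner:
  assumes nD: "near D" and b: "split_side pt D s C x1 y1 B x2 y2"
    and t: "split_side top_side D t T1 x3 h3 T2 x4 h4"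
    and l: "full_side left_side D C yL l" and r: "full_side right_side D R yR r"
  shows False
proof -
  note D = near_dissection[OF nD]
  note S = split_sideD[OF b nD] and U = split_sideD[OF t nD] and L = full_sideD[OF l nD] and R = full_sideD[OF r nD]
  have C1: "C = tri SW (pt s 0) (pt x1 y1)" using S(4) by simp
  have Be: "B = tri (pt s 0) SE (pt x2 y2)" using S(5) by simp
  have T1e: "T1 = tri NW (pt t 1) (pt x3 (1 - h3))" using U(4) by simp
  have T2e: "T2 = tri (pt t 1) NE (pt x4 (1 - h4))" using U(5) by simp
  have Re: "R = tri SE NE (pt (1 - r) yR)" using R(2) by simp
  have "NW \<in> C" using L(2) by simp
  then have "NW = pt x1 y1"
    using tri_apex[of "SW" "pt s 0" "pt x1 y1" "NW" 1] S(6,14,15) unfolding C1 by simp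
  then have Ce: "C = tri SW (pt s 0) NW" and y1: "y1 = 1" using C1 by simp_all
  have s: "3639/10000 \<le> s" "s \<le> 4361/10000" using S(6,12) near_bounds(2)[OF nD S(1)] unfolding y1 by simp_all
  have h: "572/1000 \<le> y2" "y2 \<le> 1" "572/1000 \<le> h3" "h3 \<le> 1" "572/1000 \<le> h4" "h4 \<le> 1" using S(16,17) U(14-17) .
  have tb: "3639/10000 \<le> t" "t \<le> 6361/10000" using U(6,7) .
  have ar: "(1 - s) * y2 \<le> 4361/10000" "t * h3 \<le> 4361/10000" "(1 - t) * h4 \<le> 4361/10000"
    unfolding S(13) U(12,13) using near_bounds(2)[OF nD] S(2) U(1,2) by blast+
  note rb = R(6,7)
  have y2: "y2 < 774/1000" using height_bound[of "1 - s" y2] s h ar by simp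
  have in_C: "x \<le> s * (1 - y)" if "pt x y \<in> C" for x y
    using tri_cr_le[OF that[unfolded Ce], of "NW" "pt s 0" 0] s by (simp add: algebra_simps)
  have in_B: "y \<le> y2" if "pt x y \<in> B" for x y using pt_tri_mem(3)[OF that[unfolded Be], of y2] h by simp
  have in_R: "1 - r \<le> x" if "pt x y \<in> R" for x y using pt_tri_mem(2)[OF that[unfolded Re], of "1 - r"] rb by simp
  have in_T1: "1 - h3 \<le> y" if "pt x y \<in> T1" for x y using pt_tri_mem(4)[OF that[unfolded T1e], of "1 - h3"] h by simp
  have in_T2: "1 - h4 \<le> y" if "pt x y \<in> T2" for x y using pt_tri_mem(4)[OF that[unfolded T2e], of "1 - h4"] h by simp
  have V: "SW \<in> C" "pt s 0 \<in> C" "NW \<in> C" "pt s 0 \<in> B" "SE \<in> B" "pt x2 y2 \<in> B"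
    "NW \<in> T1" "pt t 1 \<in> T1" "pt x3 (1 - h3) \<in> T1" "pt t 1 \<in> T2" "NE \<in> T2" "pt x4 (1 - h4) \<in> T2"
    "SE \<in> R" "NE \<in> R" unfolding Ce Be T1e T2e Re by simp_all
  have nm: "pt t 1 \<notin> C" "NE \<notin> C" "NW \<notin> B" "NE \<notin> B" "NW \<notin> R" "pt s 0 \<notin> R" "pt t 1 \<notin> B" "SE \<notin> C"
    using in_C[of t 1] in_C[of 1 1] in_B[of 0 1] in_B[of 1 1] in_R[of 0 1] in_R[of s 0] in_B[of t 1] in_C[of 1 0] tb y2 rb s by auto
  have n1: "C \<noteq> T1" using V(8) nm(1) by blast
  have n2: "C \<noteq> T2" using V(10) nm(1) by blast
  have n3: "C \<noteq> R" using V(14) nm(2) by blast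
  have n4: "B \<noteq> T1" using V(7) nm(3) by blast
  have n5: "B \<noteq> T2" using V(11) nm(4) by blast
  have n6: "B \<noteq> R" using V(14) nm(4) by blast
  have n7: "T1 \<noteq> R" using V(7) nm(5) by blast
  note inD = S(1,2) U(1,2) R(1)
  have forms: "tri (pt s 0) NW SW \<in> D" "tri NW (pt s 0) SW \<in> D"
    using inD(1) unfolding Ce tri_def by (simp_all add: insert_commute)
  have K_T2: "\<not> nb (pt s 0) NW SW T2"
    using nb_on2[of "pt s 0" "NW" "SW" "pt t 1" "NE" "pt x4 (1 - h4)"] tb unfolding T2e on2_def by auto
  have K_T1: "x3 = s * h3" if "nb (pt s 0) NW SW T1"
    using nb_on2[OF that[unfolded T1e]] tb by (auto simp: on2_def algebra_simps)
  have E_B: "x2 = s * (1 - y2)" if "nb NW (pt s 0) SW B"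
    using nb_on2[OF that[unfolded Be]] s by (auto simp: on2_def algebra_simps)
  have E_T1: "h3 = 1" if "nb NW (pt s 0) SW T1" using in_T1[OF nb_mem[OF that]] h by simp
  have both: False if "x3 = s * h3" "x2 = s * (1 - y2)"
  proof (rule overlap[OF D inD(3,2) n4[symmetric] _ _ _ _ _ _ _ _ V(8,5), of s "-s" "1 - h3" 1 0 y2])
    show "pt (s + - s * (1 - h3)) (1 - h3) \<in> T1" using V(9) unfolding that by (simp add: algebra_simps)
    show "pt (s + - s * 1) 1 \<in> T1" using V(7) by simp
    show "pt (s + - s * y2) y2 \<in> B" using V(6) unfolding that by (simp add: algebra_simps)
    show "pt (s + - s * 0) 0 \<in> B" using V(4) by simp
  qed (use h s tb in auto)
  show False
  proof (cases "R = T2")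
    case False
    \<comment> \<open>All five triangles are now known. \<open>T1\<close> has to border the slanted
      edge of \<open>C\<close> at both ends, hence reaches down to \<open>pt s 0\<close>; then
      \<open>T2\<close> and \<open>B\<close> border the other long edge of \<open>T1\<close> from
      the same side and overlap.\<close>
    have dist: "distinct [C, B, T1, T2, R]" using S(3) U(3) n1 n2 n3 n4 n5 n6 n7 False by simp
    have DD: "D = {C, B, T1, T2, R}" by (rule five_eq[OF nD inD dist])
    have nbr: "nb u v w C \<or> nb u v w B \<or> nb u v w T1 \<or> nb u v w T2 \<or> nb u v w R"
      if "tri u v w \<in> D" "0 < u$1 + v$1" "u$1 + v$1 < 2" "0 < u$2 + v$2" "u$2 + v$2 < 2" for u v w
      using nb_ex[OF D that] unfolding DD by blast
    have "x3 = s * h3" using nbr[OF forms(1)] nb_self[OF _ V(1)] nb_mem nm(3,5) K_T1 K_T2 s by auto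
    note x3 = this
    have "nb NW (pt s 0) SW B \<or> nb NW (pt s 0) SW T1"
    proof -
      have "\<not> nb NW (pt s 0) SW T2"
        using nb_on2[of "NW" "pt s 0" "SW" "pt t 1" "NE" "pt x4 (1 - h4)"] tb unfolding T2e on2_def by auto
      then show ?thesis using nbr[OF forms(2)] nb_self[OF _ V(1)] nb_mem nm(6) s by auto
    qed
    then have h3: "h3 = 1" using E_B E_T1 both[OF x3] by blast
    then have x3': "x3 = s" and t1: "t \<le> 4361/10000" using x3 ar(2) by simp_all
    have T1f: "T1 = tri NW (pt t 1) (pt s 0)" using T1e unfolding h3 x3' by simp
    have forms': "tri (pt s 0) (pt t 1) NW \<in> D" "tri (pt t 1) (pt s 0) NW \<in> D"
      using inD(3) unfolding T1f tri_def by (simp_all add: insert_commute)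
    have nR: "pt t 1 \<notin> R" using in_R[of t 1] rb t1 by auto
    have nT2: "pt s 0 \<notin> T2"
    proof
      assume "pt s 0 \<in> T2"
      then have "h4 = 1" using in_T2[of s 0] h by simp
      then show False using ar(3) t1 by simp
    qed
    have "nb (pt s 0) (pt t 1) NW T2"
      using nbr[OF forms'(1)] nb_self[OF _ V(3)] nb_self[OF _ V(7)] nb_mem nm(7) nR s tb by auto
    from nb_on2[OF this[unfolded T2e]] have x4: "x4 = s + (t - s) * (1 - h4)"
      using tb s by (auto simp: on2_def algebra_simps)
    have "nb (pt t 1) (pt s 0) NW B"
      using nbr[OF forms'(2)] nb_self[OF _ V(3)] nb_self[OF _ V(7)] nb_mem nm(6) nT2 s tb by auto
    from nb_on2[OF this[unfolded Be]] have x2: "x2 = s + (t - s) * y2"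
      using tb s by (auto simp: on2_def algebra_simps)
    show False
    proof (rule overlap[OF D inD(2,4) n5 _ _ _ _ _ _ _ _ V(5,11), of s "t - s" 0 y2 "1 - h4" 1])
      show "pt (s + (t - s) * y2) y2 \<in> B" using V(6) unfolding x2 .
      show "pt (s + (t - s) * 0) 0 \<in> B" using V(4) by simp
      show "pt (s + (t - s) * (1 - h4)) (1 - h4) \<in> T2" using V(12) unfolding x4 .
      show "pt (s + (t - s) * 1) 1 \<in> T2" using V(10) by simp
    qed (use h s tb in auto)
  next
    case True
    \<comment> \<open>\<open>T2\<close> fills the corner at \<open>NE\<close>, so there are two
      slanted edges and one free triangle \<open>F\<close>. On each of them the two triangles
      standing on the horizontal sides would overlap, so \<open>F\<close> has an edge on both
      lines.\<close>
    have G: "SE \<in> T2" using V(13) True by simp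
    have h4: "h4 = 1" using in_T2[OF G] h by simp
    have "SE = pt x4 (1 - h4)"
      using tri_apex[of "pt t 1" "NE" "pt x4 (1 - h4)" "SE" "-1"] G tb unfolding T2e h4 by simp
    then have T2f: "T2 = tri (pt t 1) NE SE" using T2e by simp
    have t5: "5639/10000 \<le> t" using ar(3) h4 by simp
    have h3: "h3 < 774/1000" using height_bound[of t h3] t5 h ar by simp
    obtain F where F: "F \<in> D" "distinct [C, B, T1, T2, F]" "D = {C, B, T1, T2, F}"
      using fifth_ex[OF nD inD(1-4)] S(3) U(3) n1 n2 n4 n5 by (metis distinct_length_2_or_more distinct_singleton)
    have nbr: "nb u v w C \<or> nb u v w B \<or> nb u v w T1 \<or> nb u v w T2 \<or> nb u v w F"
      if "tri u v w \<in> D" "0 < u$1 + v$1" "u$1 + v$1 < 2" "0 < u$2 + v$2" "u$2 + v$2 < 2" for u v w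
      using nb_ex[OF D that] unfolding F(3) by blast
    have nT2: "\<not> nb NW (pt s 0) SW T2"
      using nb_on2[of "NW" "pt s 0" "SW" "pt t 1" "NE" "pt x4 (1 - h4)"] tb unfolding T2e on2_def by auto
    have EK: "nb (pt s 0) NW SW F \<or> nb NW (pt s 0) SW F"
      using nbr[OF forms(1)] nbr[OF forms(2)] nb_self[OF _ V(1)] nb_mem nm(3) K_T1 K_T2 nT2 E_B E_T1 both h3 s by auto
    have forms': "tri (pt t 1) SE NE \<in> D" "tri SE (pt t 1) NE \<in> D"
      using inD(4) unfolding T2f tri_def by (simp_all add: insert_commute)
    have GB: "x2 = 1 + (t - 1) * y2" if "nb (pt t 1) SE NE B"
      using nb_on2[OF that[unfolded Be]] s by (auto simp: on2_def algebra_simps)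
    have HT: "x3 = 1 + (t - 1) * (1 - h3)" if "nb SE (pt t 1) NE T1"
      using nb_on2[OF that[unfolded T1e]] tb by (auto simp: on2_def algebra_simps)
    have both': False if x: "x2 = 1 + (t - 1) * y2" "x3 = 1 + (t - 1) * (1 - h3)"
    proof (rule overlap[OF D inD(2,3) n4 _ _ _ _ _ _ _ _ V(4,7), of 1 "t - 1" 0 y2 "1 - h3" 1])
      show "pt (1 + (t - 1) * y2) y2 \<in> B" using V(6) unfolding x .
      show "pt (1 + (t - 1) * 0) 0 \<in> B" using V(5) by simp
      show "pt (1 + (t - 1) * (1 - h3)) (1 - h3) \<in> T1" using V(9) unfolding x .
      show "pt (1 + (t - 1) * 1) 1 \<in> T1" using V(8) by simp
      show "0 < (pt s 0 $ 1 - 1 - (t - 1) * pt s 0 $ 2) * (NW $ 1 - 1 - (t - 1) * NW $ 2)"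
        using s tb mult_neg_pos[of "s - 1" t] by (simp add: algebra_simps)
    qed (use h s tb in auto)
    have "SE \<notin> T1" using in_T1[of 1 0] h3 by auto
    then have GH: "nb (pt t 1) SE NE F \<or> nb SE (pt t 1) NE F"
      using nbr[OF forms'(1)] nbr[OF forms'(2)] nb_self[OF _ V(11)] nb_mem nm(1,7,8) GB HT both' tb by auto
    obtain f1 f2 f3 where f: "F = tri f1 f2 f3" using dissection_tri[OF D F(1)] by metis
    define P where "P z \<longleftrightarrow> z$1 = s * (1 - z$2)" for z :: "real^2"
    define Q where "Q z \<longleftrightarrow> z$1 = 1 - (1 - t) * z$2" for z :: "real^2"
    have "P f1 \<and> P f2 \<or> P f2 \<and> P f3 \<or> P f3 \<and> P f1"
    proof -
      have "cr (pt s 0) NW z = 0 \<longleftrightarrow> P z" "cr NW (pt s 0) z = 0 \<longleftrightarrow> P z" for z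
        unfolding P_def by (auto simp: cr_def algebra_simps)
      then show ?thesis using EK nb_on2 unfolding f on2_def by metis
    qed
    moreover have "Q f1 \<and> Q f2 \<or> Q f2 \<and> Q f3 \<or> Q f3 \<and> Q f1"
    proof -
      have "cr (pt t 1) SE z = 0 \<longleftrightarrow> Q z" "cr SE (pt t 1) z = 0 \<longleftrightarrow> Q z" for z
        unfolding Q_def by (auto simp: cr_def algebra_simps)
      then show ?thesis using GH nb_on2 unfolding f on2_def by metis
    qed
    \<comment> \<open>Two edges of \<open>F\<close> share a vertex, but within the height of the
      square the two lines do not meet: one stays at or left of \<open>s\<close>, the other at or
      right of \<open>t\<close>, and \<open>s < t\<close>.\<close>
    ultimately obtain z where z: "z \<in> F" "P z" "Q z" using f tri_vertices by metis
    have zs: "0 \<le> z$2" "z$2 \<le> 1" using dissection_subset[OF D F(1) z(1)] by (auto simp: unit_square_iff)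
    have "s * (1 - z$2) \<le> s * 1" using s zs by (intro mult_left_mono) auto
    then have "z$1 \<le> s" using z(2) unfolding P_def by simp
    moreover have "(1 - t) * z$2 \<le> (1 - t) * 1" using tb zs by (intro mult_left_mono) auto
    then have "t \<le> z$1" using z(3) unfolding Q_def by simp
    ultimately show False using s t5 by simp
  qed
qed

lemma right_touch:
  assumes "pt 1 v \<in> tri (pt a 0) SE (pt x y)" "a < 1" "x \<le> 1" "0 < v" shows "x = 1 \<and> v \<le> y"
proof -
  obtain \<alpha> \<beta> \<gamma> where c: "0 \<le> \<alpha>" "0 \<le> \<beta>" "0 \<le> \<gamma>" "\<alpha> + \<beta> + \<gamma> = 1"
    "pt 1 v = \<alpha> *\<^sub>R pt a 0 + \<beta> *\<^sub>R SE + \<gamma> *\<^sub>R pt x y" using assms(1) unfolding tri_mem by blast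
  then have e: "1 = \<alpha> * a + \<beta> + \<gamma> * x" "v = \<gamma> * y" by (simp_all add: vec2_eq_iff)
  have "\<alpha> * (1 - a) + \<gamma> * (1 - x) = 0" using e(1) c(4) by (simp add: algebra_simps)
  moreover have "0 \<le> \<alpha> * (1 - a)" "0 \<le> \<gamma> * (1 - x)" using assms c by simp_all
  ultimately have "\<gamma> * (1 - x) = 0" by linarith
  moreover have "\<gamma> \<noteq> 0" using e(2) assms by auto
  ultimately have "x = 1" by simp
  moreover have "0 < y" using e(2) assms(4) c(3) zero_less_mult_iff[of \<gamma> y] by auto
  then have "\<gamma> * y \<le> 1 * y" using c by (intro mult_right_mono) auto
  ultimately show ?thesis using e(2) by simp
qed

lemma right_edge_mem:
  assumes "pt 1 v \<in> tri (pt 1 a) (pt 1 b) (pt x y)" "a < b" "x < 1" shows "a \<le> v" "v \<le> b"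
proof -
  obtain s where s: "0 \<le> s" "s \<le> 1" "pt 1 v = pt 1 a + s *\<^sub>R (pt 1 b - pt 1 a)"
    by (rule tri_edge_mem[OF assms(1)]) (use assms in \<open>auto simp: cr_sides\<close>)
  then have "v = a + s * (b - a)" by (simp add: pt_between)
  moreover have "s * (b - a) \<le> 1 * (b - a)" "0 \<le> s * (b - a)" using s assms by (intro mult_right_mono, auto)
  ultimately show "a \<le> v" "v \<le> b" by simp_all
qed

text \<open>\<open>Z\<close> is a right triangle at \<open>SE\<close> with legs \<open>1 - s\<close>
  and \<open>y2 <= t\<close>. Heights are at most 1, so \<open>area2 B1 <= s\<close> and
  \<open>area2 R2 <= 1 - t\<close>: this is a triple for \<open>near_key\<close>.\<close>

lemma corner_between_splits_key:
  assumes nD: "near D" and b: "split_side pt D s B1 x1 y1 Z x2 y2"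
    and r: "split_side right_side D t Z u1 w1 R2 u2 w2"
  shows "optimal D"
proof -
  note S = split_sideD[OF b nD] and U = split_sideD[OF r nD]
  have Z: "Z = tri (pt s 0) SE (pt x2 y2)" "Z = tri SE (pt 1 t) (pt (1 - w1) u1)" using S(5) U(4) by simp_all
  have "pt 1 t \<in> tri (pt s 0) SE (pt x2 y2)" using Z tri_vertices by metis
  then have x2: "x2 = 1" using right_touch S(7,11) U(6) by fastforce
  have "pt 1 y2 \<in> tri SE (pt 1 t) (pt (1 - w1) u1)" using Z tri_vertices x2 by metis
  then have "y2 \<le> t" using right_edge_mem(2) U(6,14) by simp
  have "(1 - s) * y2 \<le> (1 - area2 B1) * (1 - area2 R2)"
  proof (rule mult_mono)
    have "s * y1 \<le> s * 1" using S(6,15) by (intro mult_left_mono) auto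
    then show "1 - s \<le> 1 - area2 B1" using S(12) by simp
    have "(1 - t) * w2 \<le> (1 - t) * 1" using U(7,17) by (intro mult_left_mono) auto
    then show "y2 \<le> 1 - area2 R2" using U(13) \<open>y2 \<le> t\<close> by simp
    show "0 \<le> 1 - area2 B1" using near_bounds(2)[OF nD S(1)] by simp
    show "0 \<le> y2" using S(16) by simp
  qed
  then have le: "area2 Z \<le> (1 - area2 B1) * (1 - area2 R2)" using S(13) by simp
  have "B1 \<noteq> R2"
  proof
    assume e: "B1 = R2"
    have "B1 = tri SW (pt s 0) (pt x1 y1)" "R2 = tri (pt 1 t) NE (pt (1 - w2) u2)" using S(4) U(5) by simp_all
    then have "SW \<in> B1" "pt s 0 \<in> B1" "pt 1 t \<in> B1" "NE \<in> B1" unfolding e by (metis tri_vertices)+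
    then have "SE \<in> B1" using bottom_right[OF near_dissection[OF nD] S(1)] S(6) U(7) by fastforce
    then show False using side_mem[of 0 s y1 1 x1] S(4,6,7,14) by auto
  qed
  then show ?thesis using near_key[OF nD S(1) U(2) S(2) _ U(3)[symmetric] S(3) le] by blast
qed

text \<open>Unless \<open>C\<close>, \<open>T\<close>, \<open>B\<close> form a key triple,
  \<open>1 - q < y2\<close>. \<open>R1\<close> and \<open>R2\<close> each have two vertices on the
  right side, strictly off the slanted line of \<open>C\<close>, and so cannot border it. Thus
  \<open>T\<close> borders it at \<open>NW\<close> and \<open>B\<close> at its foot, where they
  overlap.\<close>

lemma adjacent_split_one_corner:
  assumes nD: "near D" and DD: "D = {C, B, R1, R2, T}" and dist: "distinct [C, B, R1, R2, T]"
    and Ce: "C = tri SW (pt s 0) NW" and Be: "B = tri (pt s 0) SE (pt x2 y2)"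
    and R1: "R1 = tri SE (pt 1 h) (pt (1 - w1) u1)" and R2: "R2 = tri (pt 1 h) NE (pt (1 - w2) u2)"
    and Te: "T = tri NW NE (pt xT (1 - q))"
    and ar: "s = area2 C" "(1 - s) * y2 = area2 B" "q = area2 T"
    and rng: "0 < h" "y2 > 0"
  shows "optimal D"
proof -
  note D = near_dissection[OF nD]
  have inD: "C \<in> D" "B \<in> D" "R1 \<in> D" "R2 \<in> D" "T \<in> D" using DD by simp_all
  have b: "3639/10000 \<le> s" "s \<le> 4361/10000" "3639/10000 \<le> q" "q \<le> 4361/10000" "(1 - s) * y2 \<le> 4361/10000"
    unfolding ar(2) using near_bounds[OF nD] inD unfolding ar(1,3) by blast+
  have ne: "C \<noteq> B" "C \<noteq> T" "T \<noteq> B" using dist by auto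
  show ?thesis
  proof (cases "1 - q < y2")
    case False
    have "(1 - area2 C) * y2 \<le> (1 - area2 C) * (1 - area2 T)"
      using False b unfolding ar by (intro mult_left_mono) auto
    then have "area2 B \<le> (1 - area2 C) * (1 - area2 T)" using ar(1,2) by simp
    then show ?thesis using near_key[OF nD inD(1,5,2)] ne by blast
  next
    case high: True
    have y2: "y2 < 774/1000" using height_bound[of "1 - s" y2] b rng by simp
    have V: "SW \<in> C" "pt s 0 \<in> B" "SE \<in> B" "pt x2 y2 \<in> B" "NW \<in> T" "NE \<in> T" "pt xT (1 - q) \<in> T"
      unfolding Ce Be Te by simp_all
    have nm: "NW \<notin> B" "pt s 0 \<notin> T"
      using pt_tri_mem(3)[of 0 1 s 0 1 0 x2 y2 y2] pt_tri_mem(4)[of s 0 0 1 1 1 xT "1 - q" "1 - q"] y2 b rng unfolding Be Te by auto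
    have forms: "tri (pt s 0) NW SW \<in> D" "tri NW (pt s 0) SW \<in> D"
      using inD(1) unfolding Ce tri_def by (simp_all add: insert_commute)
    have nbr: "nb u v w C \<or> nb u v w B \<or> nb u v w R1 \<or> nb u v w R2 \<or> nb u v w T"
      if "tri u v w \<in> D" "0 < u$1 + v$1" "u$1 + v$1 < 2" "0 < u$2 + v$2" "u$2 + v$2 < 2" for u v w
      using nb_ex[OF D that] unfolding DD by blast
    have off: "cr (pt s 0) NW (pt 1 v) < 0" "0 < cr NW (pt s 0) (pt 1 v)" if "0 \<le> v" for v
    proof -
      have "0 \<le> s * v" using b that by simp
      then show "cr (pt s 0) NW (pt 1 v) < 0" "0 < cr NW (pt s 0) (pt 1 v)" using b by (simp_all add: algebra_simps)
    qed
    have n1: "\<not> nb (pt s 0) NW SW X" "\<not> nb NW (pt s 0) SW X" if "X = R1 \<or> X = R2" for X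
      using that nb_on2 off[of 0] off[of h] off[of 1] rng unfolding R1 R2 on2_def by fastforce+
    have "nb (pt s 0) NW SW T" using nbr[OF forms(1)] nb_self[OF _ V(1)] nb_mem nm(1) n1(1) b by auto
    from nb_on2[OF this[unfolded Te]] have xT: "xT = s * q" by (auto simp: on2_def algebra_simps)
    have "nb NW (pt s 0) SW B" using nbr[OF forms(2)] nb_self[OF _ V(1)] nb_mem nm(2) n1(2) b by auto
    from nb_on2[OF this[unfolded Be]] have x2: "x2 = s * (1 - y2)" using b by (auto simp: on2_def algebra_simps)
    have False
    proof (rule overlap[OF D inD(5,2) ne(3) _ _ _ _ _ _ _ _ V(6,3), of s "-s" "1 - q" 1 0 y2])
      show "pt (s + - s * (1 - q)) (1 - q) \<in> T" using V(7) unfolding xT by (simp add: algebra_simps)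
      show "pt (s + - s * 1) 1 \<in> T" using V(5) by simp
      show "pt (s + - s * y2) y2 \<in> B" using V(4) unfolding x2 by (simp add: algebra_simps)
      show "pt (s + - s * 0) 0 \<in> B" using V(2) by simp
    qed (use rng b high in auto)
    then show ?thesis ..
  qed
qed

text \<open>\<open>C\<close> and \<open>T\<close> fill opposite corners, and the situation is
  symmetric under reflection in the line \<open>NW SE\<close>, which exchanges \<open>C\<close> with
  \<open>T\<close> and \<open>B\<close> with \<open>R\<close>. Two key triples are available; if
  neither applies, \<open>B\<close> and \<open>R\<close> are so high that \<open>F\<close> reaches
  the feet of both slanted edges, and the segment joining these feet enters
  \<open>B\<close>.\<close>

lemma adjacent_split_two_corners:
  assumes nD: "near D" and DD: "D = {C, B, R, T, F}" and dist: "distinct [C, B, R, T, F]"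
    and Ce: "C = tri SW (pt s 0) NW" and Be: "B = tri (pt s 0) SE (pt x2 y2)"
    and Re: "R = tri SE (pt 1 (1 - q)) (pt (1 - w) v)" and Te: "T = tri NW NE (pt 1 (1 - q))"
    and ar: "s = area2 C" "(1 - s) * y2 = area2 B" "(1 - q) * w = area2 R" "q = area2 T"
    and rng: "0 < y2" "0 < w" "0 \<le> x2" "x2 \<le> 1" "0 \<le> v" "v \<le> 1"
  shows "optimal D"
proof (rule ccontr)
  assume nopt: "\<not> optimal D"
  note D = near_dissection[OF nD]
  have inD: "C \<in> D" "B \<in> D" "R \<in> D" "T \<in> D" "F \<in> D" using DD by simp_all
  have b: "3639/10000 \<le> s" "s \<le> 4361/10000" "3639/10000 \<le> q" "q \<le> 4361/10000" "(1 - s) * y2 \<le> 4361/10000"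
     "(1 - q) * w \<le> 4361/10000"
    unfolding ar(2,3) using near_bounds[OF nD] inD unfolding ar(1,4) by blast+
  have ne: "C \<noteq> B" "C \<noteq> T" "T \<noteq> B" "T \<noteq> C" "C \<noteq> R" "T \<noteq> R" "B \<noteq> F" "F \<noteq> B" using dist by auto
  have y2: "1 - q < y2"
  proof (rule ccontr)
    assume "\<not> 1 - q < y2"
    then have "(1 - area2 C) * y2 \<le> (1 - area2 C) * (1 - area2 T)" using b unfolding ar by (intro mult_left_mono) auto
    then have "area2 B \<le> (1 - area2 C) * (1 - area2 T)" using ar(1,2) by simp
    then show False using near_key[OF nD inD(1,4,2)] ne nopt by blast
  qed
  have w: "1 - s < w"
  proof (rule ccontr)
    assume "\<not> 1 - s < w"
    then have "(1 - area2 T) * w \<le> (1 - area2 T) * (1 - area2 C)" using b unfolding ar by (intro mult_left_mono) auto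
    then have "area2 R \<le> (1 - area2 T) * (1 - area2 C)" using ar(3,4) by simp
    then show False using near_key[OF nD inD(4,1,3)] ne nopt by blast
  qed
  have small: "y2 < 774/1000" "w < 774/1000" using height_bound[of "1 - s" y2] height_bound[of "1 - q" w] b rng by simp_all
  have V: "SW \<in> C" "pt s 0 \<in> C" "NW \<in> C" "pt s 0 \<in> B" "SE \<in> B" "pt x2 y2 \<in> B"
     "SE \<in> R" "pt 1 (1 - q) \<in> R" "pt (1 - w) v \<in> R" "NW \<in> T" "NE \<in> T" "pt 1 (1 - q) \<in> T"
    unfolding Ce Be Re Te by simp_all
  have in_C: "x \<le> s" if "pt x y \<in> C" for x y using pt_tri_mem(1)[OF that[unfolded Ce], of s] b by simp
  have in_B: "y \<le> y2" if "pt x y \<in> B" for x y using pt_tri_mem(3)[OF that[unfolded Be], of y2] rng by simp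
  have in_R: "1 - w \<le> x" if "pt x y \<in> R" for x y using pt_tri_mem(2)[OF that[unfolded Re], of "1 - w"] rng by simp
  have in_T: "1 - q \<le> y" if "pt x y \<in> T" for x y using pt_tri_mem(4)[OF that[unfolded Te], of "1 - q"] b by simp
  have nm: "NW \<notin> B" "NW \<notin> R" "pt s 0 \<notin> T" "pt 1 (1 - q) \<notin> C" "SE \<notin> T" "SE \<notin> C"
    using in_B[of 0 1] in_R[of 0 1] in_T[of s 0] in_C[of 1 "1 - q"] in_T[of 1 0] in_C[of 1 0] small b by auto
  have nbr: "nb u v w C \<or> nb u v w B \<or> nb u v w R \<or> nb u v w T \<or> nb u v w F"
    if "tri u v w \<in> D" "0 < u$1 + v$1" "u$1 + v$1 < 2" "0 < u$2 + v$2" "u$2 + v$2 < 2" for u v w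
    using nb_ex[OF D that] unfolding DD by blast
  have forms: "tri (pt s 0) NW SW \<in> D" "tri NW (pt s 0) SW \<in> D"
    "tri (pt 1 (1 - q)) NW NE \<in> D" "tri NW (pt 1 (1 - q)) NE \<in> D"
    "tri SE (pt x2 y2) (pt s 0) \<in> D" "tri SE (pt (1 - w) v) (pt 1 (1 - q)) \<in> D"
    using inD(1-4) unfolding Ce Be Re Te tri_def by (simp_all add: insert_commute)
  have sq: "0 < s * q" "s * q < 1" using b mult_strict_mono[of s 1 q 1] by auto
  have K_EK: "nb (pt s 0) NW SW F"
  proof -
    have "\<not> nb (pt s 0) NW SW T"
      using nb_on2[of "pt s 0" "NW" "SW" "NW" "NE" "pt 1 (1 - q)"] sq unfolding Te on2_def by (auto simp: algebra_simps)
    then show ?thesis using nbr[OF forms(1)] nb_self[OF _ V(1)] nb_mem nm(1,2) b by auto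
  qed
  have K_HK: "nb (pt 1 (1 - q)) NW NE F"
  proof -
    have "\<not> nb (pt 1 (1 - q)) NW NE C"
      using nb_on2[of "pt 1 (1 - q)" "NW" "NE" "SW" "pt s 0" "NW"] sq unfolding Ce on2_def by (auto simp: algebra_simps)
    then show ?thesis using nbr[OF forms(3)] nb_self[OF _ V(11)] nb_mem nm(1,2) b by auto
  qed
  obtain f1 f2 f3 where f: "F = tri f1 f2 f3" using dissection_tri[OF D inD(5)] by metis
  have F_EK: "s * (1 - z$2) \<le> z$1" if "z \<in> F" for z
  proof -
    have "- s * (z$1 - s * (1 - z$2)) \<le> 0" using nb_side[OF K_EK that] by (simp add: cr_def algebra_simps)
    then have "0 \<le> z$1 - s * (1 - z$2)" by (rule nonneg_of_neg_mult[rotated]) (use b in simp)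
    then show ?thesis by simp
  qed
  have F_HK: "z$2 \<le> 1 - q * z$1" if "z \<in> F" for z
  proof -
    have "cr (pt 1 (1 - q)) NW NE = - q" by simp
    moreover have "cr (pt 1 (1 - q)) NW z = 1 - q * z$1 - z$2" by (simp add: cr_def algebra_simps)
    ultimately have "- q * (1 - q * z$1 - z$2) \<le> 0" using nb_side[OF K_HK that] by simp
    then have "0 \<le> 1 - q * z$1 - z$2" by (rule nonneg_of_neg_mult[rotated]) (use b in simp)
    then show ?thesis by simp
  qed
  have meet: "\<exists>z\<in>F. cr u v z = 0 \<and> cr u' v' z = 0" if "nb u v a F" "nb u' v' a' F" for u v a u' v' a'
    using nb_on2[OF that(1)[unfolded f]] nb_on2[OF that(2)[unfolded f]] tri_vertices unfolding on2_def f by metis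
  \<comment> \<open>Otherwise \<open>F\<close> borders the edge from \<open>SE\<close> to the apex
    of \<open>B\<close> and has a vertex \<open>z\<close> on both this line and the slanted line of
    \<open>T\<close>. Not being left of the slanted line of \<open>C\<close>, \<open>z\<close> is no
    higher than the apex of \<open>B\<close>; this is too low to meet the line of \<open>T\<close>.
    The value 19019/100000 is 0.4361 squared, rounded up.\<close>
  have not_gamma: "x2 \<noteq> s * (1 - y2)"
  proof
    assume g: "x2 = s * (1 - y2)"
    have "s * (1 - y2) \<le> 4361/10000 * (4361/10000)" using b y2 small by (intro mult_mono) auto
    then have x2: "x2 \<le> 19019/100000" unfolding g by simp
    let ?nb = "nb SE (pt x2 y2) (pt s 0)"
    have "\<not> ?nb R"
    proof
      assume "?nb R"
      from in_R[OF nb_mem[OF this]] have "80981/100000 \<le> w" using x2 by simp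
      then show False using small by simp
    qed
    moreover have "\<not> ?nb T"
      using nb_on2[of "SE" "pt x2 y2" "pt s 0" "NW" "NE" "pt 1 (1 - q)"] x2 b unfolding Te on2_def by auto
    ultimately have "?nb F" using nbr[OF forms(5)] nb_self[OF _ V(2)] nb_self[OF _ V(4)] small rng x2 by auto
    from meet[OF this K_HK] obtain z where z: "z \<in> F" "cr SE (pt x2 y2) z = 0" "cr (pt 1 (1 - q)) NW z = 0" by blast
    have z1: "y2 * (1 - z$1) = (1 - x2) * z$2" using z(2) by (simp add: cr_def algebra_simps)
    have z2: "z$2 = 1 - q * z$1" using z(3) by (simp add: cr_def algebra_simps)
    have "y2 * (s * (1 - z$2)) \<le> y2 * z$1" using F_EK[OF z(1)] rng by (intro mult_left_mono) auto
    then have "(1 - s) * (z$2) \<le> (1 - s) * y2" using z1 unfolding g by (simp add: algebra_simps)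
    then have zy: "z$2 \<le> y2" using b by simp
    have "z$2 * (y2 - q * (1 - x2)) = (1 - q) * y2" using z1 z2 by algebra
    moreover have "0 < (1 - q) * y2" using b rng by simp
    moreover have "0 \<le> z$2" using dissection_subset[OF D inD(5) z(1)] by (simp add: unit_square_iff)
    ultimately have pos: "0 < y2 - q * (1 - x2)" by (metis mult_nonneg_nonpos not_less)
    then have "z$2 * (y2 - q * (1 - x2)) \<le> y2 * (y2 - q * (1 - x2))" using zy by (intro mult_right_mono) auto
    then have "y2 * (1 - q) \<le> y2 * (y2 - q * (1 - x2))" using \<open>z$2 * (y2 - q * (1 - x2)) = (1 - q) * y2\<close> by (simp add: mult.commute)
    then have "1 - q \<le> y2 - q * (1 - x2)" using rng by simp
    moreover have "3639/10000 * (80981/100000) \<le> q * (1 - x2)" using b x2 by (intro mult_mono) auto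
    ultimately show False using small b by simp
  qed
  have EF: "pt s 0 \<in> F"
  proof -
    let ?nb = "nb NW (pt s 0) SW"
    have "\<not> ?nb B" using nb_on2[of "NW" "pt s 0" "SW" "pt s 0" "SE" "pt x2 y2"] b not_gamma unfolding Be on2_def by (auto simp: algebra_simps)
    moreover have "\<not> ?nb R" using nb_on2[of "NW" "pt s 0" "SW" "SE" "pt 1 (1 - q)" "pt (1 - w) v"] b sq unfolding Re on2_def by (auto simp: algebra_simps)
    ultimately show ?thesis using nbr[OF forms(2)] nb_self[OF _ V(1)] nb_mem nm(3) b by auto
  qed
  \<comment> \<open>Mirror image of \<open>not_gamma\<close>, with \<open>R\<close> and the slanted
    line of \<open>T\<close> in place of \<open>B\<close> and that of \<open>C\<close>.\<close>
  have not_gamma': "v \<noteq> 1 - q * (1 - w)"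
  proof
    assume g: "v = 1 - q * (1 - w)"
    have "q * (1 - w) \<le> 4361/10000 * (4361/10000)" using b w small by (intro mult_mono) auto
    then have v: "80981/100000 \<le> v" unfolding g by simp
    let ?nb = "nb SE (pt (1 - w) v) (pt 1 (1 - q))"
    have "\<not> ?nb B"
    proof
      assume "?nb B"
      from in_B[OF nb_mem[OF this]] show False using small v by simp
    qed
    moreover have "\<not> ?nb C"
      using nb_on2[of "SE" "pt (1 - w) v" "pt 1 (1 - q)" "SW" "pt s 0" "NW"] v b unfolding Ce on2_def by auto
    moreover have "\<not> ?nb R" "\<not> ?nb T" using nb_self V(8,12) by blast+
    moreover have "w < 1" "v < 1 \<or> v = 1" using small rng by auto
    ultimately have "?nb F" using nbr[OF forms(6)] small rng v by auto
    from meet[OF this K_EK] obtain z where z: "z \<in> F" "cr SE (pt (1 - w) v) z = 0" "cr (pt s 0) NW z = 0" by blast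
    have z1: "v * (1 - z$1) = w * z$2" using z(2) by (simp add: cr_def algebra_simps)
    have z2: "z$1 = s * (1 - z$2)" using z(3) by (simp add: cr_def algebra_simps)
    have "w * z$2 \<le> w * (1 - q * z$1)" using F_HK[OF z(1)] rng by (intro mult_left_mono) auto
    then have "(1 - q) * (1 - z$1) \<le> (1 - q) * w" using z1 unfolding g by (simp add: algebra_simps)
    then have zw: "1 - z$1 \<le> w" using b by simp
    have "(1 - z$1) * (w - s * v) = (1 - s) * w" using z1 z2 by algebra
    moreover have "0 < (1 - s) * w" using b rng by simp
    moreover have "0 \<le> 1 - z$1" using dissection_subset[OF D inD(5) z(1)] by (simp add: unit_square_iff)
    ultimately have pos: "0 < w - s * v" by (metis mult_nonneg_nonpos not_less)
    then have "(1 - z$1) * (w - s * v) \<le> w * (w - s * v)" using zw by (intro mult_right_mono) auto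
    then have "w * (1 - s) \<le> w * (w - s * v)" using \<open>(1 - z$1) * (w - s * v) = (1 - s) * w\<close> by (simp add: mult.commute)
    then have "1 - s \<le> w - s * v" using rng by simp
    moreover have "3639/10000 * (80981/100000) \<le> s * v" using b v by (intro mult_mono) auto
    ultimately show False using small b by simp
  qed
  have HF: "pt 1 (1 - q) \<in> F"
  proof -
    let ?nb = "nb NW (pt 1 (1 - q)) NE"
    have "\<not> ?nb B" using nb_on2[of "NW" "pt 1 (1 - q)" "NE" "pt s 0" "SE" "pt x2 y2"] b sq unfolding Be on2_def by (auto simp: algebra_simps)
    moreover have "\<not> ?nb R" using nb_on2[of "NW" "pt 1 (1 - q)" "NE" "SE" "pt 1 (1 - q)" "pt (1 - w) v"] b not_gamma' unfolding Re on2_def by (auto simp: algebra_simps)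
    ultimately show ?thesis using nbr[OF forms(4)] nb_self[OF _ V(11)] nb_mem nm(4) b by auto
  qed
  \<comment> \<open>Since \<open>y2 > 1 - q\<close> and \<open>x2 <= 1\<close>, the apex of
    \<open>B\<close> is above the line from \<open>pt s 0\<close> to \<open>pt 1 (1 - q)\<close>, so
    this segment of \<open>F\<close> leaves \<open>pt s 0\<close> inside the angle of
    \<open>B\<close>.\<close>
  have "(1 - q) * (x2 - s) \<le> (1 - q) * (1 - s)" using b rng by (intro mult_left_mono) auto
  also have "\<dots> < y2 * (1 - s)" using y2 b by (intro mult_strict_right_mono) auto
  finally have "0 < (1 - s) * y2 - (1 - q) * (x2 - s)" by (simp add: mult.commute)
  moreover have "0 < (1 - s) * (1 - q)" "0 < (1 - s) * y2" using b rng by simp_all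
  ultimately show False
    using cone_disjoint[OF D inD(5,2) ne(8) EF HF V(4,5,6), of 1] by simp
qed

section \<open>Assembling the cases\<close>

definition full where
  "full D p q \<longleftrightarrow> (\<exists>X\<in>D. p \<in> X \<and> q \<in> X)"

text \<open>A single triangle fills the whole angle at \<open>V\<close>. Like \<open>full\<close>,
  this is phrased by points and containment alone, so that it transforms directly under
  \<open>img\<close> and all cases reduce to a few positions.\<close>

definition corner where
  "corner D V A B \<longleftrightarrow> (\<exists>X\<in>D. V \<in> X \<and> (\<exists>t. 0 < t \<and> t \<le> 1 \<and> V + t *\<^sub>R (A - V) \<in> X) \<and>
    (\<exists>t. 0 < t \<and> t \<le> 1 \<and> V + t *\<^sub>R (B - V) \<in> X))"

definition is_side where
  "is_side c \<longleftrightarrow> c = pt \<or> c = left_side \<or> c = top_side \<or> c = right_side"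

lemma is_side [simp]: "is_side pt" "is_side left_side" "is_side top_side" "is_side right_side"
  by (simp_all add: is_side_def)

lemma side_uniq:
  assumes "is_side c" "triangle_dissection n D" "X \<in> D" "Y \<in> D" "a < t" "t < b" "c a 0 \<in> X" "c b 0 \<in> X" "c t 0 \<in> Y"
  shows "X = Y"
  using assms(1,7-9) side_unique[OF assms(2-6)] unfolding is_side_def by auto

lemma side_seg:
  assumes "is_side c" "triangle_dissection n D" "X \<in> D" "c a 0 \<in> X" "c b 0 \<in> X" "0 \<le> t" "t \<le> 1"
  shows "c (a + t * (b - a)) 0 \<in> X"
  using assms(1) segment_mem[OF assms(2-7)] unfolding is_side_def by (auto simp: pt_between)

lemma side_same:
  assumes c: "is_side c" and D: "triangle_dissection n D" and X: "X \<in> D" "Y \<in> D"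
    and a: "c a 0 \<in> X" "c b 0 \<in> X" "c a' 0 \<in> Y" "c b' 0 \<in> Y" "a < b" "a' < b'" "a < b'" "a' < b"
  shows "X = Y"
proof -
  define m where "m = (max a a' + min b b') / 2"
  have m: "a < m" "m < b" "a' < m" "m < b'" using a unfolding m_def by auto
  define t where "t = (m - a) / (b - a)"
  have t: "0 \<le> t" "t \<le> 1" "a + t * (b - a) = m" using m a(5) unfolding t_def by (auto simp: field_simps)
  have "c m 0 \<in> X" using side_seg[OF c D X(1) a(1,2) t(1,2)] unfolding t(3) .
  then show ?thesis using side_uniq[OF c D X(2,1) m(3,4) a(3,4)] by simp
qed

lemma side_ok_all: "is_side c \<Longrightarrow> side_ok c"
  using side_ok_bottom side_ok_left side_ok_top side_ok_right unfolding is_side_def by blast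

lemma side_full:
  assumes c: "is_side c" and nD: "near D" and f: "full D (c 0 0) (c 1 0)"
  obtains X x y where "full_side c D X x y"
proof -
  have "\<not> split_side c D s X x y X' x' y'" for s X x y X' x' y'
  proof
    assume sp: "split_side c D s X x y X' x' y'"
    note S = split_sideD[OF sp nD]
    obtain Z where Z: "Z \<in> D" "c 0 0 \<in> Z" "c 1 0 \<in> Z" using f unfolding full_def by blast
    have V: "c 0 0 \<in> X" "c s 0 \<in> X" "c s 0 \<in> X'" "c 1 0 \<in> X'" using S(4,5) tri_vertices by metis+
    have "Z = X" using side_same[OF c near_dissection[OF nD] Z(1) S(1) Z(2,3) V(1,2)] S(6) by simp
    moreover have "Z = X'" using side_same[OF c near_dissection[OF nD] Z(1) S(2) Z(2,3) V(3,4)] S(7) by simp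
    ultimately show False using S(3) by simp
  qed
  then show thesis using side_ok_all[OF c] nD that unfolding side_ok_def by blast
qed

lemma side_split:
  assumes c: "is_side c" and nD: "near D" and f: "\<not> full D (c 0 0) (c 1 0)"
  obtains s X x y X' x' y' where "split_side c D s X x y X' x' y'"
proof -
  have "\<not> full_side c D X x y" for X x y
  proof
    assume "full_side c D X x y"
    note F = full_sideD[OF this nD]
    have "c 0 0 \<in> X" "c 1 0 \<in> X" using F(2) tri_vertices by metis+
    then show False using f F(1) unfolding full_def by blast
  qed
  then show thesis using side_ok_all[OF c] nD that unfolding side_ok_def by blast
qed

lemma full_side_vertices:
  assumes "full_side c D X x y" shows "X \<in> D" "c 0 0 \<in> X" "c 1 0 \<in> X"
  using assms tri_vertices unfolding full_side_def by metis+

lemma split_side_vertices: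
  assumes "split_side c D s X x y X' x' y'"
  shows "X \<in> D" "X' \<in> D" "X \<noteq> X'" "c 0 0 \<in> X" "c s 0 \<in> X" "c s 0 \<in> X'" "c 1 0 \<in> X'" "0 < s" "s < 1"
proof -
  show "X \<in> D" "X' \<in> D" "X \<noteq> X'" "c 0 0 \<in> X" "c s 0 \<in> X" "c s 0 \<in> X'" "c 1 0 \<in> X'"
    using assms tri_vertices unfolding split_side_def by metis+
  have "3639/10000 \<le> s" "s \<le> 6361/10000" using assms unfolding split_side_def by blast+
  then show "0 < s" "s < 1" by simp_all
qed

lemmas bottom_split = side_split[OF is_side(1)]
lemmas left_full = side_full[OF is_side(2)]
lemmas top_full = side_full[OF is_side(3), unfolded diff_zero]
lemmas top_split = side_split[OF is_side(3), unfolded diff_zero]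
lemmas right_full = side_full[OF is_side(4), unfolded diff_zero]
lemmas right_split = side_split[OF is_side(4), unfolded diff_zero]

lemma full_comm: "full D p q \<longleftrightarrow> full D q p" by (auto simp: full_def)

lemma full_img: "square_sym f \<Longrightarrow> full (img f D) p q \<longleftrightarrow> full D (f p) (f q)"
proof -
  assume f: "square_sym f"
  have ff: "f (f p) = p" for p using f by (simp add: square_sym_def)
  have "p \<in> f ` X \<longleftrightarrow> f p \<in> X" for p X using ff by (metis imageE imageI)
  then show ?thesis by (simp add: full_def img_def)
qed

lemma corner_img: "square_sym f \<Longrightarrow> corner (img f D) V A B \<longleftrightarrow> corner D (f V) (f A) (f B)"
proof -
  assume f: "square_sym f"
  have ff: "f (f p) = p" for p using f by (simp add: square_sym_def)
  have im: "p \<in> f ` X \<longleftrightarrow> f p \<in> X" for p X using ff by (metis imageE imageI)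
  have "f (p + t *\<^sub>R (q - p)) = f p + t *\<^sub>R (f q - f p)" for p q t
  proof -
    have "\<alpha> + \<beta> + \<gamma> = 1 \<longrightarrow> f (\<alpha> *\<^sub>R a + \<beta> *\<^sub>R b + \<gamma> *\<^sub>R c) = \<alpha> *\<^sub>R f a + \<beta> *\<^sub>R f b + \<gamma> *\<^sub>R f c" for \<alpha> \<beta> \<gamma> a b c
      using f unfolding square_sym_def by blast
    from this[of "1 - t" t 0 p q p] show ?thesis by (simp add: algebra_simps)
  qed
  then show ?thesis by (simp add: corner_def img_def im)
qed

lemma segment_param:
  assumes D: "triangle_dissection n D" "X \<in> D" and sq: "\<And>t. V + t *\<^sub>R (A - V) \<in> unit_square \<Longrightarrow> 0 \<le> t \<and> t \<le> 1"
    and a: "V + a *\<^sub>R (A - V) \<in> X" "V + b *\<^sub>R (A - V) \<in> X" "a \<noteq> b"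
  shows "\<exists>t. 0 < t \<and> t \<le> 1 \<and> V + t *\<^sub>R (A - V) \<in> X"
proof (cases "a = 0")
  case True
  then show ?thesis using a sq[OF dissection_subset[OF D a(2)]] by (intro exI[of _ b]) auto
next
  case False
  then show ?thesis using a sq[OF dissection_subset[OF D a(1)]] by (intro exI[of _ a]) auto
qed

lemma corner_bottom_left:
  assumes D: "triangle_dissection n D" "X \<in> D" and X: "pt a 0 \<in> X" "pt b 0 \<in> X" "a \<noteq> b" "pt 0 c \<in> X" "pt 0 d \<in> X" "c \<noteq> d"
  shows "corner D SW SE NW"
  unfolding corner_def using segment_param[OF D, of "SW" "SE" a b] segment_param[OF D, of "SW" "NW" c d] X
    bottom_left[OF D X] by (intro bexI[OF _ D(2)] conjI) (simp_all add: pt_between unit_square_iff)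

lemma corner_bottom_right:
  assumes D: "triangle_dissection n D" "X \<in> D" and X: "pt a 0 \<in> X" "pt b 0 \<in> X" "a \<noteq> b" "pt 1 c \<in> X" "pt 1 d \<in> X" "c \<noteq> d"
  shows "corner D SE SW NE"
  unfolding corner_def using segment_param[OF D, of "SE" "SW" "1 - a" "1 - b"] segment_param[OF D, of "SE" "NE" c d] X
    bottom_right[OF D X] by (intro bexI[OF _ D(2)] conjI) (simp_all add: pt_between unit_square_iff)

lemma corner_top_left:
  assumes D: "triangle_dissection n D" "X \<in> D" and X: "pt a 1 \<in> X" "pt b 1 \<in> X" "a \<noteq> b" "pt 0 c \<in> X" "pt 0 d \<in> X" "c \<noteq> d"
  shows "corner D NW NE SW"
  unfolding corner_def using segment_param[OF D, of "NW" "NE" a b] segment_param[OF D, of "NW" "SW" "1 - c" "1 - d"] X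
    top_left[OF D X] by (intro bexI[OF _ D(2)] conjI) (simp_all add: pt_between unit_square_iff)

lemma corner_top_right:
  assumes D: "triangle_dissection n D" "X \<in> D" and X: "pt a 1 \<in> X" "pt b 1 \<in> X" "a \<noteq> b" "pt 1 c \<in> X" "pt 1 d \<in> X" "c \<noteq> d"
  shows "corner D NE NW SE"
  unfolding corner_def using segment_param[OF D, of "NE" "NW" "1 - a" "1 - b"] segment_param[OF D, of "NE" "SE" "1 - c" "1 - d"] X
    top_right[OF D X] by (intro bexI[OF _ D(2)] conjI) (simp_all add: pt_between unit_square_iff)

text \<open>Two points suffice to record a base on a side. If a triangle has bases on two sides,
  these are adjacent and it fills their corner; so without filled corners the triangles on different
  sides are distinct and can be counted.\<close>

definition touches :: "(real \<Rightarrow> real \<Rightarrow> real^2) \<Rightarrow> (real^2) set \<Rightarrow> bool" where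
  "touches c X \<longleftrightarrow> (\<exists>a b. a \<noteq> b \<and> c a 0 \<in> X \<and> c b 0 \<in> X)"

lemma split_touches: assumes "split_side c D s X x y X' x' y'" shows "touches c X" "touches c X'"
proof -
  note v = split_side_vertices[OF assms]
  show "touches c X" unfolding touches_def using v(4,5,8) by (intro exI[of _ 0] exI[of _ s]) simp
  show "touches c X'" unfolding touches_def using v(6,7,9) by (intro exI[of _ s] exI[of _ 1]) simp
qed

lemma full_touches: "full_side c D X x y \<Longrightarrow> touches c X"
  unfolding touches_def using full_side_vertices[of c D X x y] by (intro exI[of _ 0] exI[of _ 1]) simp

lemma touches_corner:
  assumes D: "triangle_dissection n D" and X: "X \<in> D"
  shows "touches pt X \<Longrightarrow> touches left_side X \<Longrightarrow> corner D SW SE NW"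
    "touches pt X \<Longrightarrow> touches right_side X \<Longrightarrow> corner D SE SW NE"
    "touches top_side X \<Longrightarrow> touches left_side X \<Longrightarrow> corner D NW NE SW"
    "touches top_side X \<Longrightarrow> touches right_side X \<Longrightarrow> corner D NE NW SE"
    "touches pt X \<Longrightarrow> touches top_side X \<Longrightarrow> False"
    "touches left_side X \<Longrightarrow> touches right_side X \<Longrightarrow> False"
proof -
  have *: "\<exists>a b. c a 0 \<in> X \<and> c b 0 \<in> X \<and> a \<noteq> b" if "touches c X" for c
    using that unfolding touches_def by blast
  have top: "\<exists>a b. pt a 1 \<in> X \<and> pt b 1 \<in> X \<and> a \<noteq> b" if "touches top_side X"
    using *[OF that] by simp
  have right: "\<exists>a b. pt 1 a \<in> X \<and> pt 1 b \<in> X \<and> a \<noteq> b" if "touches right_side X"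
    using *[OF that] by simp
  show "touches pt X \<Longrightarrow> touches left_side X \<Longrightarrow> corner D SW SE NW"
    using *[of pt] *[of "left_side"] corner_bottom_left[OF D X] by metis
  show "touches pt X \<Longrightarrow> touches right_side X \<Longrightarrow> corner D SE SW NE"
    using *[of pt] right corner_bottom_right[OF D X] by metis
  show "touches top_side X \<Longrightarrow> touches left_side X \<Longrightarrow> corner D NW NE SW"
    using top *[of "left_side"] corner_top_left[OF D X] by metis
  show "touches top_side X \<Longrightarrow> touches right_side X \<Longrightarrow> corner D NE NW SE"
    using top right corner_top_right[OF D X] by metis
  show "touches pt X \<Longrightarrow> touches top_side X \<Longrightarrow> False"
    using *[of pt] top bottom_top[OF D X] by metis
  show "touches left_side X \<Longrightarrow> touches right_side X \<Longrightarrow> False"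
    using *[of "left_side"] right left_right[OF D X] by metis
qed

lemma corner_first:
  assumes nD: "near D" and c: "corner D SW SE NW"
    and b: "SW \<in> X" "pt s 0 \<in> X" "0 < s" "X \<in> D" and l: "full_side left_side D L y l"
  shows "L = X"
proof -
  note D = near_dissection[OF nD]
  obtain Z t u where Z: "Z \<in> D" "SW \<in> Z" "0 < t" "pt t 0 \<in> Z" "0 < u" "pt 0 u \<in> Z"
    using c unfolding corner_def by (auto simp: pt_between)
  have "Z = X" using side_same[OF is_side(1) D Z(1) b(4) Z(2,4) b(1,2)] Z b(3) by simp
  moreover have "Z = L"
    using side_same[OF is_side(2) D Z(1) full_side_vertices(1)[OF l], of 0 u 0 1] Z full_side_vertices[OF l] by simp
  ultimately show ?thesis by simp
qed

lemma left_corner_form: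
  assumes nD: "near D" and b: "split_side pt D s C x1 y1 B x2 y2" and l: "full_side left_side D C yL l"
  shows "C = tri SW (pt s 0) NW" "s = area2 C"
proof -
  note S = split_sideD[OF b nD] and L = full_sideD[OF l nD]
  have C1: "C = tri SW (pt s 0) (pt x1 y1)" using S(4) by simp
  have "NW \<in> C" using L(2) by simp
  then have e: "NW = pt x1 y1"
    using tri_apex[of "SW" "pt s 0" "pt x1 y1" "NW" 1] S(6,14,15) unfolding C1 by simp
  then show "C = tri SW (pt s 0) NW" using C1 by simp
  show "s = area2 C" using S(12) e by simp
qed

lemma one_split_corner:
  assumes nD: "near D" and f: "\<not> full D SW SE" "full D SW NW" "full D NW NE" "full D SE NE"
    and c: "corner D SW SE NW"
  shows "optimal D"
proof -
  note D = near_dissection[OF nD]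
  obtain s B1 x1 y1 B x2 y2 where b: "split_side pt D s B1 x1 y1 B x2 y2" by (rule bottom_split[OF nD f(1)])
  obtain L yL l where l: "full_side left_side D L yL l" by (rule left_full[OF nD f(2)])
  obtain T xT q where t: "full_side top_side D T xT q" by (rule top_full[OF nD f(3)])
  obtain R yR r where r: "full_side right_side D R yR r" by (rule right_full[OF nD f(4)])
  note S = split_sideD[OF b nD] and T = full_sideD[OF t nD] and R = full_sideD[OF r nD]
  note Sv = split_side_vertices[OF b]
  have LB: "L = B1" using corner_first[OF nD c Sv(4,5,8,1) l] .
  note C = left_corner_form[OF nD b l[unfolded LB]]
  have Be: "B = tri (pt s 0) SE (pt x2 y2)" using S(5) by simp
  have Te: "T = tri NW NE (pt xT (1 - q))" using T(2) by simp
  have Re: "R = tri SE NE (pt (1 - r) yR)" using R(2) by simp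
  have sb: "s \<le> 4361/10000" using near_bounds(2)[OF nD S(1)] C(2) by simp
  have y2: "y2 \<noteq> 1" using near_bounds(2)[OF nD S(2)] S(13) sb by auto
  have V: "SW \<in> B1" "SE \<in> B" "NW \<in> T" "NE \<in> T" "NE \<in> R" unfolding C(1) Be Te Re by simp_all
  have nm: "NE \<notin> B1" "NE \<notin> B" "NW \<notin> R"
    using pt_tri_mem(1)[of 1 1 0 0 s 0 0 1 s] pt_tri_mem(3)[of 1 1 s 0 1 0 x2 y2 y2] S(16,17) y2
      pt_tri_mem(2)[of 0 1 1 0 1 1 "1 - r" yR "1 - r"] R(6,7) sb Sv(8) unfolding C(1) Be Re by auto
  have n1: "B1 \<noteq> T" "B1 \<noteq> R" using V(4,5) nm(1) by blast+
  have n2: "B \<noteq> T" "B \<noteq> R" using V(4,5) nm(2) by blast+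
  have n3: "R \<noteq> T" using V(3) nm(3) by blast
  have dist: "distinct [B1, B, R, T]" using Sv(3) n1 n2 n3 by simp
  obtain F where F: "distinct [B1, B, R, T, F]" "D = {B1, B, R, T, F}" using fifth_ex[OF nD S(1,2) R(1) T(1) dist] .
  show ?thesis
    by (rule one_split_left_corner[OF nD F(2,1) C(1) Be Re Te C(2) S(13) R(5) T(5) S(10,11) _ R(3,4) T(3,4)]) (use S(16) in simp)
qed

lemma sym_transfer: "square_sym f \<Longrightarrow> near D \<Longrightarrow> (near (img f D) \<Longrightarrow> optimal (img f D)) \<Longrightarrow> optimal D"
  using sym_near sym_optimal by blast

lemma one_split:
  assumes nD: "near D" and f: "\<not> full D SW SE" "full D SW NW" "full D NW NE" "full D SE NE"
  shows "optimal D"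
proof (cases "corner D SW SE NW")
  case True then show ?thesis by (rule one_split_corner[OF nD f])
next
  case O: False
  note D = near_dissection[OF nD]
  show ?thesis
  proof (cases "corner D SE SW NE")
    case True
    show ?thesis
    proof (rule sym_transfer[OF square_sym_flip nD])
      assume "near (img flip_x D)"
      then show "optimal (img flip_x D)"
        by (rule one_split_corner) (use f True in \<open>simp_all add: full_img corner_img square_sym_flip full_comm\<close>)
    qed
  next
    case G: False
    obtain s B1 x1 y1 B x2 y2 where b: "split_side pt D s B1 x1 y1 B x2 y2" by (rule bottom_split[OF nD f(1)])
    obtain L yL l where l: "full_side left_side D L yL l" by (rule left_full[OF nD f(2)])
    obtain T xT q where t: "full_side top_side D T xT q" by (rule top_full[OF nD f(3)])
    obtain R yR r where r: "full_side right_side D R yR r" by (rule right_full[OF nD f(4)])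
    note Sv = split_side_vertices[OF b] and Lv = full_side_vertices[OF l] and Rv = full_side_vertices[OF r]
    have "L \<noteq> B1" using corner_bottom_left[OF D Sv(1), of 0 s 0 1] Sv Lv O by auto
    moreover have "R \<noteq> B" using corner_bottom_right[OF D Sv(2), of s 1 0 1] Sv Rv G by auto
    ultimately show ?thesis using one_split_no_corner[OF nD b r t l] by blast
  qed
qed

lemma opposite_split_corner:
  assumes nD: "near D" and f: "\<not> full D SW SE" "full D SW NW" "\<not> full D NW NE" "full D SE NE"
    and c: "corner D SW SE NW"
  shows False
proof -
  note D = near_dissection[OF nD]
  obtain s B1 x1 y1 B x2 y2 where b: "split_side pt D s B1 x1 y1 B x2 y2" by (rule bottom_split[OF nD f(1)])
  obtain L yL l where l: "full_side left_side D L yL l" by (rule left_full[OF nD f(2)])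
  obtain t T1 x3 h3 T2 x4 h4 where t: "split_side top_side D t T1 x3 h3 T2 x4 h4" by (rule top_split[OF nD f(3)])
  obtain R yR r where r: "full_side right_side D R yR r" by (rule right_full[OF nD f(4)])
  note Sv = split_side_vertices[OF b]
  have LB: "L = B1" using corner_first[OF nD c Sv(4,5,8,1) l] .
  show False by (rule opposite_split_left_corner[OF nD b t l[unfolded LB] r])
qed

lemma flip_y_transfer: "near D \<Longrightarrow> (near (img swap_xy (img flip_x (img swap_xy D))) \<Longrightarrow> optimal (img swap_xy (img flip_x (img swap_xy D)))) \<Longrightarrow> optimal D"
  by (metis sym_near sym_transfer square_sym_flip square_sym_swap)

lemmas img_simps = full_img[OF square_sym_flip] full_img[OF square_sym_swap] corner_img[OF square_sym_flip] corner_img[OF square_sym_swap]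

lemma opposite_split:
  assumes nD: "near D" and f: "\<not> full D SW SE" "full D SW NW" "\<not> full D NW NE" "full D SE NE"
  shows "optimal D"
proof -
  note D = near_dissection[OF nD]
  have f': "\<not> full D SE SW" "full D NW SW" "\<not> full D NE NW" "full D NE SE"
    using f unfolding full_def by blast+
  consider (O) "corner D SW SE NW" | (G) "corner D SE SW NE"
    | (K) "corner D NW NE SW" | (N) "corner D NE NW SE"
    | (none) "\<not> corner D SW SE NW" "\<not> corner D SE SW NE"
      "\<not> corner D NW NE SW" "\<not> corner D NE NW SE" by blast
  then show ?thesis
  proof cases
    case O then show ?thesis using opposite_split_corner[OF nD f] by blast
  next
    case G
    show ?thesis
    proof (rule sym_transfer[OF square_sym_flip nD])
      assume n: "near (img flip_x D)"
      then have False by (rule opposite_split_corner) (use f f' G in \<open>simp_all add: img_simps\<close>)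
      then show "optimal (img flip_x D)" ..
    qed
  next
    case K
    show ?thesis
    proof (rule flip_y_transfer[OF nD])
      let ?D = "img swap_xy (img flip_x (img swap_xy D))"
      assume n: "near ?D"
      then have False by (rule opposite_split_corner) (use f f' K in \<open>simp_all add: img_simps\<close>)
      then show "optimal ?D" ..
    qed
  next
    case N
    show ?thesis
    proof (rule flip_y_transfer[OF nD])
      let ?D = "img swap_xy (img flip_x (img swap_xy D))"
      assume n: "near ?D"
      show "optimal ?D"
      proof (rule sym_transfer[OF square_sym_flip n])
        assume n: "near (img flip_x ?D)"
        then have False by (rule opposite_split_corner) (use f f' N in \<open>simp_all add: img_simps\<close>)
        then show "optimal (img flip_x ?D)" ..
      qed
    qed
  next
    case none
    \<comment> \<open>No corner is filled, so two triangles on the bottom, two on the top and one on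
      each vertical side would be six distinct triangles.\<close>
    obtain s B1 x1 y1 B2 x2 y2 where b: "split_side pt D s B1 x1 y1 B2 x2 y2" by (rule bottom_split[OF nD f(1)])
    obtain L yL l where l: "full_side left_side D L yL l" by (rule left_full[OF nD f(2)])
    obtain t T1 x3 h3 T2 x4 h4 where t: "split_side top_side D t T1 x3 h3 T2 x4 h4" by (rule top_split[OF nD f(3)])
    obtain R yR r where r: "full_side right_side D R yR r" by (rule right_full[OF nD f(4)])
    note tc = split_touches[OF b] split_touches[OF t] full_touches[OF l] full_touches[OF r]
    have inD: "B1 \<in> D" "B2 \<in> D" "T1 \<in> D" "T2 \<in> D" "L \<in> D" "R \<in> D" and ne: "B1 \<noteq> B2" "T1 \<noteq> T2"
      using split_side_vertices(1-3)[OF b] split_side_vertices(1-3)[OF t] full_side_vertices(1)[OF l] full_side_vertices(1)[OF r] by simp_all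
    have "B1 \<noteq> T1" "B1 \<noteq> T2" "B1 \<noteq> L" "B1 \<noteq> R" "B2 \<noteq> T1" "B2 \<noteq> T2" "B2 \<noteq> L" "B2 \<noteq> R" "T1 \<noteq> L" "T1 \<noteq> R" "T2 \<noteq> L" "T2 \<noteq> R" "L \<noteq> R"
      using touches_corner[OF D inD(1)] touches_corner[OF D inD(2)] touches_corner[OF D inD(3)] touches_corner[OF D inD(4)]
        touches_corner[OF D inD(5)] none tc by blast+
    then have "distinct [B1, B2, T1, T2, L, R]" using ne by simp
    then show ?thesis using six_False[OF nD inD] by blast
  qed
qed

lemma corner_between_splits:
  assumes nD: "near D" and f: "\<not> full D SW SE" "\<not> full D SE NE"
    and c: "corner D SE SW NE"
  shows "optimal D"
proof -
  note D = near_dissection[OF nD]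
  obtain s B1 x1 y1 B2 x2 y2 where b: "split_side pt D s B1 x1 y1 B2 x2 y2" by (rule bottom_split[OF nD f(1)])
  obtain h R1 u1 w1 R2 u2 w2 where r: "split_side right_side D h R1 u1 w1 R2 u2 w2" by (rule right_split[OF nD f(2)])
  note Bv = split_side_vertices[OF b] and Rv = split_side_vertices[OF r]
  obtain Z t u where Z: "Z \<in> D" "SE \<in> Z" "0 < t" "pt (1 - t) 0 \<in> Z" "0 < u" "pt 1 u \<in> Z"
    using c unfolding corner_def by (auto simp: pt_between)
  have "Z = B2" using side_same[OF is_side(1) D Z(1) Bv(2) Z(4,2) Bv(6,7)] Z Bv by simp
  moreover have "Z = R1" using side_same[OF is_side(4) D Z(1) Rv(1), of 0 u 0 h] Z Rv by simp
  ultimately have "B2 = R1" by simp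
  then show ?thesis using corner_between_splits_key[OF nD b] r by blast
qed

lemma adjacent_split_corner:
  assumes nD: "near D" and f: "\<not> full D SW SE" "full D SW NW" "full D NW NE" "\<not> full D SE NE"
    and c: "corner D SW SE NW"
  shows "optimal D"
proof (cases "corner D SE SW NE")
  case True then show ?thesis by (rule corner_between_splits[OF nD f(1,4)])
next
  case G: False
  note D = near_dissection[OF nD]
  obtain s B1 x1 y1 B x2 y2 where b: "split_side pt D s B1 x1 y1 B x2 y2" by (rule bottom_split[OF nD f(1)])
  obtain L yL l where l: "full_side left_side D L yL l" by (rule left_full[OF nD f(2)])
  obtain T xT q where t: "full_side top_side D T xT q" by (rule top_full[OF nD f(3)])
  obtain h R1 u1 w1 R2 u2 w2 where r: "split_side right_side D h R1 u1 w1 R2 u2 w2" by (rule right_split[OF nD f(4)])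
  note S = split_sideD[OF b nD] and T = full_sideD[OF t nD] and R = split_sideD[OF r nD]
  have Bv: "B1 \<in> D" "B \<in> D" "B1 \<noteq> B" "SW \<in> B1" "pt s 0 \<in> B1" "pt s 0 \<in> B" "SE \<in> B" "0 \<noteq> s" "s \<noteq> 1" "0 < s"
    using split_side_vertices[OF b] by simp_all
  have Rv: "R1 \<in> D" "R2 \<in> D" "R1 \<noteq> R2" "SE \<in> R1" "pt 1 h \<in> R1" "pt 1 h \<in> R2" "NE \<in> R2" "0 \<noteq> h" "h \<noteq> 1"
    using split_side_vertices[OF r] by simp_all
  have Tv: "T \<in> D" "NW \<in> T" "NE \<in> T" using full_side_vertices[OF t] by simp_all
  have LB: "L = B1" using corner_first[OF nD c Bv(4,5,10,1) l] .
  note C = left_corner_form[OF nD b l[unfolded LB]]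
  have Be: "B = tri (pt s 0) SE (pt x2 y2)" using S(5) by simp
  have Te: "T = tri NW NE (pt xT (1 - q))" using T(2) by simp
  have R1e: "R1 = tri SE (pt 1 h) (pt (1 - w1) u1)" and R2e: "R2 = tri (pt 1 h) NE (pt (1 - w2) u2)"
    using R(4,5) by simp_all
  have sb: "s \<le> 4361/10000" using near_bounds(2)[OF nD S(1)] C(2) by simp
  have nC: "pt 1 v \<notin> B1" for v using pt_tri_mem(1)[of 1 v 0 0 s 0 0 1 s] sb Bv(10) unfolding C(1) by auto
  have n1: "B1 \<noteq> R1" "B1 \<noteq> R2" "B1 \<noteq> T" using nC Rv(4,7) Tv(3) by blast+
  have n2: "B \<noteq> R1" "B \<noteq> R2"
    using corner_bottom_right[OF D Bv(2,6,7,9) _ _ Rv(8)] corner_bottom_right[OF D Bv(2,6,7,9) _ _ Rv(9)] Rv(4-7) G by blast+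
  have 01: "(0::real) \<noteq> 1" by simp
  have n3: "B \<noteq> T" using bottom_top[OF D Bv(2,6,7,9) _ _ 01] Tv(2,3) by blast
  have n4: "R1 \<noteq> T"
  proof
    assume "R1 = T"
    then have "NE \<in> R1" using Tv(3) by simp
    then show False using right_edge_mem(2)[of 1 0 h "1 - w1" u1] R(6,7,14) unfolding R1e by simp
  qed
  show ?thesis
  proof (cases "T = R2")
    case False
    have dist: "distinct [B1, B, R1, R2, T]" using Bv(3) Rv(3) n1 n2 n3 n4 False by simp
    have DD: "D = {B1, B, R1, R2, T}" by (rule five_eq[OF nD Bv(1,2) Rv(1,2) Tv(1) dist])
    show ?thesis by (rule adjacent_split_one_corner[OF nD DD dist C(1) Be R1e R2e Te C(2) S(13) T(5)]) (use R(6) S(16) in simp_all)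
  next
    case True
    \<comment> \<open>\<open>T\<close> is also the upper triangle of the right side and fills the
      corner at \<open>NE\<close>. Its apex is therefore on the right side, and comparing the two
      descriptions of the same triangle gives \<open>h = 1 - q\<close>.\<close>
    have "pt 1 h \<in> T" using Rv(6) True by simp
    have xT: "xT = 1 \<and> 1 - q \<le> h"
    proof (rule ccontr)
      assume a: "\<not> (xT = 1 \<and> 1 - q \<le> h)"
      have "1 - q \<le> h" using pt_tri_mem(4)[OF \<open>pt 1 h \<in> T\<close>[unfolded Te], of "1 - q"] T(6) by simp
      then have x: "xT < 1" using a T(4) by simp
      obtain \<alpha> \<beta> \<gamma> where ab: "0 \<le> \<alpha>" "0 \<le> \<beta>" "0 \<le> \<gamma>" "\<alpha> + \<beta> + \<gamma> = 1"
        "pt 1 h = \<alpha> *\<^sub>R NW + \<beta> *\<^sub>R NE + \<gamma> *\<^sub>R pt xT (1 - q)"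
        using \<open>pt 1 h \<in> T\<close> unfolding Te tri_mem by blast
      then have e: "1 = \<beta> + \<gamma> * xT" "h = \<alpha> + \<beta> + \<gamma> * (1 - q)" by (simp_all add: vec2_eq_iff)
      have "\<alpha> + \<gamma> * (1 - xT) = 0" using e(1) ab(4) by (simp add: algebra_simps)
      moreover have "0 \<le> \<gamma> * (1 - xT)" using ab(3) x by simp
      ultimately have "\<alpha> = 0" "\<gamma> * (1 - xT) = 0" using ab(1) by linarith+
      then have "\<gamma> = 0" using x by simp
      then have "h = 1" using e(2) \<open>\<alpha> = 0\<close> ab(4) by simp
      then show False using Rv(9) by simp
    qed
    have "pt 1 (1 - q) \<in> R2" using True xT tri_vertices(3)[of "pt xT (1 - q)"] unfolding Te[symmetric] by (metis Te tri_vertices(3))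
    then have "h \<le> 1 - q" using right_edge_mem(1)[of "1 - q" h 1 "1 - w2" u2] R(7,16) unfolding R2e by simp
    then have h: "h = 1 - q" using xT by simp
    have Te': "T = tri NW NE (pt 1 (1 - q))" using Te xT by simp
    have dist: "distinct [B1, B, R1, T]" using Bv(3) n1 n2 n3 n4 by simp
    obtain F where F: "distinct [B1, B, R1, T, F]" "D = {B1, B, R1, T, F}" using fifth_ex[OF nD Bv(1,2) Rv(1) Tv(1) dist] .
    show ?thesis
      by (rule adjacent_split_two_corners[OF nD F(2,1) C(1) Be R1e[unfolded h] Te' C(2) S(13) R(12)[unfolded h] T(5) _ _ S(10,11) R(8,9)]) (use S(16) R(14) in simp_all)
  qed
qed

lemma adjacent_split:
  assumes nD: "near D" and f: "\<not> full D SW SE" "full D SW NW" "full D NW NE" "\<not> full D SE NE"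
  shows "optimal D"
proof -
  note D = near_dissection[OF nD]
  have f': "\<not> full D SE SW" "full D NW SW" "full D NE NW" "\<not> full D NE SE"
    using f unfolding full_def by blast+
  consider (O) "corner D SW SE NW" | (G) "corner D SE SW NE"
    | (N) "corner D NE NW SE"
    | (none) "\<not> corner D SW SE NW" "\<not> corner D SE SW NE"
      "\<not> corner D NE NW SE" by blast
  then show ?thesis
  proof cases
    case O then show ?thesis using adjacent_split_corner[OF nD f] by blast
  next
    case G then show ?thesis using corner_between_splits[OF nD f(1,4)] by blast
  next
    case N
    then have N': "corner D NE SE NW" unfolding corner_def by blast
    let ?D = "img flip_x (img swap_xy (img flip_x D))"
    have n: "near ?D" using nD sym_near square_sym_flip square_sym_swap by blast
    then have "optimal ?D" by (rule adjacent_split_corner) (use f f' N N' in \<open>simp_all add: img_simps\<close>)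
    then show ?thesis using nD sym_near sym_optimal square_sym_flip square_sym_swap by blast
  next
    case none
    obtain s B1 x1 y1 B2 x2 y2 where b: "split_side pt D s B1 x1 y1 B2 x2 y2" by (rule bottom_split[OF nD f(1)])
    obtain L yL l where l: "full_side left_side D L yL l" by (rule left_full[OF nD f(2)])
    obtain T xT q where t: "full_side top_side D T xT q" by (rule top_full[OF nD f(3)])
    obtain h R1 u1 w1 R2 u2 w2 where r: "split_side right_side D h R1 u1 w1 R2 u2 w2" by (rule right_split[OF nD f(4)])
    note tc = split_touches[OF b] split_touches[OF r] full_touches[OF l] full_touches[OF t]
    have inD: "B1 \<in> D" "B2 \<in> D" "R1 \<in> D" "R2 \<in> D" "L \<in> D" "T \<in> D" and ne: "B1 \<noteq> B2" "R1 \<noteq> R2"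
      using split_side_vertices(1-3)[OF b] split_side_vertices(1-3)[OF r] full_side_vertices(1)[OF l] full_side_vertices(1)[OF t] by simp_all
    have "B1 \<noteq> R1" "B1 \<noteq> R2" "B1 \<noteq> L" "B1 \<noteq> T" "B2 \<noteq> R1" "B2 \<noteq> R2" "B2 \<noteq> L" "B2 \<noteq> T" "R1 \<noteq> L" "R1 \<noteq> T" "R2 \<noteq> L" "R2 \<noteq> T"
      using touches_corner[OF D inD(1)] touches_corner[OF D inD(2)] touches_corner[OF D inD(3)] touches_corner[OF D inD(4)]
        touches_corner[OF D inD(5)] none tc by blast+
    \<comment> \<open>The corner at \<open>NW\<close> needs no case of its own: a triangle with two
      whole sides of the square would have doubled area 1.\<close>
    moreover have "L \<noteq> T"
    proof
      assume "L = T"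
      then have "NE \<in> L" using full_side_vertices(3)[OF t] by simp
      moreover have "L = tri SW NW (pt l yL)" "l \<le> 4361/10000" "3639/10000 \<le> l" using full_sideD(2,6,7)[OF l nD] by simp_all
      ultimately show False using pt_tri_mem(1)[of 1 1 0 0 0 1 l yL l] by simp
    qed
    ultimately have "distinct [B1, B2, R1, R2, L, T]" using ne by simp
    then show ?thesis using six_False[OF nD inD] by blast
  qed
qed

text \<open>A filled corner between two divided sides gives the key triple; otherwise the three
  divided sides already need six triangles. Nothing is assumed about the left side.\<close>

lemma three_split:
  assumes nD: "near D" and f: "\<not> full D SW SE" "\<not> full D NW NE" "\<not> full D SE NE"
  shows "optimal D"
proof -
  note D = near_dissection[OF nD]
  have f': "\<not> full D SE SW" "\<not> full D NE NW" "\<not> full D NE SE"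
    using f unfolding full_def by blast+
  consider (G) "corner D SE SW NE" | (N) "corner D NE NW SE"
    | (none) "\<not> corner D SE SW NE" "\<not> corner D NE NW SE" by blast
  then show ?thesis
  proof cases
    case G then show ?thesis using corner_between_splits[OF nD f(1,3)] by blast
  next
    case N
    show ?thesis
    proof (rule flip_y_transfer[OF nD])
      let ?D = "img swap_xy (img flip_x (img swap_xy D))"
      assume "near ?D"
      then show "optimal ?D" by (rule corner_between_splits) (use f f' N in \<open>simp_all add: img_simps\<close>)
    qed
  next
    case none
    obtain s B1 x1 y1 B2 x2 y2 where b: "split_side pt D s B1 x1 y1 B2 x2 y2" by (rule bottom_split[OF nD f(1)])
    obtain t T1 x3 h3 T2 x4 h4 where t: "split_side top_side D t T1 x3 h3 T2 x4 h4" by (rule top_split[OF nD f(2)])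
    obtain h R1 u1 w1 R2 u2 w2 where r: "split_side right_side D h R1 u1 w1 R2 u2 w2" by (rule right_split[OF nD f(3)])
    note tc = split_touches[OF b] split_touches[OF t] split_touches[OF r]
    have inD: "B1 \<in> D" "B2 \<in> D" "T1 \<in> D" "T2 \<in> D" "R1 \<in> D" "R2 \<in> D" and ne: "B1 \<noteq> B2" "T1 \<noteq> T2" "R1 \<noteq> R2"
      using split_side_vertices(1-3)[OF b] split_side_vertices(1-3)[OF t] split_side_vertices(1-3)[OF r] by simp_all
    have "B1 \<noteq> T1" "B1 \<noteq> T2" "B1 \<noteq> R1" "B1 \<noteq> R2" "B2 \<noteq> T1" "B2 \<noteq> T2" "B2 \<noteq> R1" "B2 \<noteq> R2" "T1 \<noteq> R1" "T1 \<noteq> R2" "T2 \<noteq> R1" "T2 \<noteq> R2"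
      using touches_corner[OF D inD(1)] touches_corner[OF D inD(2)] touches_corner[OF D inD(3)] touches_corner[OF D inD(4)]
        none tc by blast+
    then have "distinct [B1, B2, T1, T2, R1, R2]" using ne by simp
    then show ?thesis using six_False[OF nD inD] by blast
  qed
qed

lemma bottom_split_optimal:
  assumes nD: "near D" and f: "\<not> full D SW SE" shows "optimal D"
proof -
  have f': "\<not> full D SE SW" using f unfolding full_def by blast
  consider (B) "full D SW NW" "full D NW NE" "full D SE NE"
    | (C) "full D SW NW" "\<not> full D NW NE" "full D SE NE"
    | (D) "full D SW NW" "full D NW NE" "\<not> full D SE NE"
    | (D') "\<not> full D SW NW" "full D NW NE" "full D SE NE"
    | (E) "\<not> full D NW NE" "\<not> full D SE NE"
    | (E') "\<not> full D NW NE" "\<not> full D SW NW"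
    | (E'') "\<not> full D SW NW" "\<not> full D SE NE" by blast
  then show ?thesis
  proof cases
    case B then show ?thesis using one_split[OF nD f] by blast
  next
    case C then show ?thesis using opposite_split[OF nD f] by blast
  next
    case D then show ?thesis using adjacent_split[OF nD f] by blast
  next
    case D'
    then have *: "full D NE NW" unfolding full_def by blast
    show ?thesis
    proof (rule sym_transfer[OF square_sym_flip nD])
      assume "near (img flip_x D)"
      then show "optimal (img flip_x D)" by (rule adjacent_split) (use f' D' * in \<open>simp_all add: img_simps\<close>)
    qed
  next
    case E then show ?thesis using three_split[OF nD f] by blast
  next
    case E'
    then have *: "\<not> full D NE NW" unfolding full_def by blast
    show ?thesis
    proof (rule sym_transfer[OF square_sym_flip nD])
      assume "near (img flip_x D)"
      then show "optimal (img flip_x D)" by (rule three_split) (use f' E' * in \<open>simp_all add: img_simps\<close>)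
    qed
  next
    case E''
    then have *: "\<not> full D NW SW" "\<not> full D NE SE" unfolding full_def by blast+
    show ?thesis
    proof (rule sym_transfer[OF square_sym_swap nD])
      assume n: "near (img swap_xy D)"
      show "optimal (img swap_xy D)"
      proof (rule sym_transfer[OF square_sym_flip n])
        assume "near (img flip_x (img swap_xy D))"
        then show "optimal (img flip_x (img swap_xy D))" by (rule three_split) (use f f' E'' * in \<open>simp_all add: img_simps\<close>)
      qed
    qed
  qed
qed

lemma near_optimal: assumes nD: "near D" shows "optimal D"
proof -
  consider (b) "\<not> full D SW SE" | (l) "\<not> full D SW NW" | (t) "\<not> full D NW NE"
    | (r) "\<not> full D SE NE"
    | (A) "full D SW SE" "full D SW NW" "full D NW NE" "full D SE NE" by blast
  then show ?thesis
  proof cases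
    case b then show ?thesis by (rule bottom_split_optimal[OF nD])
  next
    case l
    show ?thesis
    proof (rule sym_transfer[OF square_sym_swap nD])
      assume "near (img swap_xy D)"
      then show "optimal (img swap_xy D)" by (rule bottom_split_optimal) (use l in \<open>simp add: img_simps\<close>)
    qed
  next
    case t
    show ?thesis
    proof (rule flip_y_transfer[OF nD])
      let ?D = "img swap_xy (img flip_x (img swap_xy D))"
      assume "near ?D"
      then show "optimal ?D" by (rule bottom_split_optimal) (use t in \<open>simp add: img_simps\<close>)
    qed
  next
    case r
    show ?thesis
    proof (rule sym_transfer[OF square_sym_flip nD])
      assume n: "near (img flip_x D)"
      show "optimal (img flip_x D)"
      proof (rule sym_transfer[OF square_sym_swap n])
        assume "near (img swap_xy (img flip_x D))"
        then show "optimal (img swap_xy (img flip_x D))" by (rule bottom_split_optimal) (use r in \<open>simp add: img_simps\<close>)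
      qed
    qed
  next
    case A
    obtain B x1 d1 where b: "full_side pt D B x1 d1" using side_full[OF is_side(1) nD A(1)] .
    obtain L yL l where l: "full_side left_side D L yL l" by (rule left_full[OF nD A(2)])
    obtain T xT q where t: "full_side top_side D T xT q" by (rule top_full[OF nD A(3)])
    obtain R yR r where r: "full_side right_side D R yR r" by (rule right_full[OF nD A(4)])
    show ?thesis using all_sides_full[OF nD b r t l] ..
  qed
qed

section \<open>An optimal dissection\<close>

text \<open>The barycentric coordinates of \<open>p\<close> are the three signed areas divided by
  \<open>cr a b c\<close>.\<close>

lemma tri_mem_cr:
  assumes "0 \<le> cr a b p" "0 \<le> cr b c p" "0 \<le> cr c a p" "0 < cr a b c"
  shows "p \<in> tri a b c"
proof -
  define \<Delta> where "\<Delta> = cr a b c"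
  have \<Delta>: "0 < \<Delta>" using assms unfolding \<Delta>_def by simp
  have "cr b c p + cr c a p + cr a b p = \<Delta>"
    "cr b c p * a$1 + cr c a p * b$1 + cr a b p * c$1 = p$1 * \<Delta>"
    "cr b c p * a$2 + cr c a p * b$2 + cr a b p * c$2 = p$2 * \<Delta>"
    unfolding \<Delta>_def cr_def by algebra+
  then have "cr b c p / \<Delta> + cr c a p / \<Delta> + cr a b p / \<Delta> = 1"
    "p = (cr b c p / \<Delta>) *\<^sub>R a + (cr c a p / \<Delta>) *\<^sub>R b + (cr a b p / \<Delta>) *\<^sub>R c"
    using \<Delta> by (simp_all add: vec2_eq_iff field_simps)
  moreover have "0 \<le> cr b c p / \<Delta>" "0 \<le> cr c a p / \<Delta>" "0 \<le> cr a b p / \<Delta>" using assms \<Delta> by simp_all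
  ultimately show ?thesis unfolding tri_mem by blast
qed

text \<open>A small step from an interior point along the normal \<open>d\<close> stays in
  \<open>X\<close> and strictly increases \<open>cr u v\<close>, so the value before the step was
  negative.\<close>

lemma interior_cr_neg:
  assumes z: "z \<in> interior X" and X: "\<And>p. p \<in> X \<Longrightarrow> cr u v p \<le> 0" and uv: "u \<noteq> v"
  shows "cr u v z < 0"
proof -
  obtain e where e: "e > 0" "ball z e \<subseteq> X" using z mem_interior by blast
  define d where "d = pt (- (v$2 - u$2)) (v$1 - u$1)"
  have "d \<noteq> 0" using uv by (auto simp: d_def vec2_eq_iff)
  define s where "s = e / (2 * norm d)"
  have s: "0 < s" using e \<open>d \<noteq> 0\<close> by (simp add: s_def)
  have "dist z (z + s *\<^sub>R d) < e" using e s \<open>d \<noteq> 0\<close> by (simp add: dist_norm s_def)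
  then have "cr u v (z + s *\<^sub>R d) \<le> 0" using e X by auto
  moreover have "cr u v (z + s *\<^sub>R d) = cr u v z + s * ((v$1 - u$1)^2 + (v$2 - u$2)^2)"
    by (simp add: cr_def d_def power2_eq_square algebra_simps)
  moreover have "0 < (v$1 - u$1)^2 + (v$2 - u$2)^2" using uv by (auto simp: sum_power2_gt_zero_iff vec2_eq_iff)
  then have "0 < s * ((v$1 - u$1)^2 + (v$2 - u$2)^2)" using s by simp
  ultimately show ?thesis by linarith
qed

lemma interior_disjoint_line:
  assumes "u \<noteq> v" "cr u v a \<le> 0" "cr u v b \<le> 0" "cr u v c \<le> 0" "0 \<le> cr u v a'" "0 \<le> cr u v b'" "0 \<le> cr u v c'"
  shows "interior (tri a b c) \<inter> interior (tri a' b' c') = {}"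
proof (rule ccontr)
  assume "interior (tri a b c) \<inter> interior (tri a' b' c') \<noteq> {}"
  then obtain z where z: "z \<in> interior (tri a b c)" "z \<in> interior (tri a' b' c')" by blast
  have "cr u v z < 0"
  proof (rule interior_cr_neg[OF z(1)])
    fix p assume "p \<in> tri a b c"
    then show "cr u v p \<le> 0" using assms(2-4) by (rule tri_cr_le)
  qed (rule assms(1))
  moreover have "cr v u z < 0"
  proof (rule interior_cr_neg[OF z(2)])
    fix p assume "p \<in> tri a' b' c'"
    then show "cr v u p \<le> 0"
      by (rule tri_cr_le) (use assms(5-7) cr_rot(2)[of v u a'] cr_rot(2)[of v u b'] cr_rot(2)[of v u c'] in linarith)+
  qed (use assms in auto)
  ultimately show False using cr_rot(2)[of u v z] by simp
qed

lemma nondegenerate_tri: "cr a b c \<noteq> 0 \<Longrightarrow> nondegenerate_triangle (tri a b c)"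
  unfolding nondegenerate_triangle_def area_tri by (auto simp: tri_def)

text \<open>Three triangles of doubled area \<open>p\<close> with \<open>(1 - p)^2 = p\<close> cut off the corners and leave a triangle with
  apex \<open>NW\<close>, which is bisected by the median from \<open>NW\<close>.\<close>

lemma optimal_exists: "\<exists>D. triangle_dissection 5 D \<and> optimal D"
proof -
  define p where "p = (3 - sqrt 5) / 2"
  have p: "0 < p" "p < 1" "p^2 = 3 * p - 1" using sqrt5_bounds unfolding p_def
    by (auto simp: power2_eq_square field_simps)
  \<comment> \<open>The midpoint of \<open>pt p 0\<close> and \<open>pt 1 (1 - p)\<close>.\<close>
  define N where "N = pt ((1 + p) / 2) ((1 - p) / 2)"
  define A where "A = tri SW (pt p 0) NW"
  define B where "B = tri NW (pt 1 (1 - p)) NE"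
  define C where "C = tri (pt p 0) SE (pt 1 (1 - p))"
  define E where "E = tri NW (pt p 0) N"
  define F where "F = tri NW N (pt 1 (1 - p))"
  define D where "D = {A, B, C, E, F}"
  have pp: "p * p = 3 * p - 1" using p(3) by (simp add: power2_eq_square)
  have pos: "0 < p * p" "p * p < p" "0 < p * (1 - p)" "0 < (1 - p) * (1 - p)" using p(1,2) by simp_all
  have crs: "cr SW (pt p 0) NW = p" "cr NW (pt 1 (1 - p)) NE = p"
    "cr (pt p 0) SE (pt 1 (1 - p)) = p" "cr NW (pt p 0) N = 1 - 3 * p / 2" "cr NW N (pt 1 (1 - p)) = 1 - 3 * p / 2"
    using pp unfolding N_def by (simp_all add: field_simps)
  have p23: "3 * p < 2" using sqrt5_bounds unfolding p_def by simp
  have disj: "interior A \<inter> interior B = {}" "interior A \<inter> interior C = {}" "interior A \<inter> interior E = {}" "interior A \<inter> interior F = {}"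
    "interior B \<inter> interior C = {}" "interior B \<inter> interior E = {}" "interior B \<inter> interior F = {}"
    "interior C \<inter> interior E = {}" "interior C \<inter> interior F = {}" "interior E \<inter> interior F = {}"
  proof -
    have EK: "NW \<noteq> pt p 0" and HK: "NW \<noteq> pt 1 (1 - p)" "pt 1 (1 - p) \<noteq> NW" and EH: "pt 1 (1 - p) \<noteq> pt p 0" "pt p 0 \<noteq> pt 1 (1 - p)" and KN: "NW \<noteq> N"
      using p by (auto simp: N_def)
    show "interior A \<inter> interior B = {}" unfolding A_def B_def
      by (rule interior_disjoint_line[OF EK]) (use p pos in \<open>simp_all add: algebra_simps\<close>)
    show "interior A \<inter> interior C = {}" unfolding A_def C_def
      by (rule interior_disjoint_line[OF EK]) (use p pos in \<open>simp_all add: algebra_simps\<close>)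
    show "interior A \<inter> interior E = {}" unfolding A_def E_def N_def
      by (rule interior_disjoint_line[OF EK]) (use p pos in \<open>simp_all add: field_simps\<close>)
    show "interior A \<inter> interior F = {}" unfolding A_def F_def N_def
      by (rule interior_disjoint_line[OF EK]) (use p pos in \<open>simp_all add: field_simps\<close>)
    show "interior B \<inter> interior C = {}" unfolding B_def C_def
      by (rule interior_disjoint_line[OF HK(2)]) (use p pos in \<open>simp_all add: algebra_simps\<close>)
    show "interior B \<inter> interior E = {}" unfolding B_def E_def N_def
      by (rule interior_disjoint_line[OF HK(2)]) (use p pos in \<open>simp_all add: field_simps\<close>)
    show "interior B \<inter> interior F = {}" unfolding B_def F_def N_def
      by (rule interior_disjoint_line[OF HK(2)]) (use p pos in \<open>simp_all add: field_simps\<close>)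
    show "interior C \<inter> interior E = {}" unfolding C_def E_def N_def
      by (rule interior_disjoint_line[OF EH(2)]) (use p pos in \<open>simp_all add: field_simps\<close>)
    show "interior C \<inter> interior F = {}" unfolding C_def F_def N_def
      by (rule interior_disjoint_line[OF EH(2)]) (use p pos in \<open>simp_all add: field_simps\<close>)
    show "interior E \<inter> interior F = {}" unfolding E_def F_def
      by (rule interior_disjoint_line[OF KN]) (use p pos in \<open>simp_all add: N_def field_simps\<close>)
  qed
  have area: "area A = p / 2" "area B = p / 2" "area C = p / 2" "area E = (1 - 3 * p / 2) / 2" "area F = (1 - 3 * p / 2) / 2"
    unfolding A_def B_def C_def E_def F_def area_tri crs using p p23 by simp_all
  have nz: "cr SW (pt p 0) NW \<noteq> 0" "cr NW (pt 1 (1 - p)) NE \<noteq> 0"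
    "cr (pt p 0) SE (pt 1 (1 - p)) \<noteq> 0" "cr NW (pt p 0) N \<noteq> 0" "cr NW N (pt 1 (1 - p)) \<noteq> 0"
    unfolding crs using p p23 by simp_all
  have ndg: "nondegenerate_triangle X" if "X \<in> D" for X
    using that nz[THEN nondegenerate_tri] unfolding D_def A_def B_def C_def E_def F_def by blast
  have int: "interior X \<noteq> {}" if "X \<in> D" for X
    using that nz[THEN tri_interior_ne] unfolding D_def A_def B_def C_def E_def F_def by blast
  have inD: "A \<in> D" "B \<in> D" "C \<in> D" "E \<in> D" "F \<in> D" unfolding D_def by simp_all
  have "A \<noteq> B" "A \<noteq> C" "A \<noteq> E" "A \<noteq> F" "B \<noteq> C" "B \<noteq> E" "B \<noteq> F" "C \<noteq> E" "C \<noteq> F" "E \<noteq> F"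
    using disj int[OF inD(1)] int[OF inD(2)] int[OF inD(3)] int[OF inD(4)] by (metis Int_absorb)+
  note ne = this
  have "\<Union>D = unit_square"
  proof
    have "convex unit_square" unfolding unit_square_cbox by (rule convex_box)
    then have "X \<subseteq> unit_square" if "X \<in> D" for X
      using that p unfolding D_def A_def B_def C_def E_def F_def N_def
      by (auto intro!: tri_subset del: subsetI simp: unit_square_iff)
    then show "\<Union>D \<subseteq> unit_square" by blast
    show "unit_square \<subseteq> \<Union>D"
    proof
      fix z assume z: "z \<in> unit_square"
      obtain x y where xy: "z = pt x y" using pt_collapse by metis
      have b: "0 \<le> x" "x \<le> 1" "0 \<le> y" "y \<le> 1" using z unfolding xy unit_square_iff by simp_all
      \<comment> \<open>The square is cut along the three sides of the central triangle with
        vertices \<open>NW\<close>, \<open>pt p 0\<close> and \<open>pt 1 (1 - p)\<close>; the side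
        opposite to \<open>NW\<close> has slope 1. Case \<open>d\<close> is inside this triangle,
        and the sign of \<open>cr NW N\<close> then decides between \<open>E\<close> and
        \<open>F\<close>.\<close>
      consider (a) "x + p * y \<le> p" | (b) "p < x + p * y" "1 \<le> y + p * x" | (c) "p < x + p * y" "y + p * x < 1" "y \<le> x - p"
        | (d) "p < x + p * y" "y + p * x < 1" "x - p < y" by linarith
      then show "z \<in> \<Union>D"
      proof cases
        case a
        have "z \<in> A" unfolding A_def xy using p b a by (intro tri_mem_cr) (simp_all add: algebra_simps)
        then show ?thesis using inD by blast
      next
        case b': b
        have "p * x \<le> p * 1" using p b by (intro mult_left_mono) auto
        then have "z \<in> B" unfolding B_def xy using p b b' by (intro tri_mem_cr) (simp_all add: algebra_simps)
        then show ?thesis using inD by blast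
      next
        case c
        have "0 \<le> (1 - p) * (x - p - y)" "0 \<le> (1 - p) * y" "0 \<le> (1 - p) * (1 - x)" using c p b by simp_all
        then have "z \<in> C" unfolding C_def xy using p b c pos by (intro tri_mem_cr) (simp_all add: algebra_simps)
        then show ?thesis using inD by blast
      next
        case d
        have e: "0 \<le> (1 - p) / 2 * (y - x + p)" using d p by simp
        have e1: "cr (pt p 0) N (pt x y) = (1 - p) / 2 * (y - x + p)" "cr N (pt 1 (1 - p)) (pt x y) = (1 - p) / 2 * (y - x + p)"
          unfolding N_def by (simp_all add: field_simps)
        have e2: "0 \<le> cr NW (pt p 0) (pt x y)" "0 \<le> cr (pt 1 (1 - p)) NW (pt x y)"
          using d by (simp_all add: algebra_simps)
        have e3: "cr N NW (pt x y) = - cr NW N (pt x y)" by (rule cr_rot(2))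
        have pos: "0 < cr NW (pt p 0) N" "0 < cr NW N (pt 1 (1 - p))" unfolding crs using p23 by simp_all
        show ?thesis
        proof (cases "cr NW N (pt x y) \<le> 0")
          case True
          have "z \<in> E" unfolding E_def xy by (rule tri_mem_cr) (use True e e1 e2 e3 pos in linarith)+
          then show ?thesis using inD by blast
        next
          case False
          have "z \<in> F" unfolding F_def xy by (rule tri_mem_cr) (use False e e1 e2 pos in linarith)+
          then show ?thesis using inD by blast
        qed
      qed
    qed
  qed
  moreover have "pairwise (\<lambda>S T. interior S \<inter> interior T = {}) D"
    unfolding D_def pairwise_insert using disj disj[THEN Int_commute[THEN trans]]
    by (simp, intro conjI allI impI; elim conjE disjE; simp)
  moreover have "card D = 5" "finite D" using ne unfolding D_def by simp_all
  ultimately have "triangle_dissection 5 D" using ndg unfolding triangle_dissection_def by simp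
  moreover have "optimal D"
  proof -
    have "areas D = {#area A, area B, area C, area E, area F#}" using ne unfolding areas_def D_def by simp
    then show ?thesis unfolding optimal_def area p_def by (simp add: field_simps)
  qed
  ultimately show ?thesis by blast
qed

lemma optimal_range: assumes "triangle_dissection n D" "optimal D" shows "area_range D = R5"
  using range_areas[OF assms(1)] assms(2) sqrt5_bounds unfolding optimal_def R5_def
  by (simp add: max_def min_def field_simps)

theorem theorem1:
  fixes m M :: real
  defines "m \<equiv> (3 - sqrt 5) / 4" and "M \<equiv> (3 * sqrt 5 - 5) / 8"
  shows "(\<forall>D. triangle_dissection 5 D \<longrightarrow> area_range D \<ge> R5) \<and>
         (\<exists>D. triangle_dissection 5 D \<and> area_range D = R5) \<and>
         (\<forall>D. triangle_dissection 5 D \<and> area_range D = R5 \<longrightarrow> areas D = {#m, m, m, M, M#})"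
proof (intro conjI allI impI)
  fix D assume D: "triangle_dissection 5 D"
  show "R5 \<le> area_range D"
  proof (rule ccontr)
    assume "\<not> R5 \<le> area_range D"
    then have "near D" "area_range D \<noteq> R5" using D by (auto simp: near_def)
    then show False using optimal_range[OF D near_optimal] by blast
  qed
next
  show "\<exists>D. triangle_dissection 5 D \<and> area_range D = R5" using optimal_exists optimal_range by blast
next
  fix D assume D: "triangle_dissection 5 D \<and> area_range D = R5"
  then have "near D" by (simp add: near_def)
  from near_optimal[OF this] show "areas D = {#m, m, m, M, M#}" unfolding optimal_def m_def M_def .
qed

end
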